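(* Let $R$ be an integral domain with field of fractions $K$ of characteristic zero, let $\overline{K}$ be an algebraic closure of $K$, and let $\Sigma\subseteq \overline{K}^*_{\times}$ be a cyclotomic Bost-Connes datum. Then the concrete Bost-Connes system $(\mathbb{Z}[\Sigma],\tilde{\sigma}_n,\tilde{\rho}_n)$ is a sub-system of $(\mathbb{W}_0(\overline{K}),Fr_n,V_n)$; that is, there is an injective ring morphism $\mathbb{Z}[\Sigma]\to\mathbb{W}_0(\overline{K})$ which, for all $n\geq 1$, intertwines $\tilde{\sigma}_n$ with $Fr_n$ and $\tilde{\rho}_n$ with $V_n$.
   Context: $\overline{K}^*_{\times}$ is the multiplicative group of non-zero elements of $\overline{K}$ and $\boldsymbol{\mu}_\infty$ its subgroup of all roots of unity. A cyclotomic Bost-Connes datum is a divisible subgroup $\Sigma$ with $\boldsymbol{\mu}_\infty\subseteq\Sigma\subseteq\overline{K}^*_{\times}$, stable under the action of $G=Gal(\overline{K}/K)$. For $x\in\Sigma$ and $n\geq 1$, $\rho_n(x)\subset\Sigma$ is the set of all $n$-th roots of $x$. The concrete Bost-Connes system of $\Sigma$ is the integral group ring $\mathbb{Z}[\Sigma]$ with the induced $G$-action, the ($G$-equivariant) ring endomorphisms $\tilde{\sigma}_n$ induced by $\tilde{\sigma}_n(x)=x^n$ for $x\in\Sigma$, and the ($G$-equivariant) $\mathbb{Z}$-module maps $\tilde{\rho}_n$ induced by $\tilde{\rho}_n(x)=\sum_{x'\in\rho_n(x)}x'$ for $x\in\Sigma$. For a commutative ring $A$, $\mathcal{E}_A$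 is the category of pairs $(E,f)$ with $E$ a projective $A$-module of finite rank and $f\in End_A(E)$, morphisms being module morphisms compatible with the endomorphisms. $K_0(\mathcal{E}_A)$ is its Grothendieck group (relations from short exact sequences), a commutative ring with addition induced by $\oplus$ and multiplication by $(E_1,f_1)\otimes(E_2,f_2)=(E_1\otimes E_2,f_1\otimes f_2)$. $\mathbb{W}_0(A)$ is the quotient of $K_0(\mathcal{E}_A)$ by the ideal consisting of the pairs $(E,0)$. The Frobenius ring endomorphisms are $Fr_n(E,f)=(E,f^n)$. The Verschiebung additive maps are $V_n(E,f)=(E^{\oplus n},F_n)$, where $F_n$ is the $n\times n$ block matrix with $f$ in the upper right corner, identity maps in the positions $(i+1,i)$ for $1\leq i<n$, and zeros elsewhere. *)

theory Defs
  imports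
    "HOL-Algebra.Free_Abelian_Groups"
    "HOL-Algebra.QuotRing"
    "HOL-Algebra.Module"
    "HOL-Algebra.Algebraic_Closure_Type"
begin

hide_const (open) Multiset.mult Polynomial.smult

section \<open>Fields of fractions, algebraic closures, cyclotomic Bost-Connes data\<close>

definition is_fraction_field :: "('r::idom \<Rightarrow> 'k::field) \<Rightarrow> bool" where
  "is_fraction_field j \<longleftrightarrow>
     j \<in> ring_hom ring_of_type_algebra ring_of_type_algebra \<and> inj j \<and>
     (\<forall>z. \<exists>a b. b \<noteq> 0 \<and> z = j a / j b)"

text \<open>The target is algebraically closed by its type class.\<close>

definition is_algebraic_closure :: "('k::field \<Rightarrow> 'c::alg_closed_field) \<Rightarrow> bool" where
  "is_algebraic_closure i \<longleftrightarrow>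
     i \<in> ring_hom ring_of_type_algebra ring_of_type_algebra \<and>
     (\<forall>z. \<exists>p. p \<noteq> 0 \<and> poly (map_poly i p) z = 0)"

definition galois_group :: "('k::field \<Rightarrow> 'c::field) \<Rightarrow> ('c \<Rightarrow> 'c) set" where
  "galois_group i =
     {g \<in> ring_iso ring_of_type_algebra ring_of_type_algebra. \<forall>x. g (i x) = i x}"

definition roots_of_unity :: "'c::field set" where
  "roots_of_unity = {z. \<exists>n\<ge>1. z ^ n = 1}"

definition cyclotomic_datum :: "('k::field \<Rightarrow> 'c::field) \<Rightarrow> 'c set \<Rightarrow> bool" where
  "cyclotomic_datum i \<Sigma> \<longleftrightarrow>
     subgroup \<Sigma> (units_of ring_of_type_algebra) \<and>
     (\<forall>x\<in>\<Sigma>. \<forall>n\<ge>1. \<exists>y\<in>\<Sigma>. y ^ n = x) \<and>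
     roots_of_unity \<subseteq> \<Sigma> \<and>
     (\<forall>g\<in>galois_group i. g ` \<Sigma> \<subseteq> \<Sigma>)"

section \<open>The concrete Bost-Connes system\<close>

text \<open>The \<open>\<int>\<close>-bilinear extension of a binary operation on generators.\<close>

definition frag_bilinear ::
  "('a \<Rightarrow> 'a \<Rightarrow> 'a) \<Rightarrow> ('a \<Rightarrow>\<^sub>0 int) \<Rightarrow> ('a \<Rightarrow>\<^sub>0 int) \<Rightarrow> ('a \<Rightarrow>\<^sub>0 int)" where
  "frag_bilinear m c d = frag_extend (\<lambda>x. frag_extend (\<lambda>y. frag_of (m x y)) d) c"

text \<open>The integral group ring of a multiplicative group \<open>\<Sigma>\<close>. The convolution product that
  \<open>HOL-Library.Poly_Mapping\<close> puts on \<open>\<Rightarrow>\<^sub>0\<close> is for additively written exponents and is not used.\<close>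

definition group_ring :: "'c::comm_monoid_mult set \<Rightarrow> ('c \<Rightarrow>\<^sub>0 int) ring" where
  "group_ring \<Sigma> =
     \<lparr>carrier = {c. Poly_Mapping.keys c \<subseteq> \<Sigma>},
      mult = frag_bilinear (*), one = frag_of 1, zero = 0, add = (+)\<rparr>"

definition bc_sigma :: "nat \<Rightarrow> ('c::field \<Rightarrow>\<^sub>0 int) \<Rightarrow> ('c \<Rightarrow>\<^sub>0 int)" where
  "bc_sigma n = frag_extend (\<lambda>x. frag_of (x ^ n))"

definition bc_rho :: "'c::field set \<Rightarrow> nat \<Rightarrow> ('c \<Rightarrow>\<^sub>0 int) \<Rightarrow> ('c \<Rightarrow>\<^sub>0 int)" where
  "bc_rho \<Sigma> n = frag_extend (\<lambda>x. \<Sum>x' | x' \<in> \<Sigma> \<and> x' ^ n = x. frag_of x')"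

section \<open>Finitely generated projective modules with an endomorphism\<close>

definition mod_homs ::
  "('a, 'm) ring_scheme \<Rightarrow> ('a, 'b) module \<Rightarrow> ('a, 'c) module \<Rightarrow> ('b \<Rightarrow> 'c) set" where
  "mod_homs A M N =
     {h \<in> carrier M \<rightarrow> carrier N.
        (\<forall>x\<in>carrier M. \<forall>y\<in>carrier M. h (x \<oplus>\<^bsub>M\<^esub> y) = h x \<oplus>\<^bsub>N\<^esub> h y) \<and>
        (\<forall>a\<in>carrier A. \<forall>x\<in>carrier M. h (a \<odot>\<^bsub>M\<^esub> x) = a \<odot>\<^bsub>N\<^esub> h x)}"

definition regular_module :: "('a, 'm) ring_scheme \<Rightarrow> ('a, 'a) module" where
  "regular_module A =
     \<lparr>carrier = carrier A, mult = mult A, one = one A, zero = zero A, add = add A,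
      smult = mult A\<rparr>"

text \<open>The fields \<open>mult\<close> and \<open>one\<close> of a module record play no role.\<close>

definition power_module :: "nat \<Rightarrow> ('a, 'b) module \<Rightarrow> ('a, nat \<Rightarrow> 'b) module" where
  "power_module n M =
     \<lparr>carrier = {..<n} \<rightarrow>\<^sub>E carrier M, mult = undefined, one = undefined,
      zero = (\<lambda>k\<in>{..<n}. \<zero>\<^bsub>M\<^esub>),
      add = (\<lambda>v w. \<lambda>k\<in>{..<n}. v k \<oplus>\<^bsub>M\<^esub> w k),
      smult = (\<lambda>a v. \<lambda>k\<in>{..<n}. a \<odot>\<^bsub>M\<^esub> v k)\<rparr>"

text \<open>Projective of finite rank: a direct summand of \<open>A\<^sup>n\<close> for some \<open>n\<close>.\<close>

definition fg_projective :: "('a, 'm) ring_scheme \<Rightarrow> ('a, 'b) module \<Rightarrow> bool" where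
  "fg_projective A M \<longleftrightarrow>
     Module.module A M \<and>
     (\<exists>n. \<exists>i\<in>mod_homs A M (power_module n (regular_module A)).
          \<exists>p\<in>mod_homs A (power_module n (regular_module A)) M.
            \<forall>x\<in>carrier M. p (i x) = x)"

type_synonym ('a, 'b) endo = "('a, 'b) module \<times> ('b \<Rightarrow> 'b)"

definition endo_pairs :: "('a, 'm) ring_scheme \<Rightarrow> ('a, 'b) endo set" where
  "endo_pairs A = {(E, f). fg_projective A E \<and> f \<in> mod_homs A E E}"

definition endo_homs ::
  "('a, 'm) ring_scheme \<Rightarrow> ('a, 'b) endo \<Rightarrow> ('a, 'c) endo \<Rightarrow> ('b \<Rightarrow> 'c) set" where
  "endo_homs A V W =
     {h \<in> mod_homs A (fst V) (fst W). \<forall>x\<in>carrier (fst V). h (snd V x) = snd W (h x)}"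

definition endo_iso :: "('a, 'm) ring_scheme \<Rightarrow> ('a, 'b) endo \<Rightarrow> ('a, 'c) endo \<Rightarrow> bool" where
  "endo_iso A V W \<longleftrightarrow>
     (\<exists>h\<in>endo_homs A V W. bij_betw h (carrier (fst V)) (carrier (fst W)))"

definition short_exact ::
  "('a, 'm) ring_scheme \<Rightarrow> ('a, 'b) endo \<Rightarrow> ('a, 'c) endo \<Rightarrow> ('a, 'd) endo \<Rightarrow> bool" where
  "short_exact A V' V V'' \<longleftrightarrow>
     (\<exists>i\<in>endo_homs A V' V. \<exists>p\<in>endo_homs A V V''.
        inj_on i (carrier (fst V')) \<and>
        i ` carrier (fst V') = {x \<in> carrier (fst V). p x = \<zero>\<^bsub>fst V''\<^esub>} \<and>
        p ` carrier (fst V) = carrier (fst V''))"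

text \<open>
  A quotient of the free abelian group on the objects needs a single type for the underlying sets
  of modules. Over a ring with elements of type \<open>'a\<close> the type \<open>nat \<Rightarrow> 'a\<close> is large enough: it
  contains \<open>A\<^sup>n\<close> for all \<open>n\<close>, hence an isomorphic copy of every finitely generated projective
  module.
\<close>

lemma module_regular: "cring A \<Longrightarrow> Module.module A (regular_module A)"
proof -
  assume "cring A"
  then interpret cring A .
  have "abelian_group (regular_module A)"
  proof (rule abelian_groupI)
    fix x assume "x \<in> carrier (regular_module A)"
    then show "\<exists>y\<in>carrier (regular_module A). y \<oplus>\<^bsub>regular_module A\<^esub> x = \<zero>\<^bsub>regular_module A\<^esub>"
      by (intro bexI[of _ "\<ominus>\<^bsub>A\<^esub> x"]) (auto simp: regular_module_def l_neg)
  qed (auto simp: regular_module_def a_ac)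
  then show ?thesis
    by (intro moduleI[OF is_cring]) (auto simp: regular_module_def l_distr r_distr m_assoc)
qed

lemma module_power: "Module.module A M \<Longrightarrow> Module.module A (power_module n M)"
proof -
  assume "Module.module A M"
  then interpret module A M .
  have ext: "(\<lambda>k\<in>S. v k) = v" if "v \<in> S \<rightarrow>\<^sub>E T" for S :: "nat set" and T v
    using that by (auto simp: PiE_iff extensional_restrict)
  show ?thesis
  proof (rule moduleI[OF R.is_cring])
    show "abelian_group (power_module n M)"
    proof (rule abelian_groupI)
      fix v assume v: "v \<in> carrier (power_module n M)"
      have "(\<lambda>k\<in>{..<n}. \<ominus>\<^bsub>M\<^esub> v k) \<in> carrier (power_module n M)"
           "(\<lambda>k\<in>{..<n}. \<ominus>\<^bsub>M\<^esub> v k) \<oplus>\<^bsub>power_module n M\<^esub> v = \<zero>\<^bsub>power_module n M\<^esub>"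
        using v by (auto simp: power_module_def PiE_iff M.l_neg intro!: restrict_ext)
      then show "\<exists>w\<in>carrier (power_module n M). w \<oplus>\<^bsub>power_module n M\<^esub> v = \<zero>\<^bsub>power_module n M\<^esub>"
        by blast
      show "\<zero>\<^bsub>power_module n M\<^esub> \<oplus>\<^bsub>power_module n M\<^esub> v = v"
        using v ext[of v] by (auto simp: power_module_def PiE_iff cong: restrict_cong)
    qed (auto simp: power_module_def PiE_iff M.a_ac intro!: restrict_ext)
  next
    fix v assume v: "v \<in> carrier (power_module n M)"
    show "\<one>\<^bsub>A\<^esub> \<odot>\<^bsub>power_module n M\<^esub> v = v"
      using v ext[of v] by (auto simp: power_module_def PiE_iff cong: restrict_cong)
  qed (auto simp: power_module_def PiE_iff smult_l_distr smult_r_distr smult_assoc1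
        intro!: restrict_ext)
qed

lemma endo_pairs_universe:
  fixes A :: "('a, 'm) ring_scheme" and V :: "('a, 'b) endo"
  assumes V: "V \<in> endo_pairs A"
  shows "\<exists>W :: ('a, nat \<Rightarrow> 'a) endo. W \<in> endo_pairs A \<and> endo_iso A V W"
proof -
  obtain E f where Ve: "V = (E, f)" and fg: "fg_projective A E" and f: "f \<in> mod_homs A E E"
    using V by (auto simp: endo_pairs_def)
  obtain n i p where E: "Module.module A E"
    and i: "i \<in> mod_homs A E (power_module n (regular_module A))"
    and p: "p \<in> mod_homs A (power_module n (regular_module A)) E"
    and pi: "\<And>x. x \<in> carrier E \<Longrightarrow> p (i x) = x"
    using fg by (auto simp: fg_projective_def)
  interpret E: Module.module A E by (rule E)
  define P where "P = power_module n (regular_module A)"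
  interpret P: Module.module A P
    unfolding P_def by (intro module_power module_regular E.R.is_cring)
  note i = i[folded P_def] and p = p[folded P_def]
  define N where "N = P\<lparr>carrier := i ` carrier E\<rparr>"
  define g where "g = (\<lambda>v. i (f (p v)))"
  have ic: "\<And>x. x \<in> carrier E \<Longrightarrow> i x \<in> carrier P"
    and ia: "\<And>x y. x \<in> carrier E \<Longrightarrow> y \<in> carrier E \<Longrightarrow> i x \<oplus>\<^bsub>P\<^esub> i y = i (x \<oplus>\<^bsub>E\<^esub> y)"
    and im: "\<And>a x. a \<in> carrier A \<Longrightarrow> x \<in> carrier E \<Longrightarrow> a \<odot>\<^bsub>P\<^esub> i x = i (a \<odot>\<^bsub>E\<^esub> x)"
    using i by (auto simp: mod_homs_def)
  have fc: "\<And>x. x \<in> carrier E \<Longrightarrow> f x \<in> carrier E"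
    and fa: "\<And>x y. x \<in> carrier E \<Longrightarrow> y \<in> carrier E \<Longrightarrow> f (x \<oplus>\<^bsub>E\<^esub> y) = f x \<oplus>\<^bsub>E\<^esub> f y"
    and fm: "\<And>a x. a \<in> carrier A \<Longrightarrow> x \<in> carrier E \<Longrightarrow> f (a \<odot>\<^bsub>E\<^esub> x) = a \<odot>\<^bsub>E\<^esub> f x"
    using f by (auto simp: mod_homs_def)
  have pc: "\<And>x. x \<in> carrier P \<Longrightarrow> p x \<in> carrier E"
    and pa: "\<And>x y. x \<in> carrier P \<Longrightarrow> y \<in> carrier P \<Longrightarrow> p (x \<oplus>\<^bsub>P\<^esub> y) = p x \<oplus>\<^bsub>E\<^esub> p y"
    and pm: "\<And>a x. a \<in> carrier A \<Longrightarrow> x \<in> carrier P \<Longrightarrow> p (a \<odot>\<^bsub>P\<^esub> x) = a \<odot>\<^bsub>E\<^esub> p x"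
    using p by (auto simp: mod_homs_def)
  have i0: "i \<zero>\<^bsub>E\<^esub> = \<zero>\<^bsub>P\<^esub>"
  proof -
    have "i \<zero>\<^bsub>E\<^esub> \<oplus>\<^bsub>P\<^esub> i \<zero>\<^bsub>E\<^esub> = i \<zero>\<^bsub>E\<^esub> \<oplus>\<^bsub>P\<^esub> \<zero>\<^bsub>P\<^esub>"
      using ia[of "\<zero>\<^bsub>E\<^esub>" "\<zero>\<^bsub>E\<^esub>"] ic[of "\<zero>\<^bsub>E\<^esub>"] by simp
    then show ?thesis
      using ic[of "\<zero>\<^bsub>E\<^esub>"] P.M.add.l_cancel[of "i \<zero>\<^bsub>E\<^esub>" "i \<zero>\<^bsub>E\<^esub>" "\<zero>\<^bsub>P\<^esub>"] by simp
  qed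
  have Ns: "carrier N = i ` carrier E" "add N = add P" "zero N = zero P"
    "module.smult N = module.smult P"
    by (simp_all add: N_def)
  have N: "Module.module A N"
  proof (rule moduleI[OF E.R.is_cring])
    show "abelian_group N"
    proof (rule abelian_groupI)
      fix v assume "v \<in> carrier N"
      then obtain x where x: "x \<in> carrier E" "v = i x" by (auto simp: Ns)
      have "i (\<ominus>\<^bsub>E\<^esub> x) \<oplus>\<^bsub>N\<^esub> v = \<zero>\<^bsub>N\<^esub>"
        using x by (simp add: Ns ia i0 E.M.l_neg)
      then show "\<exists>w\<in>carrier N. w \<oplus>\<^bsub>N\<^esub> v = \<zero>\<^bsub>N\<^esub>"
        using x by (auto simp: Ns)
    qed (auto simp: Ns ia i0[symmetric] E.M.a_ac)
  qed (auto simp: Ns ia im E.smult_l_distr E.smult_r_distr E.smult_assoc1)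
  have gN: "g \<in> mod_homs A N N"
    by (auto simp: mod_homs_def Ns g_def ia im pi fc fa fm)
  have "i \<in> mod_homs A E N"
    by (auto simp: mod_homs_def Ns ia im)
  moreover have "bij_betw i (carrier E) (carrier N)"
    by (auto simp: bij_betw_def Ns inj_on_def dest: arg_cong[of _ _ p] simp: pi)
  ultimately have "endo_iso A V (N, g)"
    by (auto simp: endo_iso_def endo_homs_def Ve g_def pi intro!: bexI[of _ i])
  moreover have "fg_projective A N"
    unfolding fg_projective_def P_def[symmetric]
  proof (intro conjI N exI[of _ n], fold P_def)
    have "(\<lambda>v. v) \<in> mod_homs A N P"
      by (auto simp: mod_homs_def Ns ic)
    moreover have "(\<lambda>v. i (p v)) \<in> mod_homs A P N"
      by (auto simp: mod_homs_def Ns pc pa pm ia im)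
    ultimately show "\<exists>i\<in>mod_homs A N P. \<exists>p\<in>mod_homs A P N. \<forall>x\<in>carrier N. p (i x) = x"
      by (intro bexI[of _ "\<lambda>v. v"] bexI[of _ "\<lambda>v. i (p v)"]) (auto simp: Ns pi)
  qed
  ultimately show ?thesis
    using gN by (intro exI[of _ "(N, g)"]) (auto simp: endo_pairs_def)
qed

definition endo_rep ::
  "('a, 'm) ring_scheme \<Rightarrow> ('a, 'b) endo \<Rightarrow> ('a, nat \<Rightarrow> 'a) endo" where
  "endo_rep A V = (SOME W. W \<in> endo_pairs A \<and> endo_iso A V W)"

subsection \<open>Tensor products\<close>

definition mod_bilinear ::
  "('a, 'm) ring_scheme \<Rightarrow> ('a, 'b) module \<Rightarrow> ('a, 'c) module \<Rightarrow> ('a, 'd) module \<Rightarrow>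
    ('b \<Rightarrow> 'c \<Rightarrow> 'd) \<Rightarrow> bool" where
  "mod_bilinear A M N P \<beta> \<longleftrightarrow>
     (\<forall>x\<in>carrier M. \<beta> x \<in> mod_homs A N P) \<and>
     (\<forall>y\<in>carrier N. (\<lambda>x. \<beta> x y) \<in> mod_homs A M P)"

text \<open>
  The universal property. The test module \<open>P\<close> ranges over modules with the same type of elements
  as \<open>T\<close>; for finitely generated projective \<open>M\<close> and \<open>N\<close> and \<open>T\<close> over the type \<open>nat \<Rightarrow> 'a\<close> this
  is no restriction, since the usual tensor product then has a copy over that type.
\<close>

definition is_tensor_product ::
  "('a, 'm) ring_scheme \<Rightarrow> ('a, 'b) module \<Rightarrow> ('a, 'c) module \<Rightarrow> ('a, 'd) module \<Rightarrow>
    ('b \<Rightarrow> 'c \<Rightarrow> 'd) \<Rightarrow> bool" where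
  "is_tensor_product A M N T \<tau> \<longleftrightarrow>
     Module.module A T \<and> mod_bilinear A M N T \<tau> \<and>
     (\<forall>(P :: ('a, 'd) module) \<beta>. Module.module A P \<and> mod_bilinear A M N P \<beta> \<longrightarrow>
        (\<exists>h\<in>mod_homs A T P.
           (\<forall>x\<in>carrier M. \<forall>y\<in>carrier N. h (\<tau> x y) = \<beta> x y) \<and>
           (\<forall>h'\<in>mod_homs A T P.
              (\<forall>x\<in>carrier M. \<forall>y\<in>carrier N. h' (\<tau> x y) = \<beta> x y) \<longrightarrow>
              (\<forall>t\<in>carrier T. h' t = h t))))"

definition is_endo_tensor ::
  "('a, 'm) ring_scheme \<Rightarrow> ('a, 'b) endo \<Rightarrow> ('a, 'c) endo \<Rightarrow> ('a, 'd) endo \<Rightarrow> bool" where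
  "is_endo_tensor A V W Z \<longleftrightarrow>
     (\<exists>\<tau>. is_tensor_product A (fst V) (fst W) (fst Z) \<tau> \<and>
        (\<forall>x\<in>carrier (fst V). \<forall>y\<in>carrier (fst W). snd Z (\<tau> x y) = \<tau> (snd V x) (snd W y)))"

definition endo_tensor ::
  "('a, 'm) ring_scheme \<Rightarrow> ('a, nat \<Rightarrow> 'a) endo \<Rightarrow> ('a, nat \<Rightarrow> 'a) endo \<Rightarrow>
    ('a, nat \<Rightarrow> 'a) endo" where
  "endo_tensor A V W = (SOME Z. Z \<in> endo_pairs A \<and> is_endo_tensor A V W Z)"

subsection \<open>Frobenius and Verschiebung on objects\<close>

definition endo_frob :: "nat \<Rightarrow> ('a, 'b) endo \<Rightarrow> ('a, 'b) endo" where
  "endo_frob n V = (fst V, snd V ^^ n)"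

text \<open>The block matrix with \<open>f\<close> in the upper right corner and identities below the diagonal
  acts by \<open>(v\<^sub>1, \<dots>, v\<^sub>n) \<mapsto> (f v\<^sub>n, v\<^sub>1, \<dots>, v\<^sub>n\<^sub>-\<^sub>1)\<close>; positions are numbered from 0 here.\<close>

definition endo_versch :: "nat \<Rightarrow> ('a, 'b) endo \<Rightarrow> ('a, nat \<Rightarrow> 'b) endo" where
  "endo_versch n V =
     (power_module n (fst V),
      \<lambda>v. \<lambda>k\<in>{..<n}. if k = 0 then snd V (v (n - 1)) else v (k - 1))"

section \<open>The Grothendieck ring\<close>

definition K0_free :: "('a, 'm) ring_scheme \<Rightarrow> (('a, nat \<Rightarrow> 'a) endo \<Rightarrow>\<^sub>0 int) monoid" where
  "K0_free A = free_Abelian_group (endo_pairs A)"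

definition K0_null :: "('a, 'm) ring_scheme \<Rightarrow> (('a, nat \<Rightarrow> 'a) endo \<Rightarrow>\<^sub>0 int) set" where
  "K0_null A =
     generate (K0_free A)
       {frag_of V - frag_of V' - frag_of V'' | V' V V''.
          V' \<in> endo_pairs A \<and> V \<in> endo_pairs A \<and> V'' \<in> endo_pairs A \<and> short_exact A V' V V''}"

definition K0_coset ::
  "('a, 'm) ring_scheme \<Rightarrow> (('a, nat \<Rightarrow> 'a) endo \<Rightarrow>\<^sub>0 int) \<Rightarrow>
    (('a, nat \<Rightarrow> 'a) endo \<Rightarrow>\<^sub>0 int) set" where
  "K0_coset A c = K0_null A #>\<^bsub>K0_free A\<^esub> c"

definition K0_class ::
  "('a, 'm) ring_scheme \<Rightarrow> ('a, 'b) endo \<Rightarrow> (('a, nat \<Rightarrow> 'a) endo \<Rightarrow>\<^sub>0 int) set" where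
  "K0_class A V = K0_coset A (frag_of (endo_rep A V))"

text \<open>Products of cosets, and below the induced maps on cosets, are unions of cosets of
  representatives, as in \<^const>\<open>rcoset_mult\<close>.\<close>

definition K0 :: "('a, 'm) ring_scheme \<Rightarrow> (('a, nat \<Rightarrow> 'a) endo \<Rightarrow>\<^sub>0 int) set ring" where
  "K0 A =
     \<lparr>carrier = carrier (K0_free A Mod K0_null A),
      mult = (\<lambda>C D. \<Union>c\<in>C. \<Union>d\<in>D. K0_coset A (frag_bilinear (endo_tensor A) c d)),
      one = K0_class A (regular_module A, id),
      zero = one (K0_free A Mod K0_null A),
      add = mult (K0_free A Mod K0_null A)\<rparr>"

definition K0_map ::
  "('a, 'm) ring_scheme \<Rightarrow> (('a, nat \<Rightarrow> 'a) endo \<Rightarrow> ('a, nat \<Rightarrow> 'a) endo) \<Rightarrow>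
    (('a, nat \<Rightarrow> 'a) endo \<Rightarrow>\<^sub>0 int) set \<Rightarrow> (('a, nat \<Rightarrow> 'a) endo \<Rightarrow>\<^sub>0 int) set" where
  "K0_map A g C = (\<Union>c\<in>C. K0_coset A (frag_extend (\<lambda>V. frag_of (g V)) c))"

section \<open>The ring \<open>W\<^sub>0\<close>\<close>

definition W0_ideal :: "('a, 'm) ring_scheme \<Rightarrow> (('a, nat \<Rightarrow> 'a) endo \<Rightarrow>\<^sub>0 int) set set" where
  "W0_ideal A =
     Idl\<^bsub>K0 A\<^esub> {K0_class A V | V :: ('a, nat \<Rightarrow> 'a) endo.
       V \<in> endo_pairs A \<and> (\<forall>x\<in>carrier (fst V). snd V x = \<zero>\<^bsub>fst V\<^esub>)}"

definition W0 :: "('a, 'm) ring_scheme \<Rightarrow> (('a, nat \<Rightarrow> 'a) endo \<Rightarrow>\<^sub>0 int) set set ring" where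
  "W0 A = K0 A Quot W0_ideal A"

definition W0_map ::
  "('a, 'm) ring_scheme \<Rightarrow> (('a, nat \<Rightarrow> 'a) endo \<Rightarrow> ('a, nat \<Rightarrow> 'a) endo) \<Rightarrow>
    (('a, nat \<Rightarrow> 'a) endo \<Rightarrow>\<^sub>0 int) set set \<Rightarrow> (('a, nat \<Rightarrow> 'a) endo \<Rightarrow>\<^sub>0 int) set set" where
  "W0_map A g Q = (\<Union>C\<in>Q. W0_ideal A +>\<^bsub>K0 A\<^esub> K0_map A g C)"

definition W0_frob where
  "W0_frob A n = W0_map A (endo_frob n)"

definition W0_versch where
  "W0_versch A n = W0_map A (\<lambda>V. endo_rep A (endo_versch n V))"

end

theory Submission
  imports Defs
begin

text \<open>
  Send \<open>(E, f)\<close> to its ghost vector \<open>(tr f\<^sup>k)\<^sub>k\<^sub>\<ge>\<^sub>0\<close>. Traces are additive on short exact sequences and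
  multiplicative on tensor products, so this is a ring homomorphism on \<open>K\<^sub>0\<close>. Over an algebraically
  closed field \<open>K\<close> every \<open>(E, f)\<close> has a filtration with one-dimensional quotients \<open>(K, \<lambda>)\<close>, whose ghost
  vector is \<open>(\<lambda>\<^sup>k)\<^sub>k\<close>, and in characteristic zero the sequences \<open>(\<lambda>\<^sup>k)\<^sub>k\<close> are linearly independent over
  \<open>\<int>\<close>. Hence the ghost map is injective on \<open>K\<^sub>0\<close>, and \<open>W\<^sub>0\<close> arises by forgetting the entry \<open>k = 0\<close>: all
  identities in \<open>K\<^sub>0\<close> and \<open>W\<^sub>0\<close> can be checked on ghost vectors. The embedding sends
  \<open>\<lambda> \<in> \<Sigma>\<close> to the class of \<open>(K, \<lambda>)\<close>. The Verschiebung case comes down to the \<open>k\<close>-th power sum of the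
  \<open>n\<close>-th roots of \<open>x\<close>, which is \<open>n x\<^bsup>k/n\<^esup>\<close> if \<open>n\<close> divides \<open>k\<close> and \<open>0\<close> otherwise.

  Traces of endomorphisms of projective modules are computed with dual bases, that is elements \<open>e\<^sub>i\<close> and
  functionals \<open>\<phi>\<^sub>i\<close> with \<open>x = \<Sum>\<^sub>i \<phi>\<^sub>i(x) e\<^sub>i\<close>, so that no theory of vector space dimension is needed.
\<close>

section \<open>Module homomorphisms\<close>

text \<open>The obstacle lies in the two quotients rather than in the Bost-Connes system. Products
  and induced maps in \<open>K0\<close> and \<open>W0\<close> are unions of cosets over all
  representatives, and tensor products and copies of modules are picked by choice, so neither
  well-definedness nor associativity is visible from the definitions. Once the ghost map is
  injective, each coset is a fibre of it: such a union collapses to one coset as soon as the ghost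
  vector of the result depends only on those of the arguments, and the ring laws are inherited from
  pointwise operations on sequences, without associativity isomorphisms of tensor products. The
  entry k = 0 must go because (E, 0) has vanishing traces for k \<ge> 1, whereas its entry 0 is the
  trace of the identity. On Z[\<Sigma>] nothing is lost by this, since 0 is not in \<Sigma>: a
  relation between the powers with exponent at least 1 is one between all powers with every weight
  multiplied by x, and x can be cancelled.\<close>

abbreviation scalars :: "'a::comm_ring_1 ring" where
  "scalars \<equiv> ring_of_type_algebra"

lemma scalars_simps [simp]:
  "carrier (scalars :: 'a::comm_ring_1 ring) = UNIV"
  "mult scalars = ((*) :: 'a \<Rightarrow> _)" "one scalars = (1 :: 'a)"
  "zero scalars = (0 :: 'a)" "add scalars = ((+) :: 'a \<Rightarrow> _)"
  by (simp_all add: ring_of_type_algebra_def)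

abbreviation scalar_module :: "('a::comm_ring_1, 'a) module" where
  "scalar_module \<equiv> regular_module scalars"

lemma scalar_module_simps [simp]:
  "carrier (scalar_module :: ('a::comm_ring_1, 'a) module) = UNIV"
  "zero scalar_module = (0 :: 'a)" "add scalar_module = ((+) :: 'a \<Rightarrow> _)"
  "module.smult scalar_module = ((*) :: 'a \<Rightarrow> _)"
  by (simp_all add: regular_module_def)

lemma module_scalar_module: "Module.module scalars (scalar_module :: ('a::comm_ring_1, 'a) module)"
  by (intro module_regular cring_from_type_algebra)

text \<open>Bridges two kinds of sums: \<open>finsum\<close> of a record structure and the
  type-class sum. It is applied with h the identity on scalars and with h the evaluation of a
  function at a point.\<close>

lemma (in abelian_monoid) finsum_pointwise:
  assumes "finite I" and "\<And>i. i \<in> I \<Longrightarrow> v i \<in> carrier G"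
    and "h \<zero> = (0 :: 'd::comm_monoid_add)"
    and "\<And>x y. x \<in> carrier G \<Longrightarrow> y \<in> carrier G \<Longrightarrow> h (x \<oplus> y) = h x + h y"
  shows "h (finsum G v I) = (\<Sum>i\<in>I. h (v i))"
  using assms(1,2) by (induction I rule: finite_induct) (auto simp: assms(3,4) Pi_def)

lemma finsum_scalar_module [simp]:
  assumes "finite I"
  shows "finsum (scalar_module :: ('a::comm_ring_1, 'a) module) v I = (\<Sum>i\<in>I. v i)"
proof -
  interpret Module.module scalars "scalar_module :: ('a, 'a) module" by (rule module_scalar_module)
  show ?thesis using M.finsum_pointwise[of I v "\<lambda>x. x"] assms by simp
qed

context
  fixes A :: "('a, 'm) ring_scheme"
begin

lemma mod_homsI:
  assumes "\<And>x. x \<in> carrier M \<Longrightarrow> h x \<in> carrier N"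
    and "\<And>x y. x \<in> carrier M \<Longrightarrow> y \<in> carrier M \<Longrightarrow> h (x \<oplus>\<^bsub>M\<^esub> y) = h x \<oplus>\<^bsub>N\<^esub> h y"
    and "\<And>a x. a \<in> carrier A \<Longrightarrow> x \<in> carrier M \<Longrightarrow> h (a \<odot>\<^bsub>M\<^esub> x) = a \<odot>\<^bsub>N\<^esub> h x"
  shows "h \<in> mod_homs A M N"
  using assms by (auto simp: mod_homs_def)

lemma
  assumes "h \<in> mod_homs A M N"
  shows mod_homs_closed: "x \<in> carrier M \<Longrightarrow> h x \<in> carrier N"
    and mod_homs_add:
      "x \<in> carrier M \<Longrightarrow> y \<in> carrier M \<Longrightarrow> h (x \<oplus>\<^bsub>M\<^esub> y) = h x \<oplus>\<^bsub>N\<^esub> h y"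
    and mod_homs_smult:
      "a \<in> carrier A \<Longrightarrow> x \<in> carrier M \<Longrightarrow> h (a \<odot>\<^bsub>M\<^esub> x) = a \<odot>\<^bsub>N\<^esub> h x"
  using assms by (auto simp: mod_homs_def)

lemma mod_homs_compose:
  assumes "g \<in> mod_homs A N P" "h \<in> mod_homs A M N"
  shows "(\<lambda>x. g (h x)) \<in> mod_homs A M P"
  using assms by (auto simp: mod_homs_def Pi_iff)

lemma mod_homs_funpow: "f \<in> mod_homs A M M \<Longrightarrow> f ^^ k \<in> mod_homs A M M"
proof (induction k)
  case (Suc k)
  then show ?case
    using mod_homs_compose[of f M M "f ^^ k" M] by (simp add: comp_def)
qed (auto simp: mod_homs_def)

lemma mod_homs_zero:
  assumes M: "Module.module A M" and N: "Module.module A N" and h: "h \<in> mod_homs A M N"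
  shows "h \<zero>\<^bsub>M\<^esub> = \<zero>\<^bsub>N\<^esub>"
proof -
  interpret M: Module.module A M by (rule M)
  interpret N: Module.module A N by (rule N)
  have "\<zero>\<^bsub>A\<^esub> \<odot>\<^bsub>N\<^esub> h \<zero>\<^bsub>M\<^esub> = h (\<zero>\<^bsub>A\<^esub> \<odot>\<^bsub>M\<^esub> \<zero>\<^bsub>M\<^esub>)"
    by (rule mod_homs_smult[OF h, symmetric]) auto
  then show ?thesis
    using mod_homs_closed[OF h, of "\<zero>\<^bsub>M\<^esub>"] by simp
qed

lemma mod_homs_finsum:
  assumes M: "Module.module A M" and N: "Module.module A N" and h: "h \<in> mod_homs A M N"
    and v: "\<And>i. i \<in> I \<Longrightarrow> v i \<in> carrier M"
  shows "h (finsum M v I) = finsum N (\<lambda>i. h (v i)) I"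
proof -
  interpret M: Module.module A M by (rule M)
  interpret N: Module.module A N by (rule N)
  show ?thesis using v
  proof (induction I rule: infinite_finite_induct)
    case (insert i I)
    then show ?case
      using mod_homs_closed[OF h] by (simp add: Pi_def mod_homs_add[OF h])
  qed (simp_all add: mod_homs_zero[OF M N h])
qed

lemma endo_homs_funpow:
  assumes h: "h \<in> endo_homs A V W" and f: "snd V \<in> mod_homs A (fst V) (fst V)"
  shows "h \<in> endo_homs A (fst V, snd V ^^ k) (fst W, snd W ^^ k)"
proof -
  have "h ((snd V ^^ k) x) = (snd W ^^ k) (h x)" if "x \<in> carrier (fst V)" for x
  proof (induction k)
    case (Suc k)
    have "(snd V ^^ k) x \<in> carrier (fst V)"
      using mod_homs_closed[OF mod_homs_funpow[OF f] that] .
    then show ?case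
      using Suc h by (simp add: endo_homs_def)
  qed simp
  then show ?thesis using h by (simp add: endo_homs_def)
qed

end

section \<open>Dual bases and traces\<close>

definition dual_basis ::
  "('a::comm_ring_1, 'b) module \<Rightarrow> 'i set \<Rightarrow> ('i \<Rightarrow> 'b) \<Rightarrow> ('i \<Rightarrow> 'b \<Rightarrow> 'a) \<Rightarrow> bool" where
  "dual_basis M I e \<phi> \<longleftrightarrow>
     Module.module scalars M \<and> finite I \<and> e \<in> I \<rightarrow> carrier M \<and>
     \<phi> \<in> I \<rightarrow> mod_homs scalars M scalar_module \<and>
     (\<forall>x\<in>carrier M. (\<Oplus>\<^bsub>M\<^esub>i\<in>I. \<phi> i x \<odot>\<^bsub>M\<^esub> e i) = x)"

lemma dual_basis_functional:
  assumes db: "dual_basis M I e \<phi>" and \<psi>: "\<psi> \<in> mod_homs scalars M scalar_module"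
    and x: "x \<in> carrier M"
  shows "\<psi> x = (\<Sum>i\<in>I. \<phi> i x * \<psi> (e i))"
proof -
  interpret Module.module scalars M using db by (simp add: dual_basis_def)
  have I: "finite I" and e: "\<And>i. i \<in> I \<Longrightarrow> e i \<in> carrier M"
    using db by (auto simp: dual_basis_def)
  have "\<psi> x = \<psi> (\<Oplus>\<^bsub>M\<^esub>i\<in>I. \<phi> i x \<odot>\<^bsub>M\<^esub> e i)"
    using db x by (simp add: dual_basis_def)
  also have "\<dots> = (\<Sum>i\<in>I. \<psi> (\<phi> i x \<odot>\<^bsub>M\<^esub> e i))"
    using I e by (subst mod_homs_finsum[OF module_axioms module_scalar_module \<psi>]) auto
  finally show ?thesis
    using e mod_homs_smult[OF \<psi>] by simp
qed

text \<open>Both sides are the double sum of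
  \<open>\<phi> i (g (e' j)) * \<psi> j (h (e i))\<close>, obtained by expanding one of the two
  composites in the other dual basis. Allowing two modules with unrelated dual bases gives cyclicity
  and independence of the dual basis at once.\<close>

lemma dual_basis_trace_commute:
  assumes I: "dual_basis M I e \<phi>" and J: "dual_basis N J e' \<psi>"
    and g: "g \<in> mod_homs scalars N M" and h: "h \<in> mod_homs scalars M N"
  shows "(\<Sum>i\<in>I. \<phi> i (g (h (e i)))) = (\<Sum>j\<in>J. \<psi> j (h (g (e' j))))"
proof -
  have e: "e i \<in> carrier M" "\<phi> i \<in> mod_homs scalars M scalar_module" if "i \<in> I" for i
    using I that by (auto simp: dual_basis_def)
  have e': "e' j \<in> carrier N" "\<psi> j \<in> mod_homs scalars N scalar_module" if "j \<in> J" for j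
    using J that by (auto simp: dual_basis_def)
  have "(\<Sum>i\<in>I. \<phi> i (g (h (e i)))) = (\<Sum>i\<in>I. \<Sum>j\<in>J. \<psi> j (h (e i)) * \<phi> i (g (e' j)))"
    using e by (intro sum.cong refl dual_basis_functional[OF J mod_homs_compose[OF _ g]]
        mod_homs_closed[OF h])
  also have "\<dots> = (\<Sum>j\<in>J. \<Sum>i\<in>I. \<phi> i (g (e' j)) * \<psi> j (h (e i)))"
    by (subst sum.swap) (simp add: mult.commute)
  also have "\<dots> = (\<Sum>j\<in>J. \<psi> j (h (g (e' j))))"
    using e' by (intro sum.cong refl mod_homs_closed[OF g]
        dual_basis_functional[OF I mod_homs_compose[OF _ h], symmetric])
  finally show ?thesis .
qed

lemma lincomb_mod_homs:
  assumes N: "Module.module scalars N"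
    and \<phi>: "\<And>i. i \<in> I \<Longrightarrow> \<phi> i \<in> mod_homs scalars M scalar_module"
    and v: "\<And>i. i \<in> I \<Longrightarrow> v i \<in> carrier N"
  shows "(\<lambda>x. \<Oplus>\<^bsub>N\<^esub>i\<in>I. \<phi> i x \<odot>\<^bsub>N\<^esub> v i) \<in> mod_homs scalars M N"
proof -
  interpret Module.module scalars N by (rule N)
  show ?thesis
  proof (rule mod_homsI)
    fix x y assume xy: "x \<in> carrier M" "y \<in> carrier M"
    have "(\<Oplus>\<^bsub>N\<^esub>i\<in>I. \<phi> i (x \<oplus>\<^bsub>M\<^esub> y) \<odot>\<^bsub>N\<^esub> v i) =
        (\<Oplus>\<^bsub>N\<^esub>i\<in>I. \<phi> i x \<odot>\<^bsub>N\<^esub> v i \<oplus>\<^bsub>N\<^esub> \<phi> i y \<odot>\<^bsub>N\<^esub> v i)"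
      using v smult_l_distr xy by (intro M.finsum_cong') (auto simp: mod_homs_add[OF \<phi>])
    also have "\<dots> = (\<Oplus>\<^bsub>N\<^esub>i\<in>I. \<phi> i x \<odot>\<^bsub>N\<^esub> v i) \<oplus>\<^bsub>N\<^esub> (\<Oplus>\<^bsub>N\<^esub>i\<in>I. \<phi> i y \<odot>\<^bsub>N\<^esub> v i)"
      using v by (intro M.finsum_addf) auto
    finally show "(\<Oplus>\<^bsub>N\<^esub>i\<in>I. \<phi> i (x \<oplus>\<^bsub>M\<^esub> y) \<odot>\<^bsub>N\<^esub> v i) =
        (\<Oplus>\<^bsub>N\<^esub>i\<in>I. \<phi> i x \<odot>\<^bsub>N\<^esub> v i) \<oplus>\<^bsub>N\<^esub> (\<Oplus>\<^bsub>N\<^esub>i\<in>I. \<phi> i y \<odot>\<^bsub>N\<^esub> v i)" .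
  next
    fix a x assume x: "x \<in> carrier M"
    show "(\<Oplus>\<^bsub>N\<^esub>i\<in>I. \<phi> i (a \<odot>\<^bsub>M\<^esub> x) \<odot>\<^bsub>N\<^esub> v i) = a \<odot>\<^bsub>N\<^esub> (\<Oplus>\<^bsub>N\<^esub>i\<in>I. \<phi> i x \<odot>\<^bsub>N\<^esub> v i)"
    proof (cases "finite I")
      case True
      have "(\<Oplus>\<^bsub>N\<^esub>i\<in>I. \<phi> i (a \<odot>\<^bsub>M\<^esub> x) \<odot>\<^bsub>N\<^esub> v i) = (\<Oplus>\<^bsub>N\<^esub>i\<in>I. a \<odot>\<^bsub>N\<^esub> (\<phi> i x \<odot>\<^bsub>N\<^esub> v i))"
        using v x smult_assoc1 by (intro M.finsum_cong') (auto simp: mod_homs_smult[OF \<phi>])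
      also have "\<dots> = a \<odot>\<^bsub>N\<^esub> (\<Oplus>\<^bsub>N\<^esub>i\<in>I. \<phi> i x \<odot>\<^bsub>N\<^esub> v i)"
        using v True by (intro finsum_smult_ldistr[symmetric]) auto
      finally show ?thesis .
    qed simp
  qed (use v in auto)
qed

lemma dual_basis_reindex:
  assumes db: "dual_basis M I e \<phi>" and b: "bij_betw b J I"
  shows "dual_basis M J (e \<circ> b) (\<phi> \<circ> b)"
proof -
  interpret Module.module scalars M using db by (simp add: dual_basis_def)
  have bJ: "b j \<in> I" if "j \<in> J" for j using b that by (auto simp: bij_betw_def)
  have "(\<Oplus>\<^bsub>M\<^esub>j\<in>J. \<phi> (b j) x \<odot>\<^bsub>M\<^esub> e (b j)) = x" if x: "x \<in> carrier M" for x
  proof -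
    have "(\<lambda>i. \<phi> i x \<odot>\<^bsub>M\<^esub> e i) \<in> b ` J \<rightarrow> carrier M"
      using db x bJ by (force simp: dual_basis_def Pi_iff dest: mod_homs_closed)
    then have "(\<Oplus>\<^bsub>M\<^esub>i\<in>b ` J. \<phi> i x \<odot>\<^bsub>M\<^esub> e i) = (\<Oplus>\<^bsub>M\<^esub>j\<in>J. \<phi> (b j) x \<odot>\<^bsub>M\<^esub> e (b j))"
      using b by (intro M.finsum_reindex) (auto simp: bij_betw_def)
    then show ?thesis
      using db b x by (simp add: dual_basis_def bij_betw_def)
  qed
  then show ?thesis
    using db bij_betw_finite[OF b] bJ by (auto simp: dual_basis_def)
qed

text \<open>A formula can quantify over the elements and functionals but not over the type of their
  indices, so existence statements use initial segments of nat.\<close>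

lemma dual_basis_standardize:
  assumes "dual_basis M I e \<phi>"
  obtains e' \<psi> where "dual_basis M {..<card I} e' \<psi>"
proof -
  have "finite I" using assms by (simp add: dual_basis_def)
  then obtain b where "bij_betw b {..<card I} I"
    using ex_bij_betw_nat_finite by (metis atLeast0LessThan)
  then show ?thesis using dual_basis_reindex[OF assms] that by blast
qed

definition mod_trace :: "('a::comm_ring_1, 'b) module \<Rightarrow> ('b \<Rightarrow> 'b) \<Rightarrow> 'a" where
  "mod_trace M f =
     (SOME t. \<exists>n e \<phi>. dual_basis M {..<n::nat} e \<phi> \<and> t = (\<Sum>i<n. \<phi> i (f (e i))))"

text \<open>Cyclicity with one factor the identity, between two dual bases of the same module, shows
  that the chosen trace agrees with the one computed from any dual basis, over any index
  type.\<close>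

lemma mod_trace_eq:
  assumes db: "dual_basis M I e \<phi>" and f: "f \<in> mod_homs scalars M M"
  shows "mod_trace M f = (\<Sum>i\<in>I. \<phi> i (f (e i)))"
proof -
  obtain e' \<psi> where "dual_basis M {..<card I} e' \<psi>"
    using dual_basis_standardize[OF db] .
  then have "\<exists>t n e \<phi>. dual_basis M {..<n::nat} e \<phi> \<and> t = (\<Sum>i<n. \<phi> i (f (e i)))"
    by blast
  from someI_ex[OF this] obtain n e' \<psi>
    where "dual_basis M {..<n::nat} e' \<psi>" "mod_trace M f = (\<Sum>i<n. \<psi> i (f (e' i)))"
    unfolding mod_trace_def[symmetric] by blast
  then show ?thesis
    using dual_basis_trace_commute[OF _ db f, where h = "\<lambda>x. x"]
    by (simp add: mod_homs_def)
qed

lemma power_module_simps [simp]: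
  "carrier (power_module n M) = {..<n} \<rightarrow>\<^sub>E carrier M"
  "zero (power_module n M) = (\<lambda>k\<in>{..<n}. \<zero>\<^bsub>M\<^esub>)"
  "add (power_module n M) = (\<lambda>v w. \<lambda>k\<in>{..<n}. v k \<oplus>\<^bsub>M\<^esub> w k)"
  "module.smult (power_module n M) = (\<lambda>a v. \<lambda>k\<in>{..<n}. a \<odot>\<^bsub>M\<^esub> v k)"
  by (simp_all add: power_module_def)

lemma finsum_power_module:
  assumes M: "Module.module A M" and I: "finite I"
    and v: "\<And>i. i \<in> I \<Longrightarrow> v i \<in> {..<n} \<rightarrow>\<^sub>E carrier M" and k: "k < n"
  shows "finsum (power_module n M) v I k = (\<Oplus>\<^bsub>M\<^esub>i\<in>I. v i k)"
proof -
  have "(\<lambda>w. w k) \<in> mod_homs A (power_module n M) M"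
    using k by (auto simp: mod_homs_def)
  then show ?thesis
    using mod_homs_finsum[OF module_power[OF M] M, of "\<lambda>w. w k" n I v] v by simp
qed

lemma dual_basis_power_module:
  assumes db: "dual_basis M I e \<phi>"
  shows "dual_basis (power_module n M) ({..<n} \<times> I)
           (\<lambda>(j, i). \<lambda>k\<in>{..<n}. if k = j then e i else \<zero>\<^bsub>M\<^esub>) (\<lambda>(j, i) v. \<phi> i (v j))"
    (is "dual_basis ?P ?I ?e ?\<phi>")
proof -
  interpret Module.module scalars M using db by (simp add: dual_basis_def)
  interpret P: Module.module scalars ?P by (rule module_power[OF module_axioms])
  have I: "finite I" and e: "\<And>i. i \<in> I \<Longrightarrow> e i \<in> carrier M"
    and \<phi>: "\<And>i. i \<in> I \<Longrightarrow> \<phi> i \<in> mod_homs scalars M scalar_module"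
    using db by (auto simp: dual_basis_def)
  have "(\<Oplus>\<^bsub>?P\<^esub>p\<in>?I. ?\<phi> p v \<odot>\<^bsub>?P\<^esub> ?e p) = v" (is "?s = _")
    if v: "v \<in> carrier ?P" for v
  proof (rule PiE_ext)
    show "?s \<in> {..<n} \<rightarrow>\<^sub>E carrier M"
    proof -
      have "?\<phi> p v \<odot>\<^bsub>?P\<^esub> ?e p \<in> carrier ?P" if "p \<in> ?I" for p
        using that e by auto
      then have "?s \<in> carrier ?P" by (intro P.M.finsum_closed) blast
      then show ?thesis by simp
    qed
    show "v \<in> {..<n} \<rightarrow>\<^sub>E carrier M" using v by simp
    fix k assume k: "k \<in> {..<n}"
    have "?s k = (\<Oplus>\<^bsub>M\<^esub>p\<in>?I. (?\<phi> p v \<odot>\<^bsub>?P\<^esub> ?e p) k)"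
      using k I e by (intro finsum_power_module[OF module_axioms]) auto
    also have "\<dots> = (\<Oplus>\<^bsub>M\<^esub>p\<in>{k} \<times> I. \<phi> (snd p) (v k) \<odot>\<^bsub>M\<^esub> e (snd p))"
      using k I e by (intro M.add.finprod_mono_neutral_cong_right) (auto split: if_splits)
    also have "\<dots> = (\<Oplus>\<^bsub>M\<^esub>p\<in>Pair k ` I. \<phi> (snd p) (v k) \<odot>\<^bsub>M\<^esub> e (snd p))"
      by (rule arg_cong[where f = "finsum M _"]) auto
    also have "\<dots> = (\<Oplus>\<^bsub>M\<^esub>i\<in>I. \<phi> i (v k) \<odot>\<^bsub>M\<^esub> e i)"
      using e by (subst M.finsum_reindex) (auto simp: inj_on_def)
    also have "\<dots> = v k"
      using db v k by (auto simp: dual_basis_def PiE_iff)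
    finally show "?s k = v k" .
  qed
  moreover have "?\<phi> p \<in> mod_homs scalars ?P scalar_module" if "p \<in> ?I" for p
    using that \<phi> by (auto simp: mod_homs_def Pi_iff PiE_iff)
  moreover have "?e p \<in> carrier ?P" if "p \<in> ?I" for p
    using that e by (auto split: if_splits)
  ultimately show ?thesis
    using I P.module_axioms unfolding dual_basis_def by blast
qed

lemma dual_basis_scalar_module: "dual_basis scalar_module {()} (\<lambda>_. 1) (\<lambda>_ x. x)"
  by (auto simp: dual_basis_def module_scalar_module mod_homs_def)

text \<open>Expand \<open>i x\<close> in M and push the expansion forward along p. The index set is
  kept even when the retract is smaller, which is how redundant dual bases arise.\<close>

lemma dual_basis_retract:
  assumes db: "dual_basis M I e \<phi>" and N: "Module.module scalars N"
    and i: "i \<in> mod_homs scalars N M" and p: "p \<in> mod_homs scalars M N"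
    and pi: "\<And>x. x \<in> carrier N \<Longrightarrow> p (i x) = x"
  shows "dual_basis N I (\<lambda>k. p (e k)) (\<lambda>k x. \<phi> k (i x))"
proof -
  have M: "Module.module scalars M" using db by (simp add: dual_basis_def)
  interpret M: Module.module scalars M by (rule M)
  interpret N: Module.module scalars N by (rule N)
  have e: "\<And>k. k \<in> I \<Longrightarrow> e k \<in> carrier M" using db by (auto simp: dual_basis_def)
  have "(\<Oplus>\<^bsub>N\<^esub>k\<in>I. \<phi> k (i x) \<odot>\<^bsub>N\<^esub> p (e k)) = x" if x: "x \<in> carrier N" for x
  proof -
    have "x = p (\<Oplus>\<^bsub>M\<^esub>k\<in>I. \<phi> k (i x) \<odot>\<^bsub>M\<^esub> e k)"
      using db pi[OF x] mod_homs_closed[OF i x] by (simp add: dual_basis_def)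
    also have "\<dots> = (\<Oplus>\<^bsub>N\<^esub>k\<in>I. p (\<phi> k (i x) \<odot>\<^bsub>M\<^esub> e k))"
      using e by (intro mod_homs_finsum[OF M N p]) auto
    also have "\<dots> = (\<Oplus>\<^bsub>N\<^esub>k\<in>I. \<phi> k (i x) \<odot>\<^bsub>N\<^esub> p (e k))"
      using e mod_homs_closed[OF p]
      by (intro N.finsum_cong') (auto simp: mod_homs_smult[OF p])
    finally show ?thesis by simp
  qed
  then show ?thesis
    using db N mod_homs_closed[OF p]
    by (auto simp: dual_basis_def Pi_iff intro!: mod_homs_compose[OF _ i])
qed

text \<open>This is the dual basis lemma: the coordinates \<open>\<phi> k x\<close> embed the module
  into a power of the ring, and linear combinations of the \<open>e k\<close> retract that power
  onto it.\<close>

lemma fg_projective_iff_dual_basis: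
  fixes M :: "('a::comm_ring_1, 'b) module"
  shows
  "fg_projective scalars M \<longleftrightarrow> (\<exists>n e \<phi>. dual_basis M {..<n::nat} e \<phi>)"
proof
  assume "fg_projective scalars M"
  then obtain n i p where M: "Module.module scalars M"
    and i: "i \<in> mod_homs scalars M (power_module n scalar_module)"
    and p: "p \<in> mod_homs scalars (power_module n scalar_module) M"
    and pi: "\<And>x. x \<in> carrier M \<Longrightarrow> p (i x) = x"
    by (auto simp: fg_projective_def)
  from dual_basis_retract[OF dual_basis_power_module[OF dual_basis_scalar_module, of n] M i p] pi
  show "\<exists>n e \<phi>. dual_basis M {..<n::nat} e \<phi>"
    by (blast elim: dual_basis_standardize)
next
  assume "\<exists>n e \<phi>. dual_basis M {..<n::nat} e \<phi>"
  then obtain n e \<phi> where db: "dual_basis M {..<n::nat} e \<phi>" by blast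
  interpret Module.module scalars M using db by (simp add: dual_basis_def)
  have e: "\<And>i. i < n \<Longrightarrow> e i \<in> carrier M"
    and \<phi>: "\<And>i. i < n \<Longrightarrow> \<phi> i \<in> mod_homs scalars M scalar_module"
    using db by (auto simp: dual_basis_def)
  let ?P = "power_module n (scalar_module :: ('a, 'a) module)"
  have "(\<lambda>x. \<lambda>k\<in>{..<n}. \<phi> k x) \<in> mod_homs scalars M ?P"
    using \<phi> by (auto simp: mod_homs_def intro!: restrict_ext)
  moreover have "(\<lambda>v. \<Oplus>\<^bsub>M\<^esub>k\<in>{..<n}. v k \<odot>\<^bsub>M\<^esub> e k) \<in> mod_homs scalars ?P M"
    using e by (intro lincomb_mod_homs module_axioms) (auto simp: mod_homs_def)
  moreover have "(\<Oplus>\<^bsub>M\<^esub>k\<in>{..<n}. (\<lambda>k\<in>{..<n}. \<phi> k x) k \<odot>\<^bsub>M\<^esub> e k) = x" if "x \<in> carrier M" for x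
    using db that e by (simp add: dual_basis_def cong: M.finsum_cong)
  ultimately show "fg_projective scalars M"
    unfolding fg_projective_def
    by (intro conjI module_axioms exI[of _ n] bexI[of _ "\<lambda>x. \<lambda>k\<in>{..<n}. \<phi> k x"]
        bexI[of _ "\<lambda>v. \<Oplus>\<^bsub>M\<^esub>k\<in>{..<n}. v k \<odot>\<^bsub>M\<^esub> e k"]) auto
qed

lemma fg_projectiveI: "dual_basis M I e \<phi> \<Longrightarrow> fg_projective scalars M"
  using fg_projective_iff_dual_basis dual_basis_standardize by metis

section \<open>Cyclicity, additivity and isomorphism invariance of the trace\<close>

lemma mod_homs_inv_into:
  assumes M: "Module.module A M"
    and h: "h \<in> mod_homs A M N" and b: "bij_betw h (carrier M) (carrier N)"
  shows "inv_into (carrier M) h \<in> mod_homs A N M"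
proof -
  interpret M: Module.module A M by (rule M)
  let ?k = "inv_into (carrier M) h"
  have k: "?k y \<in> carrier M" "h (?k y) = y" if "y \<in> carrier N" for y
    using b that by (auto simp: bij_betw_def inv_into_into f_inv_into_f)
  have eq: "?k y = x" if "x \<in> carrier M" "h x = y" for x y
    using b that by (auto simp: bij_betw_def inv_into_f_f)
  show ?thesis
    by (rule mod_homsI)
      (auto simp: k mod_homs_add[OF h] mod_homs_smult[OF h] intro!: eq)
qed

lemma endo_pairsD:
  assumes "V \<in> endo_pairs A"
  shows "fg_projective A (fst V)" "snd V \<in> mod_homs A (fst V) (fst V)"
    "Module.module A (fst V)"
  using assms by (auto simp: endo_pairs_def) (auto simp: fg_projective_def)

lemma endo_pairs_dual_basis:
  assumes "V \<in> endo_pairs scalars"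
  obtains n e \<phi> where "dual_basis (fst V) {..<n::nat} e \<phi>"
  using endo_pairsD(1)[OF assms] by (auto simp: fg_projective_iff_dual_basis)

lemma mod_trace_commute:
  assumes "fg_projective scalars M" and "fg_projective scalars N"
    and g: "g \<in> mod_homs scalars N M" and h: "h \<in> mod_homs scalars M N"
  shows "mod_trace M (\<lambda>x. g (h x)) = mod_trace N (\<lambda>y. h (g y))"
proof -
  obtain m e \<phi> n e' \<psi> where db: "dual_basis M {..<m::nat} e \<phi>" "dual_basis N {..<n::nat} e' \<psi>"
    using assms by (auto simp: fg_projective_iff_dual_basis)
  show ?thesis
    using dual_basis_trace_commute[OF db g h] mod_homs_compose[OF g h] mod_homs_compose[OF h g]
    by (simp add: mod_trace_eq[OF db(1)] mod_trace_eq[OF db(2)])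
qed

text \<open>Endomorphisms are total functions on a type, so maps that agree on the carrier may still
  be different functions.\<close>

lemma mod_trace_cong:
  assumes M: "fg_projective scalars M" and f: "f \<in> mod_homs scalars M M"
    and eq: "\<And>x. x \<in> carrier M \<Longrightarrow> f x = g x"
  shows "mod_trace M f = mod_trace M g"
proof -
  obtain n e \<phi> where db: "dual_basis M {..<n::nat} e \<phi>"
    using M by (auto simp: fg_projective_iff_dual_basis)
  interpret Module.module scalars M using db by (simp add: dual_basis_def)
  have "g \<in> mod_homs scalars M M"
    using f by (auto simp: mod_homs_def Pi_iff simp flip: eq)
  then show ?thesis
    using db eq by (auto simp: mod_trace_eq[OF db] f dual_basis_def Pi_iff intro!: sum.cong)
qed

lemma mod_trace_add:
  assumes M: "fg_projective scalars M"
    and f: "f \<in> mod_homs scalars M M" and g: "g \<in> mod_homs scalars M M"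
  shows "mod_trace M (\<lambda>x. f x \<oplus>\<^bsub>M\<^esub> g x) = mod_trace M f + mod_trace M g"
proof -
  obtain n e \<phi> where db: "dual_basis M {..<n::nat} e \<phi>"
    using M by (auto simp: fg_projective_iff_dual_basis)
  interpret Module.module scalars M using db by (simp add: dual_basis_def)
  have fg: "(\<lambda>x. f x \<oplus>\<^bsub>M\<^esub> g x) \<in> mod_homs scalars M M"
    using f g by (intro mod_homsI) (auto simp: mod_homs_def Pi_iff M.a_ac smult_r_distr)
  have "\<phi> i (f (e i) \<oplus>\<^bsub>M\<^esub> g (e i)) = \<phi> i (f (e i)) + \<phi> i (g (e i))" if "i < n" for i
    using db that mod_homs_closed[OF f] mod_homs_closed[OF g]
    by (subst mod_homs_add[where N = scalar_module and A = scalars])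
      (auto simp: dual_basis_def)
  then show ?thesis
    by (simp add: mod_trace_eq[OF db] f g fg sum.distrib)
qed

text \<open>With k the inverse of the isomorphism h, insert k h in front of the endomorphism of V
  and move k to the other end by cyclicity: the result is the conjugate, which is the endomorphism
  of W.\<close>

lemma mod_trace_iso:
  assumes V: "V \<in> endo_pairs scalars" and W: "W \<in> endo_pairs scalars"
    and "endo_iso scalars V W"
  shows "mod_trace (fst V) (snd V) = mod_trace (fst W) (snd W)"
proof -
  obtain h where h: "h \<in> endo_homs scalars V W" and b: "bij_betw h (carrier (fst V)) (carrier (fst W))"
    using assms by (auto simp: endo_iso_def)
  note V = endo_pairsD[OF V] and W = endo_pairsD[OF W]
  have h': "h \<in> mod_homs scalars (fst V) (fst W)" using h by (simp add: endo_homs_def)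
  let ?k = "inv_into (carrier (fst V)) h"
  have k: "?k \<in> mod_homs scalars (fst W) (fst V)"
    by (rule mod_homs_inv_into[OF V(3) h' b])
  have kh: "?k (h x) = x" if "x \<in> carrier (fst V)" for x
    using b that by (auto simp: bij_betw_def)
  have hk: "h (?k x) = x" if "x \<in> carrier (fst W)" for x
    using b that by (auto simp: bij_betw_def f_inv_into_f)
  have "mod_trace (fst V) (snd V) = mod_trace (fst V) (\<lambda>x. ?k (h (snd V x)))"
    using mod_homs_closed[OF V(2)] by (intro mod_trace_cong V) (simp add: kh)
  also have "\<dots> = mod_trace (fst W) (\<lambda>x. h (snd V (?k x)))"
    by (rule mod_trace_commute[OF V(1) W(1) k mod_homs_compose[OF h' V(2)]])
  also have "\<dots> = mod_trace (fst W) (snd W)"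
    using h mod_homs_closed[OF k]
    by (intro mod_trace_cong[OF W(1)] mod_homs_compose[OF h'] mod_homs_compose[OF V(2)] k)
      (simp add: endo_homs_def hk)
  finally show ?thesis .
qed

text \<open>A surjection onto a projective module splits, so that the identity is \<open>i \<circ> r + s \<circ> p\<close>;
  the trace then splits by cyclicity.\<close>

lemma mod_trace_short_exact:
  fixes V' :: "('a::comm_ring_1, 'b) endo" and V :: "('a, 'c) endo" and V'' :: "('a, 'd) endo"
  assumes V': "V' \<in> endo_pairs scalars" and V: "V \<in> endo_pairs scalars"
    and V'': "V'' \<in> endo_pairs scalars" and ex: "short_exact scalars V' V V''"
  shows "mod_trace (fst V) (snd V) = mod_trace (fst V') (snd V') + mod_trace (fst V'') (snd V'')"
proof -
  define E' E E'' f' f f'' where defs: "E' = fst V'" "E = fst V" "E'' = fst V''"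
    "f' = snd V'" "f = snd V" "f'' = snd V''"
  note V' = endo_pairsD[OF V', folded defs] and V = endo_pairsD[OF V, folded defs]
    and V'' = endo_pairsD[OF V'', folded defs]
  from ex obtain i p where "i \<in> endo_homs scalars V' V" "p \<in> endo_homs scalars V V''"
    and inj: "inj_on i (carrier E')"
    and ker: "i ` carrier E' = {x \<in> carrier E. p x = \<zero>\<^bsub>E''\<^esub>}"
    and surj: "p ` carrier E = carrier E''"
    unfolding short_exact_def defs by blast
  then have i: "i \<in> mod_homs scalars E' E" and p: "p \<in> mod_homs scalars E E''"
    and f'i: "\<And>x. x \<in> carrier E' \<Longrightarrow> i (f' x) = f (i x)"
    and pf: "\<And>x. x \<in> carrier E \<Longrightarrow> p (f x) = f'' (p x)"
    by (simp_all add: endo_homs_def defs)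
  interpret E': Module.module scalars E' by (rule V'(3))
  interpret E: Module.module scalars E by (rule V(3))
  interpret E'': Module.module scalars E'' by (rule V''(3))
  note ic = mod_homs_closed[OF i] and pc = mod_homs_closed[OF p]
  obtain n e \<phi> where db: "dual_basis E'' {..<n::nat} e \<phi>"
    using V'' by (auto simp: fg_projective_iff_dual_basis)
  then have e: "\<And>k. k < n \<Longrightarrow> e k \<in> carrier E''"
    and \<phi>: "\<And>k. k < n \<Longrightarrow> \<phi> k \<in> mod_homs scalars E'' scalar_module"
    by (auto simp: dual_basis_def)
  \<comment> \<open>Lifting the members of a dual basis of \<open>E''\<close> through p and sending
    x to the combination with coefficients \<open>\<phi> k x\<close> defines the section s.\<close>
  have "\<exists>t\<in>carrier E. p t = e k" if "k < n" for k
    using e[OF that] surj by (metis imageE)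
  then obtain t where t: "\<And>k. k < n \<Longrightarrow> t k \<in> carrier E" "\<And>k. k < n \<Longrightarrow> p (t k) = e k"
    by metis
  define s where "s = (\<lambda>x. \<Oplus>\<^bsub>E\<^esub>k\<in>{..<n}. \<phi> k x \<odot>\<^bsub>E\<^esub> t k)"
  have s: "s \<in> mod_homs scalars E'' E"
    unfolding s_def using t(1) \<phi> by (intro lincomb_mod_homs V) auto
  note sc = mod_homs_closed[OF s]
  have ps: "p (s x) = x" if x: "x \<in> carrier E''" for x
  proof -
    have "p (s x) = (\<Oplus>\<^bsub>E''\<^esub>k\<in>{..<n}. p (\<phi> k x \<odot>\<^bsub>E\<^esub> t k))"
      unfolding s_def using t(1) by (intro mod_homs_finsum[OF V(3) V''(3) p]) auto
    also have "\<dots> = (\<Oplus>\<^bsub>E''\<^esub>k\<in>{..<n}. \<phi> k x \<odot>\<^bsub>E''\<^esub> e k)"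
      using e t by (intro E''.M.finsum_cong') (auto simp: mod_homs_smult[OF p])
    finally show ?thesis using db x by (simp add: dual_basis_def)
  qed
  have "\<exists>u\<in>carrier E'. i u \<oplus>\<^bsub>E\<^esub> s (p x) = x" if x: "x \<in> carrier E" for x
  proof -
    \<comment> \<open>This is x - s (p x), written with the scalar -1 so that p passes through it by
      \<open>mod_homs_add\<close> and \<open>mod_homs_smult\<close>. It lies in the kernel of p
      because p s is the identity.\<close>
    let ?d = "x \<oplus>\<^bsub>E\<^esub> (\<ominus>\<^bsub>scalars\<^esub> \<one>\<^bsub>scalars\<^esub>) \<odot>\<^bsub>E\<^esub> s (p x)"
    have m: "(\<ominus>\<^bsub>scalars\<^esub> \<one>\<^bsub>scalars\<^esub>) \<odot>\<^bsub>E\<^esub> y = \<ominus>\<^bsub>E\<^esub> y" if "y \<in> carrier E" for y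
      using that by (metis E'.R.one_closed E.smult_l_minus E.smult_one)
    have m'': "(\<ominus>\<^bsub>scalars\<^esub> \<one>\<^bsub>scalars\<^esub>) \<odot>\<^bsub>E''\<^esub> y = \<ominus>\<^bsub>E''\<^esub> y" if "y \<in> carrier E''" for y
      using that by (metis E'.R.one_closed E''.smult_l_minus E''.smult_one)
    have d: "?d \<in> carrier E" using x pc sc by auto
    have "p ?d = p x \<oplus>\<^bsub>E''\<^esub> \<ominus>\<^bsub>E''\<^esub> p x"
      using x pc sc by (subst mod_homs_add[OF p])
          (auto simp: mod_homs_smult[OF p] ps m'' simp del: scalars_simps(2-))
    then have "?d \<in> i ` carrier E'"
      unfolding ker using d x pc by (auto simp: E''.M.r_neg)
    then obtain u where u: "u \<in> carrier E'" "i u = ?d" by auto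
    have "i u \<oplus>\<^bsub>E\<^esub> s (p x) = x"
      using x pc sc unfolding u by (subst m) (auto simp: E.M.a_assoc E.M.l_neg)
    then show ?thesis using u by blast
  qed
  then obtain r where rc: "\<And>x. x \<in> carrier E \<Longrightarrow> r x \<in> carrier E'"
    and r: "\<And>x. x \<in> carrier E \<Longrightarrow> i (r x) \<oplus>\<^bsub>E\<^esub> s (p x) = x"
    by metis
  \<comment> \<open>The retraction r was chosen pointwise. Injectivity of i makes its value unique,
    so linearity of r and r i = id follow by checking the defining equation for the expected
    value.\<close>
  have r_eq: "r x = u" if "x \<in> carrier E" "u \<in> carrier E'" "i u \<oplus>\<^bsub>E\<^esub> s (p x) = x" for x u
  proof -
    have "i (r x) = i u"
      using r[OF that(1)] that ic rc pc sc E.M.add.r_cancel by metis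
    then show ?thesis using inj rc that by (auto simp: inj_on_def)
  qed
  have rh: "r \<in> mod_homs scalars E E'"
  proof (rule mod_homsI)
    fix x y assume xy: "x \<in> carrier E" "y \<in> carrier E"
    have "i (r x \<oplus>\<^bsub>E'\<^esub> r y) \<oplus>\<^bsub>E\<^esub> s (p (x \<oplus>\<^bsub>E\<^esub> y)) =
        (i (r x) \<oplus>\<^bsub>E\<^esub> s (p x)) \<oplus>\<^bsub>E\<^esub> (i (r y) \<oplus>\<^bsub>E\<^esub> s (p y))"
      using xy rc ic pc sc
      by (simp add: mod_homs_add[OF i] mod_homs_add[OF s] mod_homs_add[OF p] E.M.a_ac)
    then show "r (x \<oplus>\<^bsub>E\<^esub> y) = r x \<oplus>\<^bsub>E'\<^esub> r y"
      using xy rc by (intro r_eq) (auto simp: r)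
  next
    fix a :: 'a and x assume ax: "a \<in> carrier scalars" "x \<in> carrier E"
    have "i (a \<odot>\<^bsub>E'\<^esub> r x) \<oplus>\<^bsub>E\<^esub> s (p (a \<odot>\<^bsub>E\<^esub> x)) = a \<odot>\<^bsub>E\<^esub> (i (r x) \<oplus>\<^bsub>E\<^esub> s (p x))"
      using ax rc ic pc sc
      by (simp add: mod_homs_smult[OF i] mod_homs_smult[OF s] mod_homs_smult[OF p] E.smult_r_distr)
    then show "r (a \<odot>\<^bsub>E\<^esub> x) = a \<odot>\<^bsub>E'\<^esub> r x"
      using ax rc by (intro r_eq) (auto simp: r)
  qed (rule rc)
  have ri: "r (i u) = u" if u: "u \<in> carrier E'" for u
  proof (rule r_eq)
    have "p (i u) = \<zero>\<^bsub>E''\<^esub>" using ker u by auto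
    then show "i u \<oplus>\<^bsub>E\<^esub> s (p (i u)) = i u"
      using u ic mod_homs_zero[OF V''(3) V(3) s] by simp
  qed (use u ic in auto)
  have fir: "(\<lambda>x. f (i (r x))) \<in> mod_homs scalars E E"
    by (intro mod_homs_compose[OF V(2)] mod_homs_compose[OF i] rh)
  have fsp: "(\<lambda>x. f (s (p x))) \<in> mod_homs scalars E E"
    by (intro mod_homs_compose[OF V(2)] mod_homs_compose[OF s] p)
  have "mod_trace E f = mod_trace E (\<lambda>x. f (i (r x)) \<oplus>\<^bsub>E\<^esub> f (s (p x)))"
    using ic rc sc pc
    by (intro mod_trace_cong V) (auto simp: r simp flip: mod_homs_add[OF V(2)])
  also have "\<dots> = mod_trace E (\<lambda>x. f (i (r x))) + mod_trace E (\<lambda>x. f (s (p x)))"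
    by (rule mod_trace_add[OF V(1) fir fsp])
  \<comment> \<open>On the outer terms the cycled composites simplify: r f i = r i f' = f', and p f
    s = f'' p s = f''.\<close>
  also have "mod_trace E (\<lambda>x. f (i (r x))) = mod_trace E' (\<lambda>x. r (f (i x)))"
    by (rule mod_trace_commute[OF V(1) V'(1) mod_homs_compose[OF V(2) i] rh])
  also have "\<dots> = mod_trace E' f'"
    using mod_homs_closed[OF V'(2)]
    by (intro mod_trace_cong V' mod_homs_compose[OF rh] mod_homs_compose[OF V(2)] i)
      (simp add: ri flip: f'i)
  also have "mod_trace E (\<lambda>x. f (s (p x))) = mod_trace E'' (\<lambda>x. p (f (s x)))"
    by (rule mod_trace_commute[OF V(1) V''(1) mod_homs_compose[OF V(2) s] p])
  also have "\<dots> = mod_trace E'' f''"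
    using sc
    by (intro mod_trace_cong V'' mod_homs_compose[OF p] mod_homs_compose[OF V(2)] s)
      (simp add: ps pf)
  finally show ?thesis by (simp add: defs)
qed

section \<open>Ghost vectors of objects under exact sequences, isomorphisms and Frobenius\<close>

lemma short_exact_funpow:
  assumes V': "V' \<in> endo_pairs A" and V: "V \<in> endo_pairs A" and ex: "short_exact A V' V V''"
  shows "short_exact A (endo_frob k V') (endo_frob k V) (endo_frob k V'')"
proof -
  from ex obtain i p where "i \<in> endo_homs A V' V" "p \<in> endo_homs A V V''"
    "inj_on i (carrier (fst V'))"
    "i ` carrier (fst V') = {x \<in> carrier (fst V). p x = \<zero>\<^bsub>fst V''\<^esub>}"
    "p ` carrier (fst V) = carrier (fst V'')"
    unfolding short_exact_def by blast
  then show ?thesis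
    using endo_homs_funpow[of i A V' V k] endo_homs_funpow[of p A V V'' k]
      endo_pairsD(2)[OF V'] endo_pairsD(2)[OF V]
    unfolding short_exact_def endo_frob_def by auto
qed

lemma endo_iso_funpow:
  assumes V: "V \<in> endo_pairs A" and "endo_iso A V W"
  shows "endo_iso A (endo_frob k V) (endo_frob k W)"
  using assms endo_homs_funpow[OF _ endo_pairsD(2)[OF V]]
  unfolding endo_iso_def endo_frob_def by fastforce

lemma endo_frob_in_endo_pairs: "V \<in> endo_pairs A \<Longrightarrow> endo_frob k V \<in> endo_pairs A"
  by (auto simp: endo_pairs_def endo_frob_def mod_homs_funpow)

definition endo_ghost :: "('a::comm_ring_1, 'b) endo \<Rightarrow> nat \<Rightarrow> 'a" where
  "endo_ghost V k = mod_trace (fst V) (snd V ^^ k)"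

lemma endo_ghost_short_exact:
  assumes "V' \<in> endo_pairs scalars" and "V \<in> endo_pairs scalars" and "V'' \<in> endo_pairs scalars"
    and "short_exact scalars V' V V''"
  shows "endo_ghost V k = endo_ghost V' k + endo_ghost V'' k"
  using mod_trace_short_exact[OF assms(1-3)[THEN endo_frob_in_endo_pairs]
      short_exact_funpow[OF assms(1,2,4)]]
  by (simp add: endo_ghost_def endo_frob_def)

lemma endo_ghost_iso:
  assumes "V \<in> endo_pairs scalars" and "W \<in> endo_pairs scalars" and "endo_iso scalars V W"
  shows "endo_ghost V k = endo_ghost W k"
  using mod_trace_iso[OF assms(1,2)[THEN endo_frob_in_endo_pairs] endo_iso_funpow[OF assms(1,3)]]
  by (simp add: endo_ghost_def endo_frob_def)

lemma endo_ghost_frob: "endo_ghost (endo_frob n V) k = endo_ghost V (n * k)"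
  by (simp add: endo_ghost_def endo_frob_def funpow_mult)

lemma
  assumes "V \<in> endo_pairs A"
  shows endo_rep_in_endo_pairs: "endo_rep A V \<in> endo_pairs A"
    and endo_iso_endo_rep: "endo_iso A V (endo_rep A V)"
  using someI_ex[OF endo_pairs_universe[OF assms]] unfolding endo_rep_def by blast+

lemma endo_ghost_endo_rep:
  "V \<in> endo_pairs scalars \<Longrightarrow> endo_ghost (endo_rep scalars V) k = endo_ghost V k"
  using endo_ghost_iso[OF _ endo_rep_in_endo_pairs endo_iso_endo_rep] by metis

subsection \<open>Verschiebung\<close>

text \<open>Read v backwards, as the start of an infinite sequence in which every further block of n
  entries is the preceding block with the endomorphism applied to it. The Verschiebung is then the
  shift of this sequence by one place, so its k-th power is the shift by k. This is why positions
  appear as n - 1 - m.\<close>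

lemma endo_versch_funpow:
  assumes "m < n"
  shows "(snd (endo_versch n V) ^^ k) v (n - 1 - m) =
           (snd V ^^ ((m + k) div n)) (v (n - 1 - (m + k) mod n))"
proof -
  define F where "F = snd (endo_versch n V)"
  \<comment> \<open>G v is the infinite sequence; the two cases of \<open>step\<close> are the
    passage into the next block and a move inside a block.\<close>
  define G where "G = (\<lambda>v m. (snd V ^^ (m div n)) (v (n - 1 - m mod n)))"
  have step: "G (F v) m = G v (Suc m)" for v m
  proof (cases "Suc (m mod n) = n")
    case True
    then have "m mod n = n - 1" by simp
    moreover have "Suc m mod n = 0" "Suc m div n = Suc (m div n)"
      using True mod_Suc[of m n] div_Suc[of m n] by auto
    ultimately show ?thesis
      using assms by (simp add: G_def F_def endo_versch_def funpow_swap1)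
  next
    case False
    then have "Suc m mod n = Suc (m mod n)" "Suc m div n = m div n"
      using mod_Suc[of m n] div_Suc[of m n] by auto
    moreover have "Suc (m mod n) < n"
      using False assms mod_less_divisor[of n m] by linarith
    ultimately show ?thesis
      using assms by (simp add: G_def F_def endo_versch_def)
  qed
  have "G ((F ^^ k) v) m = G v (m + k)" for v
    by (induction k arbitrary: v m) (simp_all add: step funpow_swap1)
  then show ?thesis
    using assms by (simp add: G_def F_def)
qed

lemma endo_versch_in_endo_pairs:
  assumes V: "V \<in> endo_pairs scalars"
  shows "endo_versch n V \<in> endo_pairs scalars"
proof -
  obtain m e \<phi> where "dual_basis (fst V) {..<m::nat} e \<phi>"
    using endo_pairs_dual_basis[OF V] .
  then have "fg_projective scalars (power_module n (fst V))"
    by (rule fg_projectiveI[OF dual_basis_power_module])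
  moreover have "snd (endo_versch n V) \<in>
      mod_homs scalars (power_module n (fst V)) (power_module n (fst V))"
    using endo_pairsD(2)[OF V]
    by (auto simp: mod_homs_def endo_versch_def PiE_iff Pi_iff intro!: restrict_ext)
  ultimately show ?thesis
    by (simp add: endo_pairs_def endo_versch_def)
qed

text \<open>After k steps a block returns to its own position exactly if n divides k. Then each of
  the n diagonal blocks is the power k div n of the endomorphism, and otherwise all diagonal blocks
  vanish.\<close>

lemma endo_ghost_versch:
  assumes V: "V \<in> endo_pairs scalars"
  shows "endo_ghost (endo_versch n V) k =
           (if n dvd k then of_nat n * endo_ghost V (k div n) else 0)"
proof -
  obtain N e \<phi> where db: "dual_basis (fst V) {..<N::nat} e \<phi>"
    using endo_pairs_dual_basis[OF V] .
  note V' = endo_pairsD[OF V]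
  have \<phi>: "\<And>i. i < N \<Longrightarrow> \<phi> i \<in> mod_homs scalars (fst V) scalar_module"
    using db by (auto simp: dual_basis_def)
  note f = mod_homs_funpow[OF V'(2)]
  let ?F = "snd (endo_versch n V) ^^ k"
  have F: "?F \<in> mod_homs scalars (power_module n (fst V)) (power_module n (fst V))"
    using endo_pairsD(2)[OF endo_frob_in_endo_pairs[OF endo_versch_in_endo_pairs[OF V, of n], of k]]
    by (simp add: endo_frob_def endo_versch_def)
  have eq: "\<phi> i (?F (\<lambda>k\<in>{..<n}. if k = j then e i else \<zero>\<^bsub>fst V\<^esub>) j) =
      (if n dvd k then \<phi> i ((snd V ^^ (k div n)) (e i)) else 0)" if j: "j < n" and i: "i < N" for i j
  proof -
    define m where "m = n - 1 - j"
    have m: "m < n" "n - 1 - m = j" using j by (auto simp: m_def)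
    let ?v = "\<lambda>k\<in>{..<n}. if k = j then e i else \<zero>\<^bsub>fst V\<^esub>"
    have *: "?F ?v j = (snd V ^^ ((m + k) div n)) (?v (n - 1 - (m + k) mod n))"
      using endo_versch_funpow[OF m(1), where V = V and k = k and v = ?v] m(2) by simp
    show ?thesis
    proof (cases "n dvd k")
      case True
      then have "(m + k) mod n = m" "(m + k) div n = k div n"
        using m(1) by (auto elim!: dvdE)
      then show ?thesis
        using True j m(2) unfolding * by simp
    next
      case False
      \<comment> \<open>The entry at j then stems from a different block, where the basis vector
        supported at j is zero.\<close>
      have "(m + k) mod n \<noteq> m"
      proof
        assume "(m + k) mod n = m"
        then have "(m + k) mod n = m mod n" using m(1) by simp
        then have "n dvd m + k - m" by (metis le_add1 mod_eq_dvd_iff_nat)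
        then show False using False by simp
      qed
      moreover have "(m + k) mod n < n" using j by simp
      ultimately have "n - 1 - (m + k) mod n \<noteq> j" "n - 1 - (m + k) mod n < n"
        using m by linarith+
      then have "?v (n - 1 - (m + k) mod n) = \<zero>\<^bsub>fst V\<^esub>" by simp
      then show ?thesis
        using False mod_homs_zero[OF V'(3) V'(3) f] mod_homs_zero[OF V'(3) module_scalar_module \<phi>[OF i]]
        by (simp add: *)
    qed
  qed
  have "endo_ghost (endo_versch n V) k = mod_trace (power_module n (fst V)) ?F"
    by (simp add: endo_ghost_def endo_versch_def)
  also have "\<dots> = (\<Sum>(j, i)\<in>{..<n} \<times> {..<N}.
      \<phi> i (?F (\<lambda>k\<in>{..<n}. if k = j then e i else \<zero>\<^bsub>fst V\<^esub>) j))"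
    by (subst mod_trace_eq[OF dual_basis_power_module[OF db] F]) (simp add: case_prod_unfold)
  also have "\<dots> = (\<Sum>(j, i)\<in>{..<n} \<times> {..<N}.
      if n dvd k then \<phi> i ((snd V ^^ (k div n)) (e i)) else 0)"
    by (intro sum.cong) (auto simp: eq)
  also have "\<dots> = (if n dvd k then of_nat n * endo_ghost V (k div n) else 0)"
    by (simp add: mod_trace_eq[OF db f] endo_ghost_def flip: sum.cartesian_product)
  finally show ?thesis .
qed

subsection \<open>Tensor products\<close>

lemma (in abelian_monoid) finsum_Times:
  assumes "finite I" "finite J" and f: "\<And>i j. i \<in> I \<Longrightarrow> j \<in> J \<Longrightarrow> f i j \<in> carrier G"
  shows "(\<Oplus>p\<in>I \<times> J. f (fst p) (snd p)) = (\<Oplus>i\<in>I. \<Oplus>j\<in>J. f i j)"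
  using assms(1) f
proof (induction I rule: finite_induct)
  case (insert i I)
  have "insert i I \<times> J = Pair i ` J \<union> I \<times> J" by auto
  then have "(\<Oplus>p\<in>insert i I \<times> J. f (fst p) (snd p)) = (\<Oplus>p\<in>Pair i ` J \<union> I \<times> J. f (fst p) (snd p))"
    by simp
  also have "\<dots> = (\<Oplus>p\<in>Pair i ` J. f (fst p) (snd p)) \<oplus> (\<Oplus>p\<in>I \<times> J. f (fst p) (snd p))"
    using insert.hyps insert.prems assms(2) by (intro finsum_Un_disjoint) auto
  also have "(\<Oplus>p\<in>Pair i ` J. f (fst p) (snd p)) = (\<Oplus>j\<in>J. f i j)"
    using insert.prems by (subst finsum_reindex) (auto simp: inj_on_def)
  also have "\<dots> \<oplus> (\<Oplus>p\<in>I \<times> J. f (fst p) (snd p)) = (\<Oplus>i\<in>insert i I. \<Oplus>j\<in>J. f i j)"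
    using insert by (subst finsum_insert) (auto intro!: finsum_closed)
  finally show ?case .
qed simp

lemma
  assumes "mod_bilinear A M N P \<beta>"
  shows mod_bilinear_right: "x \<in> carrier M \<Longrightarrow> \<beta> x \<in> mod_homs A N P"
    and mod_bilinear_left: "y \<in> carrier N \<Longrightarrow> (\<lambda>x. \<beta> x y) \<in> mod_homs A M P"
    and mod_bilinear_closed: "x \<in> carrier M \<Longrightarrow> y \<in> carrier N \<Longrightarrow> \<beta> x y \<in> carrier P"
  using assms by (auto simp: mod_bilinear_def mod_homs_def)

lemma mod_bilinear_compose:
  assumes \<beta>: "mod_bilinear A M' N' P \<beta>"
    and f: "f \<in> mod_homs A M M'" and g: "g \<in> mod_homs A N N'"
  shows "mod_bilinear A M N P (\<lambda>x y. \<beta> (f x) (g y))"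
  unfolding mod_bilinear_def
proof (intro conjI ballI)
  fix x assume x: "x \<in> carrier M"
  show "(\<lambda>y. \<beta> (f x) (g y)) \<in> mod_homs A N P"
    by (rule mod_homs_compose[OF mod_bilinear_right[OF \<beta> mod_homs_closed[OF f x]] g])
next
  fix y assume y: "y \<in> carrier N"
  show "(\<lambda>x. \<beta> (f x) (g y)) \<in> mod_homs A M P"
    by (rule mod_homs_compose[OF mod_bilinear_left[OF \<beta> mod_homs_closed[OF g y]] f])
qed

text \<open>A bilinear map is determined by its values on pairs from two dual bases. This serves
  both directions of the tensor product: expanding elementary tensors, and building the map that
  factors a given bilinear map.\<close>

lemma mod_bilinear_expand:
  fixes M :: "('a::comm_ring_1, 'b) module" and N :: "('a, 'c) module"
  assumes I: "dual_basis M I e \<phi>" and J: "dual_basis N J e' \<psi>"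
    and P: "Module.module scalars P" and \<beta>: "mod_bilinear scalars M N P \<beta>"
    and x: "x \<in> carrier M" and y: "y \<in> carrier N"
  shows "\<beta> x y = (\<Oplus>\<^bsub>P\<^esub>p\<in>I \<times> J. (\<phi> (fst p) x * \<psi> (snd p) y) \<odot>\<^bsub>P\<^esub> \<beta> (e (fst p)) (e' (snd p)))"
proof -
  interpret P: Module.module scalars P by (rule P)
  interpret M: Module.module scalars M using I by (simp add: dual_basis_def)
  interpret N: Module.module scalars N using J by (simp add: dual_basis_def)
  have fin: "finite I" "finite J"
    and e: "\<And>i. i \<in> I \<Longrightarrow> e i \<in> carrier M" "\<And>j. j \<in> J \<Longrightarrow> e' j \<in> carrier N"
    using I J by (auto simp: dual_basis_def)
  have ee: "\<And>i j. i \<in> I \<Longrightarrow> j \<in> J \<Longrightarrow> \<beta> (e i) (e' j) \<in> carrier P"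
    and ey: "\<And>i. i \<in> I \<Longrightarrow> \<beta> (e i) y \<in> carrier P"
    using mod_bilinear_closed[OF \<beta>] e y by auto
  have 1: "\<beta> (e i) y = (\<Oplus>\<^bsub>P\<^esub>j\<in>J. \<psi> j y \<odot>\<^bsub>P\<^esub> \<beta> (e i) (e' j))" if i: "i \<in> I" for i
  proof -
    note b = mod_bilinear_right[OF \<beta> e(1)[OF i]]
    have "\<beta> (e i) y = \<beta> (e i) (\<Oplus>\<^bsub>N\<^esub>j\<in>J. \<psi> j y \<odot>\<^bsub>N\<^esub> e' j)"
      using J y by (simp add: dual_basis_def)
    also have "\<dots> = (\<Oplus>\<^bsub>P\<^esub>j\<in>J. \<beta> (e i) (\<psi> j y \<odot>\<^bsub>N\<^esub> e' j))"
      using e by (intro mod_homs_finsum[OF N.module_axioms P b]) auto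
    also have "\<dots> = (\<Oplus>\<^bsub>P\<^esub>j\<in>J. \<psi> j y \<odot>\<^bsub>P\<^esub> \<beta> (e i) (e' j))"
      using e ee i by (intro P.M.finsum_cong') (auto simp: mod_homs_smult[OF b])
    finally show ?thesis .
  qed
  note b = mod_bilinear_left[OF \<beta> y]
  have "\<beta> x y = \<beta> (\<Oplus>\<^bsub>M\<^esub>i\<in>I. \<phi> i x \<odot>\<^bsub>M\<^esub> e i) y"
    using I x by (simp add: dual_basis_def)
  also have "\<dots> = (\<Oplus>\<^bsub>P\<^esub>i\<in>I. \<beta> (\<phi> i x \<odot>\<^bsub>M\<^esub> e i) y)"
    using e by (intro mod_homs_finsum[OF M.module_axioms P b]) auto
  also have "\<dots> = (\<Oplus>\<^bsub>P\<^esub>i\<in>I. \<phi> i x \<odot>\<^bsub>P\<^esub> \<beta> (e i) y)"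
    using e ey by (intro P.M.finsum_cong') (auto simp: mod_homs_smult[OF b])
  also have "\<dots> = (\<Oplus>\<^bsub>P\<^esub>i\<in>I. \<Oplus>\<^bsub>P\<^esub>j\<in>J. (\<phi> i x * \<psi> j y) \<odot>\<^bsub>P\<^esub> \<beta> (e i) (e' j))"
  proof (intro P.M.finsum_cong' refl)
    fix i assume i: "i \<in> I"
    have "\<phi> i x \<odot>\<^bsub>P\<^esub> \<beta> (e i) y = (\<Oplus>\<^bsub>P\<^esub>j\<in>J. \<phi> i x \<odot>\<^bsub>P\<^esub> (\<psi> j y \<odot>\<^bsub>P\<^esub> \<beta> (e i) (e' j)))"
      using ee i fin by (subst 1[OF i], intro P.finsum_smult_ldistr) auto
    also have "\<dots> = (\<Oplus>\<^bsub>P\<^esub>j\<in>J. (\<phi> i x * \<psi> j y) \<odot>\<^bsub>P\<^esub> \<beta> (e i) (e' j))"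
      using ee i P.smult_assoc1 by (intro P.M.finsum_cong') auto
    finally show "\<phi> i x \<odot>\<^bsub>P\<^esub> \<beta> (e i) y = (\<Oplus>\<^bsub>P\<^esub>j\<in>J. (\<phi> i x * \<psi> j y) \<odot>\<^bsub>P\<^esub> \<beta> (e i) (e' j))" .
  qed (use ee in \<open>auto intro!: P.M.finsum_closed\<close>)
  also have "\<dots> = (\<Oplus>\<^bsub>P\<^esub>p\<in>I \<times> J. (\<phi> (fst p) x * \<psi> (snd p) y) \<odot>\<^bsub>P\<^esub> \<beta> (e (fst p)) (e' (snd p)))"
    using fin ee by (intro P.M.finsum_Times[symmetric]) auto
  finally show ?thesis .
qed

lemma tensor_product_universal:
  fixes T :: "('a, 'd) module" and P :: "('a, 'd) module"
  assumes T: "is_tensor_product A M N T \<tau>" and P: "Module.module A P"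
    and \<beta>: "mod_bilinear A M N P \<beta>"
  obtains h where "h \<in> mod_homs A T P"
    "\<And>x y. x \<in> carrier M \<Longrightarrow> y \<in> carrier N \<Longrightarrow> h (\<tau> x y) = \<beta> x y"
    "\<And>h' t. h' \<in> mod_homs A T P \<Longrightarrow>
       (\<And>x y. x \<in> carrier M \<Longrightarrow> y \<in> carrier N \<Longrightarrow> h' (\<tau> x y) = \<beta> x y) \<Longrightarrow>
       t \<in> carrier T \<Longrightarrow> h' t = h t"
proof -
  have "\<forall>(P :: ('a, 'd) module) \<beta>. Module.module A P \<and> mod_bilinear A M N P \<beta> \<longrightarrow>
        (\<exists>h\<in>mod_homs A T P.
           (\<forall>x\<in>carrier M. \<forall>y\<in>carrier N. h (\<tau> x y) = \<beta> x y) \<and>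
           (\<forall>h'\<in>mod_homs A T P.
              (\<forall>x\<in>carrier M. \<forall>y\<in>carrier N. h' (\<tau> x y) = \<beta> x y) \<longrightarrow>
              (\<forall>t\<in>carrier T. h' t = h t)))"
    using T by (simp add: is_tensor_product_def)
  from this[rule_format, OF conjI[OF P \<beta>]] obtain h where h: "h \<in> mod_homs A T P"
    "\<forall>x\<in>carrier M. \<forall>y\<in>carrier N. h (\<tau> x y) = \<beta> x y"
    "\<forall>h'\<in>mod_homs A T P. (\<forall>x\<in>carrier M. \<forall>y\<in>carrier N. h' (\<tau> x y) = \<beta> x y) \<longrightarrow>
       (\<forall>t\<in>carrier T. h' t = h t)"
    by (elim bexE conjE)
  show ?thesis
  proof (rule that[OF h(1)])
    show "h (\<tau> x y) = \<beta> x y" if "x \<in> carrier M" "y \<in> carrier N" for x y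
      using h(2) that by blast
    show "h' t = h t" if "h' \<in> mod_homs A T P"
      "\<And>x y. x \<in> carrier M \<Longrightarrow> y \<in> carrier N \<Longrightarrow> h' (\<tau> x y) = \<beta> x y" "t \<in> carrier T" for h' t
      using h(3) that by blast
  qed
qed

text \<open>The universal property turns each product of functionals into a functional on T. The
  resulting expansion map of T and the identity both send \<open>\<tau> x y\<close> to itself, so
  the uniqueness part makes them equal. No concrete model of T enters, hence the result applies to
  the object picked by \<open>endo_tensor\<close>.\<close>

lemma dual_basis_tensor:
  fixes M :: "('a::comm_ring_1, 'b) module" and N :: "('a, 'c) module"
    and T :: "('a, nat \<Rightarrow> 'a) module"
  assumes I: "dual_basis M I e \<phi>" and J: "dual_basis N J e' \<psi>"
    and T: "is_tensor_product scalars M N T \<tau>"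
  obtains \<chi> where "dual_basis T (I \<times> J) (\<lambda>p. \<tau> (e (fst p)) (e' (snd p))) \<chi>"
    "\<And>i j x y. i \<in> I \<Longrightarrow> j \<in> J \<Longrightarrow> x \<in> carrier M \<Longrightarrow> y \<in> carrier N \<Longrightarrow>
       \<chi> (i, j) (\<tau> x y) = \<phi> i x * \<psi> j y"
proof -
  have Tm: "Module.module scalars T" and \<tau>: "mod_bilinear scalars M N T \<tau>"
    using T by (auto simp: is_tensor_product_def)
  interpret T: Module.module scalars T by (rule Tm)
  have fin: "finite I" "finite J"
    and e: "\<And>i. i \<in> I \<Longrightarrow> e i \<in> carrier M" "\<And>j. j \<in> J \<Longrightarrow> e' j \<in> carrier N"
    and \<phi>: "\<And>i. i \<in> I \<Longrightarrow> \<phi> i \<in> mod_homs scalars M scalar_module"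
    and \<psi>: "\<And>j. j \<in> J \<Longrightarrow> \<psi> j \<in> mod_homs scalars N scalar_module"
    using I J by (auto simp: dual_basis_def)
  note \<tau>c = mod_bilinear_closed[OF \<tau>]
  \<comment> \<open>Test modules must have elements of type \<open>nat \<Rightarrow> 'a\<close> like
    T, so the ring is replaced by its first power and functionals are read off at coordinate
    0.\<close>
  let ?P = "power_module 1 (scalar_module :: ('a, 'a) module)"
  have "\<exists>h\<in>mod_homs scalars T scalar_module.
      \<forall>x\<in>carrier M. \<forall>y\<in>carrier N. h (\<tau> x y) = \<phi> i x * \<psi> j y"
    if ij: "i \<in> I" "j \<in> J" for i j
  proof -
    let ?\<beta> = "\<lambda>x y. \<lambda>_\<in>{..<1::nat}. \<phi> i x * \<psi> j y"
    have \<beta>: "mod_bilinear scalars M N ?P ?\<beta>"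
      using \<phi>[OF ij(1)] \<psi>[OF ij(2)]
      by (auto simp: mod_bilinear_def mod_homs_def algebra_simps intro!: restrict_ext)
    obtain h where h: "h \<in> mod_homs scalars T ?P"
      "\<And>x y. x \<in> carrier M \<Longrightarrow> y \<in> carrier N \<Longrightarrow> h (\<tau> x y) = ?\<beta> x y"
      by (rule tensor_product_universal[OF T module_power[OF module_scalar_module] \<beta>]) blast
    have "(\<lambda>v. v 0) \<in> mod_homs scalars ?P scalar_module"
      by (auto simp: mod_homs_def)
    from mod_homs_compose[OF this h(1)] h(2) show ?thesis
      by (intro bexI[of _ "\<lambda>t. h t 0"]) auto
  qed
  then obtain h where h: "\<And>i j. i \<in> I \<Longrightarrow> j \<in> J \<Longrightarrow> h i j \<in> mod_homs scalars T scalar_module"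
    "\<And>i j x y. i \<in> I \<Longrightarrow> j \<in> J \<Longrightarrow> x \<in> carrier M \<Longrightarrow> y \<in> carrier N \<Longrightarrow> h i j (\<tau> x y) = \<phi> i x * \<psi> j y"
    by metis
  define \<chi> where "\<chi> = (\<lambda>p. h (fst p) (snd p))"
  let ?H = "\<lambda>t. \<Oplus>\<^bsub>T\<^esub>p\<in>I \<times> J. \<chi> p t \<odot>\<^bsub>T\<^esub> \<tau> (e (fst p)) (e' (snd p))"
  have H: "?H \<in> mod_homs scalars T T"
    using h e by (intro lincomb_mod_homs Tm) (auto simp: \<chi>_def intro!: \<tau>c)
  have H\<tau>: "?H (\<tau> x y) = \<tau> x y" if "x \<in> carrier M" "y \<in> carrier N" for x y
    using e that h by (subst mod_bilinear_expand[OF I J Tm \<tau> that], intro T.M.finsum_cong')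
      (auto simp: \<chi>_def intro!: \<tau>c)
  have "?H t = t" if t: "t \<in> carrier T" for t
  proof (rule tensor_product_universal[OF T Tm \<tau>])
    fix k
    assume k: "\<And>h' t. h' \<in> mod_homs scalars T T \<Longrightarrow>
      (\<And>x y. x \<in> carrier M \<Longrightarrow> y \<in> carrier N \<Longrightarrow> h' (\<tau> x y) = \<tau> x y) \<Longrightarrow>
      t \<in> carrier T \<Longrightarrow> h' t = k t"
    have "(\<lambda>t. t) \<in> mod_homs scalars T T" by (auto simp: mod_homs_def)
    from k[OF H H\<tau> t] k[OF this _ t] show ?thesis by simp
  qed
  then have "dual_basis T (I \<times> J) (\<lambda>p. \<tau> (e (fst p)) (e' (snd p))) \<chi>"
    using Tm fin e h by (auto simp: dual_basis_def \<chi>_def intro!: \<tau>c)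
  then show ?thesis
    using that h by (simp add: \<chi>_def)
qed

text \<open>In the product dual basis the k-th trace is a double sum whose terms are a diagonal
  entry for V times one for W, so it factors.\<close>

lemma endo_ghost_tensor:
  fixes V :: "('a::comm_ring_1, 'b) endo" and W :: "('a, 'c) endo"
    and Z :: "('a, nat \<Rightarrow> 'a) endo"
  assumes V: "V \<in> endo_pairs scalars" and W: "W \<in> endo_pairs scalars"
    and Z: "Z \<in> endo_pairs scalars" and VWZ: "is_endo_tensor scalars V W Z"
  shows "endo_ghost Z k = endo_ghost V k * endo_ghost W k"
proof -
  obtain m e \<phi> where I: "dual_basis (fst V) {..<m::nat} e \<phi>"
    using endo_pairs_dual_basis[OF V] .
  obtain n e' \<psi> where J: "dual_basis (fst W) {..<n::nat} e' \<psi>"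
    using endo_pairs_dual_basis[OF W] .
  obtain \<tau> where T: "is_tensor_product scalars (fst V) (fst W) (fst Z) \<tau>"
    and Z\<tau>: "\<And>x y. x \<in> carrier (fst V) \<Longrightarrow> y \<in> carrier (fst W) \<Longrightarrow>
      snd Z (\<tau> x y) = \<tau> (snd V x) (snd W y)"
    using VWZ by (auto simp: is_endo_tensor_def)
  obtain \<chi> where K: "dual_basis (fst Z) ({..<m} \<times> {..<n}) (\<lambda>p. \<tau> (e (fst p)) (e' (snd p))) \<chi>"
    and \<chi>: "\<And>i j x y. i \<in> {..<m} \<Longrightarrow> j \<in> {..<n} \<Longrightarrow> x \<in> carrier (fst V) \<Longrightarrow>
      y \<in> carrier (fst W) \<Longrightarrow> \<chi> (i, j) (\<tau> x y) = \<phi> i x * \<psi> j y"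
    by (rule dual_basis_tensor[OF I J T]) blast
  have e: "\<And>i. i < m \<Longrightarrow> e i \<in> carrier (fst V)" "\<And>j. j < n \<Longrightarrow> e' j \<in> carrier (fst W)"
    using I J by (auto simp: dual_basis_def)
  note f = mod_homs_funpow[OF endo_pairsD(2)[OF V], of k]
    and g = mod_homs_funpow[OF endo_pairsD(2)[OF W], of k]
    and F = mod_homs_funpow[OF endo_pairsD(2)[OF Z], of k]
  have "(snd Z ^^ k) (\<tau> x y) = \<tau> ((snd V ^^ k) x) ((snd W ^^ k) y)"
    if "x \<in> carrier (fst V)" "y \<in> carrier (fst W)" for x y
    using that mod_homs_closed[OF mod_homs_funpow[OF endo_pairsD(2)[OF V]]]
      mod_homs_closed[OF mod_homs_funpow[OF endo_pairsD(2)[OF W]]]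
    by (induction k) (simp_all add: Z\<tau>)
  then have "endo_ghost Z k = (\<Sum>p\<in>{..<m} \<times> {..<n}.
      \<phi> (fst p) ((snd V ^^ k) (e (fst p))) * \<psi> (snd p) ((snd W ^^ k) (e' (snd p))))"
    unfolding endo_ghost_def
    by (subst mod_trace_eq[OF K F])
      (auto intro!: sum.cong simp: e \<chi> mod_homs_closed[OF f] mod_homs_closed[OF g])
  also have "\<dots> = endo_ghost V k * endo_ghost W k"
    by (simp add: endo_ghost_def mod_trace_eq[OF I f] mod_trace_eq[OF J g] sum_product
        sum.cartesian_product case_prod_unfold)
  finally show ?thesis .
qed

text \<open>For projective \<open>M\<close> and \<open>N\<close> the tensor product is the image of an idempotent matrix, indexed
  by pairs, on finitely supported functions \<open>nat \<Rightarrow> 'a\<close>.\<close>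

lemma tensor_product_exists:
  fixes M :: "('a::comm_ring_1, 'b) module" and N :: "('a, 'c) module"
  assumes I: "dual_basis M {..<m::nat} e \<phi>" and J: "dual_basis N {..<n::nat} e' \<psi>"
  shows "\<exists>(T :: ('a, nat \<Rightarrow> 'a) module) \<tau>.
           is_tensor_product scalars M N T \<tau> \<and> fg_projective scalars T"
proof -
  let ?S = "{..<m} \<times> {..<n}"
  have e: "\<And>i. i < m \<Longrightarrow> e i \<in> carrier M" "\<And>j. j < n \<Longrightarrow> e' j \<in> carrier N"
    and \<phi>: "\<And>i. i < m \<Longrightarrow> \<phi> i \<in> mod_homs scalars M scalar_module"
    and \<psi>: "\<And>j. j < n \<Longrightarrow> \<psi> j \<in> mod_homs scalars N scalar_module"
    using I J by (auto simp: dual_basis_def)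
  \<comment> \<open>The coordinate s stands for the pair it encodes, and coordinates outside the m
    by n grid are zero. The carrier of T below consists of the fixed points of the matrix with
    entries \<open>\<phi> k (e i) * \<psi> l (e' j)\<close>.\<close>
  define \<tau> where "\<tau> = (\<lambda>x y s. case prod_decode s of (i, j) \<Rightarrow>
    if i < m \<and> j < n then \<phi> i x * \<psi> j y else 0)"
  define b where "b = (\<lambda>p. \<tau> (e (fst p)) (e' (snd p)))"
  define T :: "('a, nat \<Rightarrow> 'a) module" where
    "T = \<lparr>carrier = {t. (\<lambda>s. \<Sum>p\<in>?S. t (prod_encode p) * b p s) = t},
          mult = undefined, one = undefined,
          zero = (\<lambda>_. 0), add = (\<lambda>t u s. t s + u s), smult = (\<lambda>a t s. a * t s)\<rparr>"
  have carr: "t \<in> carrier T \<longleftrightarrow> (\<forall>s. (\<Sum>p\<in>?S. t (prod_encode p) * b p s) = t s)" for t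
    by (auto simp: T_def fun_eq_iff)
  have ops: "zero T = (\<lambda>_. 0)" "add T = (\<lambda>t u s. t s + u s)"
    "module.smult T = (\<lambda>a t s. a * t s)"
    by (simp_all add: T_def)
  have Tm: "Module.module scalars T"
  proof (rule moduleI)
    show "abelian_group T"
    proof (rule abelian_groupI)
      fix t assume "t \<in> carrier T"
      then have "(\<lambda>s. - t s) \<in> carrier T" "(\<lambda>s. - t s) \<oplus>\<^bsub>T\<^esub> t = \<zero>\<^bsub>T\<^esub>"
        by (auto simp: carr ops sum_negf)
      then show "\<exists>u\<in>carrier T. u \<oplus>\<^bsub>T\<^esub> t = \<zero>\<^bsub>T\<^esub>" by blast
    qed (auto simp: carr ops algebra_simps sum.distrib)
  next
    show "cring (scalars :: 'a ring)" ..
  next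
    fix a :: 'a and t assume t: "t \<in> carrier T"
    have "(\<Sum>p\<in>?S. a * t (prod_encode p) * b p s) = a * t s" for s
      using t unfolding carr by (simp add: mult.assoc flip: sum_distrib_left)
    then show "a \<odot>\<^bsub>T\<^esub> t \<in> carrier T"
      by (simp add: carr ops)
  qed (auto simp: ops algebra_simps)
  interpret T: Module.module scalars T by (rule Tm)
  have finsum_T: "finsum T v K s = (\<Sum>k\<in>K. v k s)"
    if "finite K" "\<And>k. k \<in> K \<Longrightarrow> v k \<in> carrier T" for v s and K :: "(nat \<times> nat) set"
    using that by (intro T.M.finsum_pointwise) (auto simp: ops)
  have \<tau>_encode: "\<tau> x y (prod_encode (i, j)) = \<phi> i x * \<psi> j y" if "i < m" "j < n" for i j x y
    using that by (simp add: \<tau>_def)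
  have \<tau>c: "\<tau> x y \<in> carrier T" if x: "x \<in> carrier M" and y: "y \<in> carrier N" for x y
    unfolding carr
  proof
    fix s
    obtain i j where s: "prod_decode s = (i, j)" by (metis surj_pair)
    show "(\<Sum>p\<in>?S. \<tau> x y (prod_encode p) * b p s) = \<tau> x y s"
    proof (cases "i < m \<and> j < n")
      case True
      \<comment> \<open>The fixed-point equation is the product of the expansions of
        \<open>\<phi> i x\<close> and \<open>\<psi> j y\<close> in the two dual bases.\<close>
      have "\<tau> x y s = (\<Sum>k<m. \<phi> k x * \<phi> i (e k)) * (\<Sum>l<n. \<psi> l y * \<psi> j (e' l))"
        using True dual_basis_functional[OF I \<phi> x, of i] dual_basis_functional[OF J \<psi> y, of j]
        by (simp add: \<tau>_def s)
      also have "\<dots> = (\<Sum>(k, l)\<in>?S. \<tau> x y (prod_encode (k, l)) * b (k, l) s)"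
        using True unfolding sum_product sum.cartesian_product
        by (intro sum.cong) (auto simp: \<tau>_encode b_def \<tau>_def s algebra_simps)
      finally show ?thesis by (simp add: case_prod_unfold)
    next
      case False
      then show ?thesis by (auto simp: \<tau>_def b_def s)
    qed
  qed
  then have b: "\<And>p. p \<in> ?S \<Longrightarrow> b p \<in> carrier T"
    using e by (auto simp: b_def)
  have \<tau>b: "mod_bilinear scalars M N T \<tau>"
    unfolding mod_bilinear_def using \<tau>c
    by (auto intro!: mod_homsI simp: ops \<tau>_def fun_eq_iff algebra_simps
        mod_homs_add[OF \<phi>] mod_homs_smult[OF \<phi>] mod_homs_add[OF \<psi>] mod_homs_smult[OF \<psi>]
        split: prod.split)
  have ev: "(\<lambda>t. t s) \<in> mod_homs scalars T scalar_module" for s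
    by (auto simp: mod_homs_def ops)
  have expand: "(\<Oplus>\<^bsub>T\<^esub>p\<in>?S. t (prod_encode p) \<odot>\<^bsub>T\<^esub> b p) = t" if t: "t \<in> carrier T" for t
  proof
    fix s
    have "(\<Oplus>\<^bsub>T\<^esub>p\<in>?S. t (prod_encode p) \<odot>\<^bsub>T\<^esub> b p) s = (\<Sum>p\<in>?S. (t (prod_encode p) \<odot>\<^bsub>T\<^esub> b p) s)"
      using b by (intro finsum_T) (auto intro!: T.smult_closed)
    then show "(\<Oplus>\<^bsub>T\<^esub>p\<in>?S. t (prod_encode p) \<odot>\<^bsub>T\<^esub> b p) s = t s"
      using t unfolding carr by (simp add: ops)
  qed
  have db: "dual_basis T ?S b (\<lambda>p t. t (prod_encode p))"
    using Tm b ev expand by (auto simp: dual_basis_def)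
  have "is_tensor_product scalars M N T \<tau>"
    unfolding is_tensor_product_def
  proof (intro conjI Tm \<tau>b allI impI; elim conjE)
    fix P :: "('a, nat \<Rightarrow> 'a) module" and \<beta>
    assume P: "Module.module scalars P" and \<beta>: "mod_bilinear scalars M N P \<beta>"
    interpret P: Module.module scalars P by (rule P)
    note \<beta>c = mod_bilinear_closed[OF \<beta>]
    let ?h = "\<lambda>t. \<Oplus>\<^bsub>P\<^esub>p\<in>?S. t (prod_encode p) \<odot>\<^bsub>P\<^esub> \<beta> (e (fst p)) (e' (snd p))"
    have h: "?h \<in> mod_homs scalars T P"
      using e ev by (intro lincomb_mod_homs P) (auto intro!: \<beta>c)
    have h\<tau>: "?h (\<tau> x y) = \<beta> x y" if "x \<in> carrier M" "y \<in> carrier N" for x y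
      using e by (subst mod_bilinear_expand[OF I J P \<beta> that], intro P.M.finsum_cong')
        (auto simp: \<tau>_encode intro!: \<beta>c)
    have uniq: "h' t = ?h t" if h': "h' \<in> mod_homs scalars T P" and t: "t \<in> carrier T"
      and eq: "\<forall>x\<in>carrier M. \<forall>y\<in>carrier N. h' (\<tau> x y) = \<beta> x y" for h' t
    proof -
      have "h' t = h' (\<Oplus>\<^bsub>T\<^esub>p\<in>?S. t (prod_encode p) \<odot>\<^bsub>T\<^esub> b p)"
        by (simp only: expand[OF t])
      also have "\<dots> = (\<Oplus>\<^bsub>P\<^esub>p\<in>?S. h' (t (prod_encode p) \<odot>\<^bsub>T\<^esub> b p))"
        using b by (intro mod_homs_finsum[OF Tm P h'] T.smult_closed) auto
      also have "\<dots> = ?h t"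
        using b e eq
        by (intro P.M.finsum_cong') (auto simp: mod_homs_smult[OF h'] b_def intro!: \<beta>c)
      finally show ?thesis .
    qed
    show "\<exists>h\<in>mod_homs scalars T P.
            (\<forall>x\<in>carrier M. \<forall>y\<in>carrier N. h (\<tau> x y) = \<beta> x y) \<and>
            (\<forall>h'\<in>mod_homs scalars T P.
              (\<forall>x\<in>carrier M. \<forall>y\<in>carrier N. h' (\<tau> x y) = \<beta> x y) \<longrightarrow>
              (\<forall>t\<in>carrier T. h' t = h t))"
      by (rule bexI[OF _ h]) (intro conjI ballI impI h\<tau> uniq; blast)
  qed
  then show ?thesis
    using fg_projectiveI[OF db] by blast
qed

lemma
  fixes V W :: "('a::comm_ring_1, nat \<Rightarrow> 'a) endo"
  assumes V: "V \<in> endo_pairs scalars" and W: "W \<in> endo_pairs scalars"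
  shows endo_tensor_in_endo_pairs: "endo_tensor scalars V W \<in> endo_pairs scalars"
    and is_endo_tensor_endo_tensor: "is_endo_tensor scalars V W (endo_tensor scalars V W)"
proof -
  obtain m e \<phi> n e' \<psi> where
    db: "dual_basis (fst V) {..<m::nat} e \<phi>" "dual_basis (fst W) {..<n::nat} e' \<psi>"
    using endo_pairs_dual_basis[OF V] endo_pairs_dual_basis[OF W] by metis
  obtain T :: "('a, nat \<Rightarrow> 'a) module" and \<tau>
    where T: "is_tensor_product scalars (fst V) (fst W) T \<tau>" "fg_projective scalars T"
    using tensor_product_exists[OF db] by blast
  have Tm: "Module.module scalars T" and \<tau>: "mod_bilinear scalars (fst V) (fst W) T \<tau>"
    using T(1) by (auto simp: is_tensor_product_def)
  have \<beta>: "mod_bilinear scalars (fst V) (fst W) T (\<lambda>x y. \<tau> (snd V x) (snd W y))"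
    by (rule mod_bilinear_compose[OF \<tau> endo_pairsD(2)[OF V] endo_pairsD(2)[OF W]])
  obtain F where "F \<in> mod_homs scalars T T"
    "\<And>x y. x \<in> carrier (fst V) \<Longrightarrow> y \<in> carrier (fst W) \<Longrightarrow> F (\<tau> x y) = \<tau> (snd V x) (snd W y)"
    by (rule tensor_product_universal[OF T(1) Tm \<beta>]) blast
  then have "(T, F) \<in> endo_pairs scalars \<and> is_endo_tensor scalars V W (T, F)"
    using T by (auto simp: endo_pairs_def is_endo_tensor_def)
  from someI[of "\<lambda>Z. Z \<in> endo_pairs scalars \<and> is_endo_tensor scalars V W Z", OF this]
  show "endo_tensor scalars V W \<in> endo_pairs scalars"
    and "is_endo_tensor scalars V W (endo_tensor scalars V W)"
    by (simp_all add: endo_tensor_def)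
qed

section \<open>Power sums\<close>

text \<open>By linearity the weighted sum of p(y) over S vanishes for every polynomial p. A
  polynomial that vanishes on S except at x isolates the weight of x.\<close>

lemma sum_powers_eq_0_imp:
  fixes w :: "'a::field \<Rightarrow> 'a"
  assumes S: "finite S" and 0: "\<And>k. (\<Sum>x\<in>S. w x * x ^ k) = 0" and x: "x \<in> S"
  shows "w x = 0"
proof -
  have poly0: "(\<Sum>y\<in>S. w y * poly p y) = 0" for p
  proof -
    have "(\<Sum>y\<in>S. w y * poly p y) = (\<Sum>y\<in>S. \<Sum>k\<le>degree p. coeff p k * (w y * y ^ k))"
      by (simp add: poly_altdef sum_distrib_left mult_ac)
    also have "\<dots> = (\<Sum>k\<le>degree p. coeff p k * (\<Sum>y\<in>S. w y * y ^ k))"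
      by (subst sum.swap) (simp add: sum_distrib_left)
    finally show ?thesis by (simp add: 0)
  qed
  define p where "p = (\<Prod>y\<in>S - {x}. [:- y, 1:])"
  have "(\<Sum>y\<in>S. w y * poly p y) = (\<Sum>y\<in>S. if y = x then w x * poly p x else 0)"
    using S by (intro sum.cong) (auto simp: p_def poly_prod)
  also have "\<dots> = w x * poly p x"
    using S x by simp
  finally have "w x * poly p x = 0" using poly0 by simp
  moreover have "poly p x \<noteq> 0" using S by (simp add: p_def poly_prod)
  ultimately show ?thesis by simp
qed

text \<open>X^n - 1 is separable: its derivative n X^(n-1) vanishes at most at 0, which is not a
  root. So the n linear factors over an algebraically closed field are distinct.\<close>

lemma card_roots_of_one:
  fixes n :: nat
  assumes n: "(of_nat n :: 'c::alg_closed_field) \<noteq> 0"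
  shows "card {z :: 'c. z ^ n = 1} = n"
proof -
  have n0: "n > 0" using n by (cases n) auto
  define p :: "'c poly" where "p = monom 1 n - 1"
  have deg: "degree p = n"
    using n0 unfolding p_def
    by (subst diff_conv_add_uminus, subst degree_add_eq_left) (auto simp: degree_monom_eq)
  then have p0: "p \<noteq> 0" using n0 by auto
  have poly_p: "poly p z = z ^ n - 1" for z by (simp add: p_def poly_monom)
  have "\<not> (poly p a = 0 \<and> poly (pderiv p) a = 0)" for a
    using n0 n by (auto simp: poly_p p_def pderiv_diff pderiv_monom poly_monom power_0_left)
  then have simple: "\<not> (poly p a = 0 \<and> poly (pderiv p) a = 0)" for a .
  obtain A where A: "size A = n" "p = Polynomial.smult (lead_coeff p) (\<Prod>x\<in>#A. [:-x, 1:])"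
    using alg_closed_imp_factorization[OF p0] deg by metis
  have lc: "lead_coeff p \<noteq> 0" using p0 by simp
  have root_iff: "poly (\<Prod>x\<in>#B. [:-x, 1:]) z = 0 \<longleftrightarrow> z \<in># B" for B and z :: 'c
    by (induction B) auto
  have set_A: "set_mset A = {z. z ^ n = 1}"
  proof (rule Set.set_eqI)
    fix z
    have "z \<in># A \<longleftrightarrow> poly (Polynomial.smult (lead_coeff p) (\<Prod>x\<in>#A. [:-x, 1:])) z = 0"
      using lc root_iff[of A z] by simp
    then show "z \<in> set_mset A \<longleftrightarrow> z \<in> {z. z ^ n = 1}"
      by (simp add: poly_p flip: A(2))
  qed
  have "count A a = 1" if a: "a \<in># A" for a
  proof -
    \<comment> \<open>Taking out one factor X - a leaves q with p'(a) = q(a), and this is nonzero;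
      hence a does not occur a second time.\<close>
    obtain B where B: "A = add_mset a B" using a by (metis mset_add)
    define q where "q = Polynomial.smult (lead_coeff p) (\<Prod>x\<in>#B. [:-x, 1:])"
    have q: "p = [:-a, 1:] * q" by (subst A(2)) (simp add: q_def B)
    have "poly p a = 0" "poly (pderiv p) a = poly q a"
      unfolding q pderiv_mult by (simp_all add: pderiv_pCons)
    then have "poly q a \<noteq> 0" using simple[of a] by simp
    then have "a \<notin># B" using root_iff[of B a] by (auto simp: q_def)
    then show ?thesis by (simp add: B not_in_iff)
  qed
  then have "n = (\<Sum>z\<in>set_mset A. 1)"
    by (simp add: size_multiset_overloaded_eq flip: A(1))
  then show ?thesis by (simp add: set_A)
qed

text \<open>If u^n = 1, multiplication by u permutes the summation range and multiplies the sum by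
  u^k, so the sum vanishes once u^k differs from 1. Such a u exists when n does not divide k:
  otherwise all n roots of X^n - 1 would be roots of X^r - 1 with r = k mod n and 0 < r < n.\<close>

lemma sum_powers_roots_of_one:
  assumes n: "(of_nat n :: 'c::alg_closed_field) \<noteq> 0"
  shows "(\<Sum>z | z ^ n = 1. z ^ k) = (if n dvd k then of_nat n else (0 :: 'c))"
proof (cases "n dvd k")
  case True
  then have "z ^ k = 1" if "z ^ n = 1" for z :: 'c
    using that by (auto simp: power_mult)
  then show ?thesis using True by (simp add: card_roots_of_one[OF n])
next
  case False
  have n0: "n > 0" using n by (cases n) auto
  have fin: "finite {z :: 'c. z ^ n = 1}"
    using card_roots_of_one[OF n] n0 by (metis card.infinite less_numeral_extra(3))
  have "\<exists>u :: 'c. u ^ n = 1 \<and> u ^ k \<noteq> 1"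
  proof (rule ccontr)
    assume "\<not> ?thesis"
    then have k: "z ^ k = 1" if "z ^ n = 1" for z :: 'c using that by blast
    define r where "r = k mod n"
    have r: "r > 0" "r < n" using False n0 by (auto simp: r_def dvd_eq_mod_eq_0)
    have "z ^ r = 1" if z: "z ^ n = 1" for z :: 'c
    proof -
      have "z ^ k = z ^ (n * (k div n) + r)" by (simp add: r_def)
      also have "\<dots> = z ^ r" using z by (simp add: power_add power_mult)
      finally show ?thesis using k[OF z] by simp
    qed
    then have "{z :: 'c. z ^ n = 1} \<subseteq> {z. z ^ r = 1}" by blast
    moreover have "card {z :: 'c. z ^ r = 1} \<le> r" "finite {z :: 'c. z ^ r = 1}"
    proof -
      define q :: "'c poly" where "q = monom 1 r - 1"
      have deg: "degree q = r"
        using r unfolding q_def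
        by (subst diff_conv_add_uminus, subst degree_add_eq_left) (auto simp: degree_monom_eq)
      then have "q \<noteq> 0" using r by auto
      moreover have "{z. z ^ r = 1} = {z. poly q z = 0}" by (simp add: q_def poly_monom)
      ultimately show "card {z :: 'c. z ^ r = 1} \<le> r" "finite {z :: 'c. z ^ r = 1}"
        using card_poly_roots_bound[of q] poly_roots_finite[of q] deg by simp_all
    qed
    ultimately have "n \<le> r"
      using card_mono card_roots_of_one[OF n] by (metis le_trans)
    then show False using r by simp
  qed
  then obtain u :: 'c where u: "u ^ n = 1" "u ^ k \<noteq> 1" by blast
  have u0: "u \<noteq> 0" using u n0 by (auto simp: power_0_left)
  have "(\<Sum>z | z ^ n = 1. z ^ k) = (\<Sum>z | z ^ n = 1. (u * z) ^ k)"
    by (rule sum.reindex_bij_witness[of _ "\<lambda>z. u * z" "\<lambda>z. z / u"])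
      (auto simp: power_divide power_mult_distrib u u0)
  also have "\<dots> = u ^ k * (\<Sum>z | z ^ n = 1. z ^ k)"
    by (simp add: power_mult_distrib sum_distrib_left)
  finally show ?thesis using u False by simp
qed

text \<open>The n-th roots of y^n are y times the n-th roots of one, which takes out a factor
  y^k.\<close>

lemma sum_powers_nth_roots:
  fixes y :: "'c::alg_closed_field"
  assumes n: "(of_nat n :: 'c) \<noteq> 0" and y: "y \<noteq> 0"
  shows "(\<Sum>z | z ^ n = y ^ n. z ^ k) = (if n dvd k then of_nat n * (y ^ n) ^ (k div n) else 0)"
proof -
  have "(\<Sum>z | z ^ n = y ^ n. z ^ k) = (\<Sum>z | z ^ n = 1. (y * z) ^ k)"
    using y by (intro sum.reindex_bij_witness[of _ "\<lambda>z. y * z" "\<lambda>z. z / y"])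
      (auto simp: power_divide power_mult_distrib)
  also have "\<dots> = y ^ k * (\<Sum>z | z ^ n = 1. z ^ k)"
    by (simp add: power_mult_distrib sum_distrib_left)
  finally show ?thesis
    by (auto simp: sum_powers_roots_of_one[OF n] mult.commute simp flip: power_mult)
qed

section \<open>Triangulation\<close>

text \<open>Gaussian elimination with the j as unknowns and the i as equations: a pivot m in
  equation i clears that equation, and the induction hypothesis solves the others in the remaining
  unknowns.\<close>

lemma nontrivial_linear_relation:
  fixes a :: "'j \<Rightarrow> 'i \<Rightarrow> 'k::field"
  assumes "finite I" and "card I < card J"
  shows "\<exists>c. (\<exists>j\<in>J. c j \<noteq> 0) \<and> (\<forall>i\<in>I. (\<Sum>j\<in>J. c j * a j i) = 0)"
  using assms
proof (induction I arbitrary: J a rule: finite_induct)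
  case empty
  then have "J \<noteq> {}" by auto
  then show ?case by (intro exI[of _ "\<lambda>_. 1"]) auto
next
  case (insert i I)
  have J: "finite J" using insert.prems by (metis card.infinite not_less_zero)
  show ?case
  proof (cases "\<exists>m\<in>J. a m i \<noteq> 0")
    case False
    then show ?thesis
      using insert.IH[of J a] insert.prems insert.hyps by fastforce
  next
    case True
    then obtain m where m: "m \<in> J" "a m i \<noteq> 0" by blast
    have "card I < card (J - {m})"
      using insert.prems insert.hyps m J by simp
    from insert.IH[OF this, of "\<lambda>j i'. a j i' - a j i / a m i * a m i'"]
    obtain c where c: "\<exists>j\<in>J - {m}. c j \<noteq> 0"
      "\<And>i'. i' \<in> I \<Longrightarrow> (\<Sum>j\<in>J - {m}. c j * (a j i' - a j i / a m i * a m i')) = 0"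
      by blast
    \<comment> \<open>Equation i forces this value at the pivot.\<close>
    define c' where "c' = c(m := - (\<Sum>j\<in>J - {m}. c j * a j i) / a m i)"
    have sum_c': "(\<Sum>j\<in>J. c' j * a j i') = c' m * a m i' + (\<Sum>j\<in>J - {m}. c j * a j i')" for i'
      using J m by (subst sum.remove[of _ m]) (auto simp: c'_def intro!: sum.cong)
    have "(\<Sum>j\<in>J. c' j * a j i') = 0" if "i' \<in> insert i I" for i'
    proof (cases "i' = i")
      case True
      then show ?thesis unfolding sum_c' using m by (simp add: c'_def)
    next
      case False
      have "(\<Sum>j\<in>J. c' j * a j i') =
          (\<Sum>j\<in>J - {m}. c j * a j i') - (\<Sum>j\<in>J - {m}. c j * a j i) * (a m i' / a m i)"
        unfolding sum_c' by (simp add: c'_def)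
      also have "\<dots> = (\<Sum>j\<in>J - {m}. c j * (a j i' - a j i / a m i * a m i'))"
        unfolding sum_distrib_right by (simp add: algebra_simps flip: sum_subtractf)
      finally show ?thesis using c(2) that False by simp
    qed
    moreover have "\<exists>j\<in>J. c' j \<noteq> 0" using c(1) by (auto simp: c'_def)
    ultimately show ?thesis by blast
  qed
qed

text \<open>Here \<open>\<Sum>k. coeff p k * s k\<close> with \<open>s k = \<phi> (f\<^sup>k x)\<close> stands for \<open>\<phi> (p(f) x)\<close>, so that no
  polynomials in \<open>f\<close> are needed.\<close>

lemma sum_coeff_linear_factor:
  fixes q :: "'a::comm_ring_1 poly"
  assumes q: "degree q \<le> n"
  shows "(\<Sum>k\<le>Suc n. coeff ([:- l, 1:] * q) k * s k) =
           (\<Sum>k\<le>n. coeff q k * (s (Suc k) - l * s k))"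
proof -
  have "(\<Sum>k\<le>Suc n. coeff ([:- l, 1:] * q) k * s k) =
      (\<Sum>k\<le>Suc n. coeff (pCons 0 q) k * s k) - (\<Sum>k\<le>Suc n. coeff q k * (l * s k))"
    by (simp add: algebra_simps sum_subtractf del: sum.atMost_Suc)
  also have "(\<Sum>k\<le>Suc n. coeff (pCons 0 q) k * s k) = (\<Sum>k\<le>n. coeff q k * s (Suc k))"
    by (subst sum.atMost_Suc_shift) simp
  also have "(\<Sum>k\<le>Suc n. coeff q k * (l * s k)) = (\<Sum>k\<le>n. coeff q k * (l * s k))"
    using q by (simp add: coeff_eq_0)
  finally show ?thesis by (simp add: algebra_simps sum_subtractf)
qed

lemma dual_basis_eq_zero:
  assumes db: "dual_basis M I e \<phi>" and x: "x \<in> carrier M" and 0: "\<And>i. i \<in> I \<Longrightarrow> \<phi> i x = 0"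
  shows "x = \<zero>\<^bsub>M\<^esub>"
proof -
  interpret Module.module scalars M using db by (simp add: dual_basis_def)
  have "x = (\<Oplus>\<^bsub>M\<^esub>i\<in>I. \<phi> i x \<odot>\<^bsub>M\<^esub> e i)" using db x by (simp add: dual_basis_def)
  also have "\<dots> = (\<Oplus>\<^bsub>M\<^esub>i\<in>I. \<zero>\<^bsub>M\<^esub>)"
    using db 0 smult_l_null by (intro M.finsum_cong') (auto simp: dual_basis_def)
  finally show ?thesis by simp
qed

text \<open>Write the annihilator p of x as (X - l) q and put y = f x - l x. If y is zero, then x is
  an eigenvector; otherwise q annihilates y and has smaller degree. A nonzero constant cannot
  annihilate x.\<close>

lemma eigenvector_of_annihilator:
  fixes M :: "('a::alg_closed_field, 'b) module"
  assumes db: "dual_basis M I e \<phi>" and f: "f \<in> mod_homs scalars M M"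
    and "x \<in> carrier M" and "x \<noteq> \<zero>\<^bsub>M\<^esub>" and "p \<noteq> 0"
    and "\<And>i. i \<in> I \<Longrightarrow> (\<Sum>k\<le>Polynomial.degree p. poly.coeff p k * \<phi> i ((f ^^ k) x)) = 0"
  shows "\<exists>y\<in>carrier M. y \<noteq> \<zero>\<^bsub>M\<^esub> \<and> (\<exists>l. f y = l \<odot>\<^bsub>M\<^esub> y)"
  using assms(3-)
proof (induction "Polynomial.degree p" arbitrary: p x)
  case 0
  have "\<phi> i x = 0" if "i \<in> I" for i
    using 0(5)[OF that] 0(4) leading_coeff_0_iff[of p] by (simp flip: 0(1))
  then have "x = \<zero>\<^bsub>M\<^esub>" by (rule dual_basis_eq_zero[OF db 0(2)])
  then show ?case using 0 by simp
next
  case (Suc n)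
  interpret Module.module scalars M using db by (simp add: dual_basis_def)
  have \<phi>: "\<And>i. i \<in> I \<Longrightarrow> \<phi> i \<in> mod_homs scalars M scalar_module"
    using db by (auto simp: dual_basis_def)
  obtain l where "poly p l = 0"
    using alg_closed_imp_poly_has_root[of p] Suc(2) by auto
  then obtain q where q: "p = [:- l, 1:] * q" by (metis dvdE poly_eq_0_iff_dvd)
  have q0: "q \<noteq> 0" using Suc.prems(3) q by auto
  have deg: "Polynomial.degree q = n"
    using Suc(2) q0 unfolding q by (subst (asm) degree_mult_eq) auto
  define y where "y = f x \<oplus>\<^bsub>M\<^esub> (- l) \<odot>\<^bsub>M\<^esub> x"
  have fx: "f x \<in> carrier M" using mod_homs_closed[OF f Suc.prems(1)] .
  have y: "y \<in> carrier M" using fx Suc.prems(1) by (auto simp: y_def)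
  show ?case
  proof (cases "y = \<zero>\<^bsub>M\<^esub>")
    case True
    have "l \<odot>\<^bsub>M\<^esub> x = y \<oplus>\<^bsub>M\<^esub> l \<odot>\<^bsub>M\<^esub> x"
      using True Suc.prems(1) by simp
    also have "\<dots> = f x \<oplus>\<^bsub>M\<^esub> ((- l) \<odot>\<^bsub>M\<^esub> x \<oplus>\<^bsub>M\<^esub> l \<odot>\<^bsub>M\<^esub> x)"
      using fx Suc.prems(1) by (simp add: y_def M.a_assoc)
    also have "(- l) \<odot>\<^bsub>M\<^esub> x \<oplus>\<^bsub>M\<^esub> l \<odot>\<^bsub>M\<^esub> x = \<zero>\<^bsub>M\<^esub>"
      using smult_l_distr[of "- l" l x] smult_l_null Suc.prems(1) by simp
    finally show ?thesis using fx Suc.prems(1,2) by (metis M.r_zero)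
  next
    case False
    show ?thesis
    proof (rule Suc.hyps(1)[OF deg[symmetric] y False q0])
      fix i assume i: "i \<in> I"
      have "\<phi> i ((f ^^ k) y) = \<phi> i ((f ^^ Suc k) x) - l * \<phi> i ((f ^^ k) x)" for k
      proof -
        note g = mod_homs_compose[OF \<phi>[OF i] mod_homs_funpow[OF f, of k]]
        have "\<phi> i ((f ^^ k) y) = \<phi> i ((f ^^ k) (f x)) + (- l) * \<phi> i ((f ^^ k) x)"
          unfolding y_def using fx Suc.prems(1)
          by (subst mod_homs_add[OF g]) (auto simp: mod_homs_smult[OF g])
        then show ?thesis by (simp add: funpow_swap1)
      qed
      then have "(\<Sum>k\<le>Polynomial.degree q. poly.coeff q k * \<phi> i ((f ^^ k) y)) =
          (\<Sum>k\<le>Suc n. poly.coeff p k * \<phi> i ((f ^^ k) x))"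
        unfolding q deg by (subst sum_coeff_linear_factor) (simp_all add: deg)
      then show "(\<Sum>k\<le>Polynomial.degree q. poly.coeff q k * \<phi> i ((f ^^ k) y)) = 0"
        using Suc.prems(4)[OF i] by (simp only: flip: Suc(2))
    qed
  qed
qed

text \<open>The card I + 1 iterates of x under f, starting with x itself, have only card I
  coordinates each. A nontrivial relation between them supplies the coefficients of an annihilating
  polynomial.\<close>

lemma eigenvector_exists:
  fixes M :: "('a::alg_closed_field, 'b) module"
  assumes db: "dual_basis M I e \<phi>" and f: "f \<in> mod_homs scalars M M"
    and x: "x \<in> carrier M" "x \<noteq> \<zero>\<^bsub>M\<^esub>"
  obtains y l where "y \<in> carrier M" "y \<noteq> \<zero>\<^bsub>M\<^esub>" "f y = l \<odot>\<^bsub>M\<^esub> y"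
proof -
  have I: "finite I" using db by (simp add: dual_basis_def)
  obtain c j where c: "j \<le> card I" "c j \<noteq> 0"
    "\<And>i. i \<in> I \<Longrightarrow> (\<Sum>k\<le>card I. c k * \<phi> i ((f ^^ k) x)) = 0"
    using nontrivial_linear_relation[OF I, of "{..card I}" "\<lambda>k i. \<phi> i ((f ^^ k) x)"] by auto
  define p where "p = (\<Sum>k\<le>card I. monom (c k) k)"
  have coeff: "coeff p k = (if k \<le> card I then c k else 0)" for k
    by (simp add: p_def coeff_sum)
  have "p \<noteq> 0" using c(1,2) coeff[of j] by auto
  moreover have "(\<Sum>k\<le>degree p. coeff p k * \<phi> i ((f ^^ k) x)) = 0" if i: "i \<in> I" for i
  proof -
    have "degree p \<le> card I" by (rule degree_le) (simp add: coeff)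
    then have "(\<Sum>k\<le>degree p. coeff p k * \<phi> i ((f ^^ k) x)) =
        (\<Sum>k\<le>card I. coeff p k * \<phi> i ((f ^^ k) x))"
      by (intro sum.mono_neutral_left) (auto simp: coeff_eq_0)
    then show ?thesis using c(3)[OF i] by (simp add: coeff)
  qed
  ultimately show ?thesis
    using eigenvector_of_annihilator[OF db f x] that by blast
qed

text \<open>The first power stands in for the ring itself, so that the line has elements of the type
  used for the objects of \<open>K0\<close>.\<close>

definition line_endo :: "'a::comm_ring_1 \<Rightarrow> ('a, nat \<Rightarrow> 'a) endo" where
  "line_endo l = (power_module 1 scalar_module, \<lambda>v. \<lambda>k\<in>{..<1}. l * v k)"

lemma line_endo_dual_basis:
  "dual_basis (fst (line_endo l)) {()} (\<lambda>_. \<lambda>k\<in>{..<1}. 1) (\<lambda>_ v. v 0)"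
proof -
  have "bij_betw (\<lambda>_. (0, ())) {()} ({..<1::nat} \<times> {()})" by (auto simp: bij_betw_def)
  from dual_basis_reindex[OF dual_basis_power_module[OF dual_basis_scalar_module] this]
  show ?thesis by (simp add: line_endo_def comp_def cong: restrict_cong)
qed

lemma line_endo_in_endo_pairs: "line_endo l \<in> endo_pairs scalars"
proof -
  have "snd (line_endo l) \<in> mod_homs scalars (fst (line_endo l)) (fst (line_endo l))"
    by (intro mod_homsI) (simp_all add: line_endo_def distrib_left mult.left_commute cong: restrict_cong)
  then show ?thesis
    using fg_projectiveI[OF line_endo_dual_basis] by (simp add: endo_pairs_def case_prod_unfold)
qed

lemma endo_ghost_line_endo: "endo_ghost (line_endo l) k = l ^ k"
proof -
  have "(snd (line_endo l) ^^ k) (\<lambda>k\<in>{..<1}. 1) = (\<lambda>_\<in>{..<1}. l ^ k)" for k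
    by (induction k) (auto simp: line_endo_def)
  then show ?thesis
    unfolding endo_ghost_def
    by (subst mod_trace_eq[OF line_endo_dual_basis
          mod_homs_funpow[OF endo_pairsD(2)[OF line_endo_in_endo_pairs]]])
      simp
qed

text \<open>If \<open>\<phi> y = 1\<close> for a functional \<open>\<phi>\<close> and \<open>y\<close> is an eigenvector, then the quotient by \<open>y\<close> is
  realised inside \<open>M\<close> as the kernel of \<open>\<phi>\<close>, with the compression of \<open>f\<close> along \<open>y\<close>. Taking for
  \<open>\<phi>\<close> a multiple of a member of a dual basis makes that member superfluous on the kernel.\<close>

lemma endo_pairs_split_eigenvector:
  fixes V :: "('a::field, 'b) endo"
  assumes V: "V \<in> endo_pairs scalars" and db: "dual_basis (fst V) I e \<phi>"
    and y: "y \<in> carrier (fst V)" and fy: "snd V y = l \<odot>\<^bsub>fst V\<^esub> y"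
    and i: "i \<in> I" and iy: "\<phi> i y \<noteq> 0"
  obtains W :: "('a, 'b) endo" and e' where
    "W \<in> endo_pairs scalars" "short_exact scalars (line_endo l) V W"
    "dual_basis (fst W) (I - {i}) e' \<phi>"
proof -
  define M f where defs: "M = fst V" "f = snd V"
  note db = db[folded defs] and y = y[folded defs] and fy = fy[folded defs]
  note f = endo_pairsD(2)[OF V, folded defs]
  interpret Module.module scalars M using db by (simp add: dual_basis_def)
  have e: "\<And>i. i \<in> I \<Longrightarrow> e i \<in> carrier M" and \<phi>: "\<And>i. i \<in> I \<Longrightarrow> \<phi> i \<in> mod_homs scalars M scalar_module"
    using db by (auto simp: dual_basis_def)
  note \<phi>i = \<phi>[OF i]
  have \<phi>_add: "\<phi> i (u \<oplus>\<^bsub>M\<^esub> v) = \<phi> i u + \<phi> i v" if "u \<in> carrier M" "v \<in> carrier M" for u v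
    using mod_homs_add[OF \<phi>i that] by simp
  have \<phi>_smult: "\<phi> i (a \<odot>\<^bsub>M\<^esub> u) = a * \<phi> i u" if "u \<in> carrier M" for a u
    using mod_homs_smult[OF \<phi>i _ that] by simp
  \<comment> \<open>The sign is such that \<open>\<pi>\<close> below is the projection onto the
    kernel of \<open>\<phi> i\<close> along y.\<close>
  define \<psi> where "\<psi> = (\<lambda>x. - \<phi> i x / \<phi> i y)"
  define \<pi> where "\<pi> = (\<lambda>x. x \<oplus>\<^bsub>M\<^esub> \<psi> x \<odot>\<^bsub>M\<^esub> y)"
  define N where "N = M\<lparr>carrier := {x \<in> carrier M. \<phi> i x = 0}\<rparr>"
  define W where "W = (N, \<lambda>x. \<pi> (f x))"
  have N: "carrier N = {x \<in> carrier M. \<phi> i x = 0}" "add N = add M" "zero N = zero M"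
    "module.smult N = module.smult M"
    by (simp_all add: N_def)
  have \<phi>0: "\<phi> i \<zero>\<^bsub>M\<^esub> = 0"
    using mod_homs_zero[OF module_axioms module_scalar_module \<phi>i] by simp
  have "Module.module scalars N"
  proof (rule moduleI)
    show "cring (scalars :: 'a ring)" ..
    show "abelian_group N"
    proof (rule abelian_groupI)
      fix x assume x: "x \<in> carrier N"
      then have "\<ominus>\<^bsub>M\<^esub> x \<oplus>\<^bsub>M\<^esub> x = \<zero>\<^bsub>M\<^esub>" by (simp add: N M.l_neg)
      moreover from this have "\<phi> i (\<ominus>\<^bsub>M\<^esub> x) = 0"
        using x \<phi>_add[of "\<ominus>\<^bsub>M\<^esub> x" x] \<phi>0 by (simp add: N)
      ultimately show "\<exists>z\<in>carrier N. z \<oplus>\<^bsub>N\<^esub> x = \<zero>\<^bsub>N\<^esub>"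
        using x by (intro bexI[of _ "\<ominus>\<^bsub>M\<^esub> x"]) (auto simp: N)
    qed (auto simp: N \<phi>_add \<phi>0 M.a_ac)
  qed (auto simp: N \<phi>_smult smult_l_distr[simplified]
      smult_r_distr[simplified] smult_assoc1[simplified] smult_one[simplified])
  note Nm = this
  have \<psi>_add: "\<psi> (u \<oplus>\<^bsub>M\<^esub> v) = \<psi> u + \<psi> v" if "u \<in> carrier M" "v \<in> carrier M" for u v
    using that by (simp add: \<psi>_def \<phi>_add add_divide_distrib)
  have \<psi>_smult: "\<psi> (a \<odot>\<^bsub>M\<^esub> u) = a * \<psi> u" if "u \<in> carrier M" for a u
    using that by (simp add: \<psi>_def \<phi>_smult)
  have \<pi>: "\<pi> \<in> mod_homs scalars M N"
  proof (rule mod_homsI)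
    fix x assume x: "x \<in> carrier M"
    then show "\<pi> x \<in> carrier N"
      using y iy by (simp add: N \<pi>_def \<phi>_add \<phi>_smult \<psi>_def)
  next
    fix u v assume "u \<in> carrier M" "v \<in> carrier M"
    then show "\<pi> (u \<oplus>\<^bsub>M\<^esub> v) = \<pi> u \<oplus>\<^bsub>N\<^esub> \<pi> v"
      using y by (simp add: N \<pi>_def \<psi>_add smult_l_distr[simplified] M.a_ac)
  next
    fix a :: 'a and u assume "u \<in> carrier M"
    then show "\<pi> (a \<odot>\<^bsub>M\<^esub> u) = a \<odot>\<^bsub>N\<^esub> \<pi> u"
      using y by (simp add: N \<pi>_def \<psi>_smult smult_r_distr[simplified] smult_assoc1[simplified])
  qed
  have incl: "(\<lambda>x. x) \<in> mod_homs scalars N M"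
    by (auto simp: mod_homs_def N)
  have \<pi>_id: "\<pi> x = x" if "x \<in> carrier N" for x
    using that y smult_l_null by (simp add: N \<pi>_def \<psi>_def)
  have \<pi>y: "\<pi> y = \<zero>\<^bsub>M\<^esub>"
    using y iy smult_l_distr[of 1 "-1" y] smult_one smult_l_null by (simp add: \<pi>_def \<psi>_def)
  have db_N: "dual_basis N I (\<lambda>k. \<pi> (e k)) \<phi>"
    using dual_basis_retract[OF db Nm incl \<pi> \<pi>_id] .
  interpret N: Module.module scalars N by (rule Nm)
  have "(\<Oplus>\<^bsub>N\<^esub>k\<in>I - {i}. \<phi> k x \<odot>\<^bsub>N\<^esub> \<pi> (e k)) = x" if x: "x \<in> carrier N" for x
  proof -
    have "\<phi> i x \<odot>\<^bsub>N\<^esub> \<pi> (e i) = \<zero>\<^bsub>N\<^esub>"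
      using x N.smult_l_null[OF mod_homs_closed[OF \<pi> e[OF i]]] by (simp add: N)
    then have "(\<Oplus>\<^bsub>N\<^esub>k\<in>I - {i}. \<phi> k x \<odot>\<^bsub>N\<^esub> \<pi> (e k)) = (\<Oplus>\<^bsub>N\<^esub>k\<in>I. \<phi> k x \<odot>\<^bsub>N\<^esub> \<pi> (e k))"
      using db_N by (intro N.M.add.finprod_mono_neutral_cong_left)
        (auto simp: dual_basis_def intro!: N.smult_closed)
    then show ?thesis
      using db_N x by (simp add: dual_basis_def)
  qed
  then have "dual_basis N (I - {i}) (\<lambda>k. \<pi> (e k)) \<phi>"
    using db_N by (auto simp: dual_basis_def)
  then have db_W: "dual_basis (fst W) (I - {i}) (\<lambda>k. \<pi> (e k)) \<phi>"
    by (simp add: W_def)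
  have W: "W \<in> endo_pairs scalars"
    using fg_projectiveI[OF db_N] mod_homs_compose[OF \<pi> mod_homs_compose[OF f incl]]
    by (simp add: endo_pairs_def W_def)
  let ?L = "fst (line_endo l)"
  have L: "carrier ?L = {..<1} \<rightarrow>\<^sub>E UNIV" "add ?L = (\<lambda>v w. \<lambda>k\<in>{..<1}. v k + w k)"
    "module.smult ?L = (\<lambda>a v. \<lambda>k\<in>{..<1}. a * v k)"
    by (simp_all add: line_endo_def)
  let ?j = "\<lambda>v :: nat \<Rightarrow> 'a. v 0 \<odot>\<^bsub>M\<^esub> y"
  have j: "?j \<in> endo_homs scalars (line_endo l) V"
    using y fy mod_homs_smult[OF f, of _ y]
    by (auto simp: endo_homs_def L line_endo_def mult.commute simp flip: defs
        smult_assoc1[simplified] simp: smult_l_distr[simplified] intro!: mod_homsI)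
  have p: "\<pi> \<in> endo_homs scalars V W"
  proof -
    \<comment> \<open>f (\<pi> x) differs from f x by a multiple of f y = l y, which \<pi>
      kills.\<close>
    have "\<pi> (f x) = \<pi> (f (\<pi> x))" if x: "x \<in> carrier M" for x
    proof -
      have "\<pi> (f (\<pi> x)) = \<pi> (f x) \<oplus>\<^bsub>N\<^esub> \<psi> x \<odot>\<^bsub>N\<^esub> (l \<odot>\<^bsub>N\<^esub> \<pi> y)"
      proof -
        have "f (\<pi> x) = f x \<oplus>\<^bsub>M\<^esub> \<psi> x \<odot>\<^bsub>M\<^esub> (l \<odot>\<^bsub>M\<^esub> y)"
          using x y by (simp add: \<pi>_def mod_homs_add[OF f] mod_homs_smult[OF f] fy)
        then show ?thesis
          using x y mod_homs_closed[OF f x] by (simp add: mod_homs_add[OF \<pi>] mod_homs_smult[OF \<pi>])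
      qed
      also have "\<dots> = \<pi> (f x)"
        using mod_homs_closed[OF \<pi> mod_homs_closed[OF f x]] N.smult_r_null by (simp add: \<pi>y flip: N(3))
      finally show ?thesis by simp
    qed
    then show ?thesis
      using \<pi> by (simp add: endo_homs_def W_def flip: defs)
  qed
  have ker: "\<pi> x = \<zero>\<^bsub>M\<^esub> \<longleftrightarrow> x \<in> ?j ` carrier ?L" if x: "x \<in> carrier M" for x
  proof
    assume "\<pi> x = \<zero>\<^bsub>M\<^esub>"
    then have "(- \<psi> x) \<odot>\<^bsub>M\<^esub> y = (x \<oplus>\<^bsub>M\<^esub> \<psi> x \<odot>\<^bsub>M\<^esub> y) \<oplus>\<^bsub>M\<^esub> (- \<psi> x) \<odot>\<^bsub>M\<^esub> y"
      using y by (simp add: \<pi>_def)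
    also have "\<dots> = x"
      using x y smult_l_distr[of "\<psi> x" "- \<psi> x" y] smult_l_null by (simp add: M.a_assoc)
    finally have eq: "?j (\<lambda>_\<in>{..<1}. - \<psi> x) = x"
      by (simp only: restrict_apply' lessThan_iff zero_less_one)
    have "(\<lambda>_\<in>{..<1}. - \<psi> x) \<in> carrier ?L" by (simp add: L)
    from imageI[OF this, of ?j] show "x \<in> ?j ` carrier ?L" unfolding eq .
  next
    assume "x \<in> ?j ` carrier ?L"
    then obtain a where "x = a \<odot>\<^bsub>M\<^esub> y" by (rule imageE) blast
    then show "\<pi> x = \<zero>\<^bsub>M\<^esub>"
      using mod_homs_smult[OF \<pi> _ y, of a] N.smult_r_null[of a] by (simp add: \<pi>y N)
  qed
  have "short_exact scalars (line_endo l) V W"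
    unfolding short_exact_def
  proof (intro bexI[OF _ j] bexI[OF _ p] conjI)
    have "a = b" if "a \<odot>\<^bsub>M\<^esub> y = b \<odot>\<^bsub>M\<^esub> y" for a b
      using arg_cong[OF that, of "\<phi> i"] y iy by (simp add: \<phi>_smult)
    then show "inj_on (\<lambda>v. v 0 \<odot>\<^bsub>M\<^esub> y) (carrier ?L)"
      unfolding L by (intro inj_onI PiE_ext) auto
    show "?j ` carrier ?L = {x \<in> carrier (fst V). \<pi> x = \<zero>\<^bsub>fst W\<^esub>}"
      using y ker by (auto simp: W_def N simp flip: defs)
    show "\<pi> ` carrier (fst V) = carrier (fst W)"
      using mod_homs_closed[OF \<pi>] \<pi>_id by (force simp: W_def N simp flip: defs)
  qed
  then show ?thesis using that W db_W by blast
qed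

section \<open>The ghost map on \<open>K\<^sub>0\<close>\<close>

text \<open>The additive extension of g to formal sums with values in a ring;
  \<open>frag_extend\<close> covers the case where the values are again formal sums.\<close>

definition frag_eval :: "('x \<Rightarrow> 'a::comm_ring_1) \<Rightarrow> ('x \<Rightarrow>\<^sub>0 int) \<Rightarrow> 'a" where
  "frag_eval g c = (\<Sum>x\<in>Poly_Mapping.keys c. of_int (Poly_Mapping.lookup c x) * g x)"

lemma frag_eval_superset:
  assumes "finite S" "Poly_Mapping.keys c \<subseteq> S"
  shows "frag_eval g c = (\<Sum>x\<in>S. of_int (Poly_Mapping.lookup c x) * g x)"
  unfolding frag_eval_def using assms
  by (intro sum.mono_neutral_left) (auto simp: in_keys_iff)

lemma frag_eval_0 [simp]: "frag_eval g 0 = 0"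
  and frag_eval_of [simp]: "frag_eval g (frag_of x) = g x"
  by (simp_all add: frag_eval_def)

lemma frag_eval_add: "frag_eval g (c + d) = frag_eval g c + frag_eval g d"
  using keys_add[of c d]
  by (simp add: frag_eval_superset[of "Poly_Mapping.keys c \<union> Poly_Mapping.keys d"]
      lookup_add distrib_right sum.distrib)

lemma frag_eval_minus: "frag_eval g (- c) = - frag_eval g c"
  by (simp add: frag_eval_def sum_negf)

lemma frag_eval_diff: "frag_eval g (c - d) = frag_eval g c - frag_eval g d"
  using frag_eval_add[of g c "- d"] by (simp add: frag_eval_minus)

lemma frag_eval_sum: "frag_eval g (\<Sum>i\<in>I. c i) = (\<Sum>i\<in>I. frag_eval g (c i))"
  by (induction I rule: infinite_finite_induct) (simp_all add: frag_eval_add)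

lemma frag_eval_cong:
  assumes "\<And>x. x \<in> Poly_Mapping.keys c \<Longrightarrow> g x = h x"
  shows "frag_eval g c = frag_eval h c"
  using assms by (simp add: frag_eval_def)

lemma frag_eval_mult_right: "frag_eval (\<lambda>x. a * g x) c = a * frag_eval g c"
  by (simp add: frag_eval_def sum_distrib_left mult.left_commute)

lemma frag_eval_extend:
  "frag_eval g (frag_extend b c) = frag_eval (\<lambda>x. frag_eval g (b x)) c"
  by (rule frag_induction[of c UNIV]) (simp_all add: frag_extend_diff frag_eval_diff)

text \<open>Multiplicativity is asked for on the keys alone, because \<open>endo_tensor\<close> is
  under control only for members of \<open>endo_pairs\<close>.\<close>

lemma frag_eval_bilinear:
  assumes "\<And>x y. x \<in> Poly_Mapping.keys c \<Longrightarrow> y \<in> Poly_Mapping.keys d \<Longrightarrow> g (m x y) = g x * g y"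
  shows "frag_eval g (frag_bilinear m c d) = frag_eval g c * frag_eval g d"
proof -
  have "frag_eval g (frag_bilinear m c d) = frag_eval (\<lambda>x. frag_eval (\<lambda>y. g (m x y)) d) c"
    unfolding frag_bilinear_def frag_eval_extend by simp
  also have "\<dots> = frag_eval (\<lambda>x. frag_eval g d * g x) c"
  proof (rule frag_eval_cong)
    fix x assume x: "x \<in> Poly_Mapping.keys c"
    have "frag_eval (\<lambda>y. g (m x y)) d = frag_eval (\<lambda>y. g x * g y) d"
      using assms x by (intro frag_eval_cong)
    then show "frag_eval (\<lambda>y. g (m x y)) d = frag_eval g d * g x"
      unfolding frag_eval_mult_right by (simp only: mult.commute)
  qed
  also have "\<dots> = frag_eval g d * frag_eval g c"
    by (rule frag_eval_mult_right)
  finally show ?thesis by (simp only: mult.commute)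
qed

lemma keys_frag_extend_subset:
  assumes "\<And>x. x \<in> Poly_Mapping.keys c \<Longrightarrow> Poly_Mapping.keys (f x) \<subseteq> S"
  shows "Poly_Mapping.keys (frag_extend f c) \<subseteq> S"
  using keys_frag_extend[of f c] assms by fastforce

lemma keys_frag_bilinear_subset:
  assumes "\<And>x y. x \<in> Poly_Mapping.keys c \<Longrightarrow> y \<in> Poly_Mapping.keys d \<Longrightarrow> m x y \<in> S"
  shows "Poly_Mapping.keys (frag_bilinear m c d) \<subseteq> S"
  unfolding frag_bilinear_def using assms
  by (intro keys_frag_extend_subset) simp

lemma keys_add_subset:
  "Poly_Mapping.keys c \<subseteq> S \<Longrightarrow> Poly_Mapping.keys d \<subseteq> S \<Longrightarrow> Poly_Mapping.keys (c + d) \<subseteq> S"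
  using keys_add[of c d] by blast

text \<open>With exponents from 1 on, one factor x is absorbed into the weight before
  \<open>sum_powers_eq_0_imp\<close> is applied, and it is cancelled afterwards since x is not 0.
  Characteristic zero recovers the integer weight from its image in the field.\<close>

lemma frag_eval_powers_inject:
  fixes c d :: "'a::field \<Rightarrow>\<^sub>0 int"
  assumes char: "CHAR('a) = 0" and 0: "0 \<notin> Poly_Mapping.keys c" "0 \<notin> Poly_Mapping.keys d"
    and eq: "\<And>k. k \<ge> 1 \<Longrightarrow> frag_eval (\<lambda>x. x ^ k) c = frag_eval (\<lambda>x. x ^ k) d"
  shows "c = d"
proof (rule poly_mapping_eqI)
  fix x
  let ?S = "Poly_Mapping.keys (c - d)" and ?w = "\<lambda>x. of_int (Poly_Mapping.lookup (c - d) x) * x"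
  have "(\<Sum>x\<in>?S. ?w x * x ^ k) = 0" for k
    using eq[of "Suc k"] frag_eval_diff[of "\<lambda>x. x ^ Suc k" c d]
    by (simp add: frag_eval_def mult.assoc)
  then have w: "?w x = 0" if "x \<in> ?S"
    using sum_powers_eq_0_imp[of ?S ?w] that by simp
  show "Poly_Mapping.lookup c x = Poly_Mapping.lookup d x"
  proof (rule ccontr)
    assume "\<not> ?thesis"
    then have "x \<in> ?S" by (simp add: in_keys_iff lookup_minus)
    moreover from this have "x \<noteq> 0" using 0 keys_diff[of c d] by blast
    ultimately show False
      using w char by (simp add: of_int_eq_0_iff_char_dvd in_keys_iff)
  qed
qed

text \<open>With the exponent 0 included the point 0 is visible as well, since 0^0 = 1; eigenvalue 0
  has to be detected in \<open>K0\<close>.\<close>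

lemma frag_eval_powers_inject0:
  fixes c d :: "'a::field \<Rightarrow>\<^sub>0 int"
  assumes char: "CHAR('a) = 0" and eq: "\<And>k. frag_eval (\<lambda>x. x ^ k) c = frag_eval (\<lambda>x. x ^ k) d"
  shows "c = d"
proof (rule poly_mapping_eqI, rule ccontr)
  fix x assume "Poly_Mapping.lookup c x \<noteq> Poly_Mapping.lookup d x"
  then have x: "x \<in> Poly_Mapping.keys (c - d)" by (simp add: in_keys_iff lookup_minus)
  have "(\<Sum>x\<in>Poly_Mapping.keys (c - d). of_int (Poly_Mapping.lookup (c - d) x) * x ^ k) = 0" for k
    using eq[of k] frag_eval_diff[of "\<lambda>x. x ^ k" c d] by (simp add: frag_eval_def)
  then have "of_int (Poly_Mapping.lookup (c - d) x) = (0 :: 'a)"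
    by (rule sum_powers_eq_0_imp[OF finite_keys _ x])
  then show False
    using x char by (simp add: of_int_eq_0_iff_char_dvd in_keys_iff)
qed

section \<open>Formal differences of objects and the subgroup of relations\<close>

definition ghost :: "(('a::comm_ring_1, 'b) endo \<Rightarrow>\<^sub>0 int) \<Rightarrow> nat \<Rightarrow> 'a" where
  "ghost c k = frag_eval (\<lambda>V. endo_ghost V k) c"

lemma ghost_simps [simp]:
  "ghost 0 k = 0" "ghost (frag_of V) k = endo_ghost V k"
  "ghost (c + d) k = ghost c k + ghost d k" "ghost (- c) k = - ghost c k"
  "ghost (c - d) k = ghost c k - ghost d k"
  by (simp_all add: ghost_def frag_eval_add frag_eval_minus frag_eval_diff)

definition virtual :: "(('a::comm_ring_1, nat \<Rightarrow> 'a) endo \<Rightarrow>\<^sub>0 int) set" where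
  "virtual = {c. Poly_Mapping.keys c \<subseteq> endo_pairs scalars}"

lemma carrier_K0_free: "carrier (K0_free scalars) = virtual"
  by (auto simp: K0_free_def virtual_def)

lemma K0_free_simps [simp]:
  "mult (K0_free A) = (+)" "one (K0_free A) = 0"
  by (auto simp: K0_free_def fun_eq_iff)

lemma comm_group_K0_free: "comm_group (K0_free A)"
  by (simp add: K0_free_def abelian_free_Abelian_group)

lemma virtual_simps [simp]:
  "0 \<in> virtual" "frag_of V \<in> virtual \<longleftrightarrow> V \<in> endo_pairs scalars"
  by (auto simp: virtual_def)

lemma virtual_add [intro]: "c \<in> virtual \<Longrightarrow> d \<in> virtual \<Longrightarrow> c + d \<in> virtual"
  by (simp add: virtual_def keys_add_subset)

lemma virtual_minus [intro]: "c \<in> virtual \<Longrightarrow> - c \<in> virtual"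
  by (simp add: virtual_def)

lemma virtual_diff [intro]: "c \<in> virtual \<Longrightarrow> d \<in> virtual \<Longrightarrow> c - d \<in> virtual"
  using virtual_add[of c "- d"] virtual_minus[of d] by simp

lemma virtual_tensor:
  "c \<in> virtual \<Longrightarrow> d \<in> virtual \<Longrightarrow> frag_bilinear (endo_tensor scalars) c d \<in> virtual"
  unfolding virtual_def mem_Collect_eq
  by (intro keys_frag_bilinear_subset endo_tensor_in_endo_pairs) blast+

lemma ghost_tensor:
  assumes "c \<in> virtual" "d \<in> virtual"
  shows "ghost (frag_bilinear (endo_tensor scalars) c d) k = ghost c k * ghost d k"
  unfolding ghost_def using assms
  by (intro frag_eval_bilinear endo_ghost_tensor endo_tensor_in_endo_pairs
      is_endo_tensor_endo_tensor) (auto simp: virtual_def)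

lemma subgroup_K0_null: "subgroup (K0_null scalars) (K0_free (scalars :: 'a::comm_ring_1 ring))"
proof -
  interpret comm_group "K0_free (scalars :: 'a ring)" by (rule comm_group_K0_free)
  show ?thesis
    unfolding K0_null_def by (rule generate_is_subgroup) (auto simp: carrier_K0_free intro!: virtual_diff)
qed

lemma K0_null_relation:
  assumes "V' \<in> endo_pairs scalars" "V \<in> endo_pairs scalars" "V'' \<in> endo_pairs scalars"
    "short_exact scalars V' V V''"
  shows "frag_of V - frag_of V' - frag_of V'' \<in> K0_null scalars"
  unfolding K0_null_def using assms by (intro generate.incl) blast

lemma K0_null_virtual: "c \<in> K0_null scalars \<Longrightarrow> c \<in> virtual"
  using subgroup.subset[OF subgroup_K0_null] by (auto simp: carrier_K0_free)

lemma K0_null_add: "c \<in> K0_null scalars \<Longrightarrow> d \<in> K0_null scalars \<Longrightarrow> c + d \<in> K0_null scalars"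
  using subgroup.m_closed[OF subgroup_K0_null] by fastforce

lemma K0_free_inv: "c \<in> virtual \<Longrightarrow> inv\<^bsub>K0_free scalars\<^esub> c = - c"
  by (simp add: K0_free_def virtual_def)

lemma K0_null_minus: "c \<in> K0_null scalars \<Longrightarrow> - c \<in> K0_null scalars"
  using subgroup.m_inv_closed[OF subgroup_K0_null] K0_free_inv[OF K0_null_virtual] by metis

lemma K0_null_diff: "c \<in> K0_null scalars \<Longrightarrow> d \<in> K0_null scalars \<Longrightarrow> c - d \<in> K0_null scalars"
  using K0_null_add[of c "- d"] K0_null_minus[of d] by simp

lemma ghost_K0_null:
  fixes c :: "('a::comm_ring_1, nat \<Rightarrow> 'a) endo \<Rightarrow>\<^sub>0 int"
  assumes "c \<in> K0_null scalars"
  shows "ghost c k = 0"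
proof -
  have rel: "h \<in> virtual \<and> ghost h k = 0" if "h \<in> {frag_of V - frag_of V' - frag_of V'' | V' V V''.
      V' \<in> endo_pairs scalars \<and> V \<in> endo_pairs scalars \<and> V'' \<in> endo_pairs scalars \<and>
      short_exact scalars V' V V''}" for h :: "('a, nat \<Rightarrow> 'a) endo \<Rightarrow>\<^sub>0 int"
    using that by (auto simp: endo_ghost_short_exact intro!: virtual_diff)
  show ?thesis
    using assms unfolding K0_null_def
  proof (induction rule: generate.induct)
    case (incl h)
    then show ?case using rel by blast
  next
    case (inv h)
    then show ?case using rel[OF inv] by (simp add: K0_free_inv)
  qed simp_all
qed

text \<open>It has two uses: as a normal form modulo relations, recording eigenvalues with
  multiplicity, and, restricted to \<Sigma>, as a lift of the embedding of the group ring.\<close>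

definition line_sum :: "('a::comm_ring_1 \<Rightarrow>\<^sub>0 int) \<Rightarrow> (('a, nat \<Rightarrow> 'a) endo \<Rightarrow>\<^sub>0 int)" where
  "line_sum = frag_extend (\<lambda>l. frag_of (line_endo l))"

lemma line_sum_virtual: "line_sum d \<in> virtual"
  unfolding virtual_def line_sum_def mem_Collect_eq
  by (rule keys_frag_extend_subset) (simp add: line_endo_in_endo_pairs)

lemma ghost_line_sum: "ghost (line_sum d) k = frag_eval (\<lambda>x. x ^ k) d"
  by (simp add: ghost_def line_sum_def frag_eval_extend endo_ghost_line_endo)

lemma line_sum_diff: "line_sum (c - d) = line_sum c - line_sum d"
  and line_sum_0: "line_sum 0 = 0"
  and line_sum_add: "line_sum (c + d) = line_sum c + line_sum d"
  and line_sum_of: "line_sum (frag_of l) = frag_of (line_endo l)"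
  by (simp_all add: line_sum_def frag_extend_diff frag_extend_add)

text \<open>Each eigenline split off also removes one member of the dual basis, so the induction
  runs on card I instead of a dimension. The case split is on the module being zero, since a
  redundant dual basis of a zero module can be nonempty.\<close>

lemma frag_of_minus_line_sum_K0_null:
  fixes V :: "('a::alg_closed_field, nat \<Rightarrow> 'a) endo"
  assumes "V \<in> endo_pairs scalars" "dual_basis (fst V) I e \<phi>"
  shows "\<exists>d. frag_of V - line_sum d \<in> K0_null scalars"
  using assms
proof (induction "card I" arbitrary: I V e rule: less_induct)
  case less
  note V = less.prems(1) and db = less.prems(2)
  interpret Module.module scalars "fst V" by (rule endo_pairsD(3)[OF V])
  show ?case
  proof (cases "carrier (fst V) = {\<zero>\<^bsub>fst V\<^esub>}")
    case True
    \<comment> \<open>For a zero module the identity maps give this sequence, and its relation V - V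
      - V puts - V among the relations.\<close>
    have "short_exact scalars V V V"
      unfolding short_exact_def using endo_pairsD(2)[OF V] True
      by (intro bexI[of _ "\<lambda>x. x"]) (auto simp: endo_homs_def mod_homs_def)
    from K0_null_minus[OF K0_null_relation[OF V V V this]]
    show ?thesis by (intro exI[of _ 0]) (simp add: line_sum_0)
  next
    case False
    then obtain x where "x \<in> carrier (fst V)" "x \<noteq> \<zero>\<^bsub>fst V\<^esub>" by blast
    then obtain y l where y: "y \<in> carrier (fst V)" "y \<noteq> \<zero>\<^bsub>fst V\<^esub>" "snd V y = l \<odot>\<^bsub>fst V\<^esub> y"
      using eigenvector_exists[OF db endo_pairsD(2)[OF V]] by metis
    obtain i where i: "i \<in> I" "\<phi> i y \<noteq> 0"
      using dual_basis_eq_zero[OF db y(1)] y(2) by blast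
    obtain W :: "('a, nat \<Rightarrow> 'a) endo" and e' where W: "W \<in> endo_pairs scalars"
      and ex: "short_exact scalars (line_endo l) V W" and db': "dual_basis (fst W) (I - {i}) e' \<phi>"
      using endo_pairs_split_eigenvector[OF V db y(1,3) i(1)] i(2) by metis
    have "card (I - {i}) < card I"
      using i db by (intro card_Diff1_less) (auto simp: dual_basis_def)
    then obtain d where d: "frag_of W - line_sum d \<in> K0_null scalars"
      using less.hyps W db' by blast
    have "(frag_of V - frag_of (line_endo l) - frag_of W) + (frag_of W - line_sum d) \<in> K0_null scalars"
      by (intro K0_null_add d K0_null_relation line_endo_in_endo_pairs V W ex)
    then have "frag_of V - line_sum (frag_of l + d) \<in> K0_null scalars"
      by (simp add: line_sum_add line_sum_of algebra_simps)
    then show ?thesis by blast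
  qed
qed

lemma virtual_minus_line_sum_K0_null:
  fixes c :: "('a::alg_closed_field, nat \<Rightarrow> 'a) endo \<Rightarrow>\<^sub>0 int"
  assumes "c \<in> virtual"
  shows "\<exists>d. c - line_sum d \<in> K0_null scalars"
proof (rule free_Abelian_group_induct[of c "endo_pairs scalars"])
  show "Poly_Mapping.keys c \<subseteq> endo_pairs scalars" using assms by (simp add: virtual_def)
  show "\<exists>d. 0 - line_sum d \<in> K0_null (scalars :: 'a ring)"
    using subgroup.one_closed[OF subgroup_K0_null[where 'a = 'a]]
    by (intro exI[of _ 0]) (simp add: line_sum_0)
  show "\<exists>d. x - y - line_sum d \<in> K0_null scalars"
    if ex: "\<exists>d. x - line_sum d \<in> K0_null scalars" "\<exists>d. y - line_sum d \<in> K0_null scalars"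
    for x y :: "('a, nat \<Rightarrow> 'a) endo \<Rightarrow>\<^sub>0 int"
  proof -
    obtain d d' where "x - line_sum d \<in> K0_null scalars" "y - line_sum d' \<in> K0_null scalars"
      using ex by blast
    from K0_null_diff[OF this] show ?thesis
      by (intro exI[of _ "d - d'"]) (simp add: line_sum_diff algebra_simps)
  qed
  show "\<exists>d. frag_of V - line_sum d \<in> K0_null scalars" if "V \<in> endo_pairs scalars"
    for V :: "('a, nat \<Rightarrow> 'a) endo"
    using endo_pairs_dual_basis[OF that] frag_of_minus_line_sum_K0_null[OF that] by metis
qed

text \<open>The ghost map is faithful on \<open>K\<^sub>0\<close> in characteristic zero; in positive characteristic the traces
  only see multiplicities of eigenvalues modulo the characteristic.\<close>

lemma K0_null_iff_ghost:
  fixes c :: "('a::alg_closed_field, nat \<Rightarrow> 'a) endo \<Rightarrow>\<^sub>0 int"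
  assumes char: "CHAR('a) = 0" and c: "c \<in> virtual"
  shows "c \<in> K0_null scalars \<longleftrightarrow> (\<forall>k. ghost c k = 0)"
proof
  assume 0: "\<forall>k. ghost c k = 0"
  obtain d where d: "c - line_sum d \<in> K0_null scalars"
    using virtual_minus_line_sum_K0_null[OF c] by blast
  have "frag_eval (\<lambda>x. x ^ k) d = frag_eval (\<lambda>x. x ^ k) 0" for k
    using ghost_K0_null[OF d, of k] 0 by (simp add: ghost_line_sum)
  then have "d = 0" by (rule frag_eval_powers_inject0[OF char])
  then show "c \<in> K0_null scalars" using d by (simp add: line_sum_0)
qed (simp add: ghost_K0_null)

section \<open>The rings \<open>K\<^sub>0\<close> and \<open>W\<^sub>0\<close>\<close>

text \<open>Two formal sums lie in one coset if their difference is a relation, and relations are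
  detected by ghosts. Reading cosets as fibres of the ghost map is what makes the operations on them
  computable below.\<close>

lemma K0_coset_eq:
  fixes c d :: "('a::alg_closed_field, nat \<Rightarrow> 'a) endo \<Rightarrow>\<^sub>0 int"
  assumes char: "CHAR('a) = 0" and c: "c \<in> virtual"
  shows "K0_coset scalars c = {d \<in> virtual. \<forall>k. ghost d k = ghost c k}"
proof (intro Set.set_eqI)
  fix d :: "('a, nat \<Rightarrow> 'a) endo \<Rightarrow>\<^sub>0 int"
  have "d \<in> K0_coset scalars c \<longleftrightarrow> (\<exists>h\<in>K0_null scalars. d = h + c)"
    by (auto simp: K0_coset_def r_coset_def)
  also have "\<dots> \<longleftrightarrow> d \<in> virtual \<and> d - c \<in> K0_null scalars"
    using c K0_null_virtual by (force intro: bexI[of _ "d - c"])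
  also have "\<dots> \<longleftrightarrow> d \<in> virtual \<and> (\<forall>k. ghost d k = ghost c k)"
    using c K0_null_iff_ghost[OF char, of "d - c"] by auto
  finally show "d \<in> K0_coset scalars c \<longleftrightarrow> d \<in> {d \<in> virtual. \<forall>k. ghost d k = ghost c k}"
    by simp
qed

definition W0_class ::
  "(('a::comm_ring_1, nat \<Rightarrow> 'a) endo \<Rightarrow>\<^sub>0 int) \<Rightarrow> (('a, nat \<Rightarrow> 'a) endo \<Rightarrow>\<^sub>0 int) set set" where
  "W0_class c = W0_ideal scalars +>\<^bsub>K0 scalars\<^esub> K0_coset scalars c"

context
  assumes char0: "CHAR('c::alg_closed_field) = 0"
begin

lemma K0_coset_inject:
  fixes c d :: "('c, nat \<Rightarrow> 'c) endo \<Rightarrow>\<^sub>0 int"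
  assumes "c \<in> virtual" "d \<in> virtual"
  shows "K0_coset scalars c = K0_coset scalars d \<longleftrightarrow> (\<forall>k. ghost c k = ghost d k)"
proof
  assume eq: "K0_coset scalars c = K0_coset scalars d"
  have "c \<in> K0_coset scalars c" using assms by (simp add: K0_coset_eq[OF char0])
  then have "c \<in> K0_coset scalars d" unfolding eq .
  then show "\<forall>k. ghost c k = ghost d k" using assms by (simp add: K0_coset_eq[OF char0])
qed (simp add: K0_coset_eq[OF char0] assms)

lemma carrier_K0: "carrier (K0 (scalars :: 'c ring)) = K0_coset scalars ` virtual"
  by (simp add: K0_def carrier_FactGroup carrier_K0_free K0_coset_def[abs_def])

lemma K0_add:
  fixes c d :: "('c, nat \<Rightarrow> 'c) endo \<Rightarrow>\<^sub>0 int"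
  assumes "c \<in> virtual" "d \<in> virtual"
  shows "K0_coset scalars c \<oplus>\<^bsub>K0 scalars\<^esub> K0_coset scalars d = K0_coset scalars (c + d)"
proof -
  interpret comm_group "K0_free (scalars :: 'c ring)" by (rule comm_group_K0_free)
  interpret normal "K0_null (scalars :: 'c ring)" "K0_free (scalars :: 'c ring)"
    using subgroup_K0_null by (simp add: normal_iff_subgroup)
  show ?thesis
    using rcos_sum[of c d] assms by (simp add: K0_def K0_coset_def carrier_K0_free)
qed

lemma K0_zero: "\<zero>\<^bsub>K0 (scalars :: 'c ring)\<^esub> = K0_coset scalars 0"
proof -
  interpret comm_group "K0_free (scalars :: 'c ring)" by (rule comm_group_K0_free)
  show ?thesis
    using coset_mult_one[of "K0_null scalars"] subgroup.subset[OF subgroup_K0_null[where 'a = 'c]]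
    by (simp add: K0_def K0_coset_def)
qed

text \<open>The ghost vector of the product depends only on the ghost vectors of the factors, so
  every choice of representatives contributes the same coset to the union.\<close>

lemma K0_mult:
  fixes c d :: "('c, nat \<Rightarrow> 'c) endo \<Rightarrow>\<^sub>0 int"
  assumes c: "c \<in> virtual" and d: "d \<in> virtual"
  shows "K0_coset scalars c \<otimes>\<^bsub>K0 scalars\<^esub> K0_coset scalars d =
    K0_coset scalars (frag_bilinear (endo_tensor scalars) c d)"
proof -
  have "K0_coset scalars (frag_bilinear (endo_tensor scalars) c' d') =
      K0_coset scalars (frag_bilinear (endo_tensor scalars) c d)"
    if "c' \<in> K0_coset scalars c" "d' \<in> K0_coset scalars d" for c' d'
    using that c d by (simp add: K0_coset_eq[OF char0] virtual_tensor ghost_tensor)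
  moreover have "c \<in> K0_coset scalars c" "d \<in> K0_coset scalars d"
    using c d by (simp_all add: K0_coset_eq[OF char0])
  ultimately have "(\<Union>c'\<in>K0_coset scalars c. \<Union>d'\<in>K0_coset scalars d.
      K0_coset scalars (frag_bilinear (endo_tensor scalars) c' d')) =
      K0_coset scalars (frag_bilinear (endo_tensor scalars) c d)"
    by blast
  then show ?thesis by (simp add: K0_def)
qed

lemma K0_class_eq:
  fixes V :: "('c, 'b) endo"
  assumes "V \<in> endo_pairs scalars"
  shows "K0_class scalars V = {d \<in> virtual. \<forall>k. ghost d k = endo_ghost V k}"
  using assms
  by (simp add: K0_class_def K0_coset_eq[OF char0] endo_rep_in_endo_pairs endo_ghost_endo_rep)

text \<open>Both objects have the constant ghost vector 1. Representing the unit by a line matches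
  it with the image of 1 in \<Sigma>.\<close>

lemma K0_one: "\<one>\<^bsub>K0 (scalars :: 'c ring)\<^esub> = K0_coset scalars (frag_of (line_endo 1))"
proof -
  have reg: "(scalar_module, id) \<in> endo_pairs (scalars :: 'c ring)"
    using fg_projectiveI[OF dual_basis_scalar_module] by (simp add: endo_pairs_def mod_homs_def)
  have "(id :: 'c \<Rightarrow> 'c) ^^ k = id" for k by (induction k) auto
  then have "endo_ghost (scalar_module, id :: 'c \<Rightarrow> 'c) k = 1" for k
    using mod_trace_eq[OF dual_basis_scalar_module, of "id :: 'c \<Rightarrow> 'c"]
    by (simp add: endo_ghost_def mod_homs_def)
  then show ?thesis
    using K0_class_eq[OF reg]
    by (simp add: K0_def K0_coset_eq[OF char0] line_endo_in_endo_pairs endo_ghost_line_endo)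
qed

lemma K0_coset_closed: "c \<in> virtual \<Longrightarrow> K0_coset scalars c \<in> carrier (K0 (scalars :: 'c ring))"
  by (simp add: carrier_K0)

lemma K0_cases:
  assumes "x \<in> carrier (K0 (scalars :: 'c ring))"
  obtains c where "x = K0_coset scalars c" "c \<in> virtual"
  using assms by (auto simp: carrier_K0)

text \<open>Through \<open>K0_coset_inject\<close> every axiom becomes the same axiom between
  elements of the field, once for each k.\<close>

lemma cring_K0: "cring (K0 (scalars :: 'c ring))"
proof (rule cringI)
  let ?K = "K0 (scalars :: 'c ring)"
  note simps = K0_add K0_mult K0_zero K0_one K0_coset_closed virtual_add virtual_minus
    virtual_tensor K0_coset_inject ghost_tensor endo_ghost_line_endo line_endo_in_endo_pairs
  show "abelian_group ?K"
  proof (rule abelian_groupI)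
    fix x assume "x \<in> carrier ?K"
    then show "\<exists>y\<in>carrier ?K. y \<oplus>\<^bsub>?K\<^esub> x = \<zero>\<^bsub>?K\<^esub>"
    proof (rule K0_cases)
      fix c assume c: "x = K0_coset scalars c" "c \<in> virtual"
      then show ?thesis
        by (intro bexI[of _ "K0_coset scalars (- c)"]) (simp_all add: simps)
    qed
  qed (((elim K0_cases)?, simp add: simps algebra_simps)+)
  show "comm_monoid ?K"
    by (rule comm_monoidI; (elim K0_cases)?; simp add: simps algebra_simps)
  fix x y z assume "x \<in> carrier ?K" "y \<in> carrier ?K" "z \<in> carrier ?K"
  then show "(x \<oplus>\<^bsub>?K\<^esub> y) \<otimes>\<^bsub>?K\<^esub> z = x \<otimes>\<^bsub>?K\<^esub> z \<oplus>\<^bsub>?K\<^esub> y \<otimes>\<^bsub>?K\<^esub> z"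
    by (elim K0_cases) (simp add: simps algebra_simps)
qed

text \<open>One inclusion is minimality: a generator has zero k-th power for k \<ge> 1, and the
  right-hand side is an ideal. For the other inclusion a single generator suffices, the line with
  eigenvalue 0.\<close>

lemma W0_ideal_eq:
  "W0_ideal (scalars :: 'c ring) =
     {K0_coset scalars c | c. c \<in> virtual \<and> (\<forall>k\<ge>1. ghost c k = 0)}" (is "_ = ?I")
proof -
  interpret cring "K0 (scalars :: 'c ring)" by (rule cring_K0)
  let ?K = "K0 (scalars :: 'c ring)"
  let ?S = "{K0_class scalars V | V :: ('c, nat \<Rightarrow> 'c) endo.
    V \<in> endo_pairs scalars \<and> (\<forall>x\<in>carrier (fst V). snd V x = \<zero>\<^bsub>fst V\<^esub>)}"
  have S: "?S \<subseteq> ?I"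
  proof safe
    fix E :: "('c, nat \<Rightarrow> 'c) module" and f
    assume V: "(E, f) \<in> endo_pairs scalars"
      and 0: "\<forall>x\<in>carrier (fst (E, f)). snd (E, f) x = \<zero>\<^bsub>fst (E, f)\<^esub>"
    obtain n e \<phi> where db: "dual_basis E {..<n::nat} e \<phi>"
      using endo_pairs_dual_basis[OF V] by auto
    have E: "Module.module scalars E" and f: "f \<in> mod_homs scalars E E"
      using endo_pairsD[OF V] by auto
    have "endo_ghost (E, f) k = 0" if k: "k \<ge> 1" for k
    proof -
      obtain m where m: "k = Suc m" using k by (cases k) auto
      have "\<phi> i ((f ^^ k) (e i)) = 0" if "i < n" for i
      proof -
        have "(f ^^ m) (e i) \<in> carrier E"
          using db that mod_homs_closed[OF mod_homs_funpow[OF f]] by (auto simp: dual_basis_def)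
        then have "(f ^^ k) (e i) = \<zero>\<^bsub>E\<^esub>" using 0 by (simp add: m)
        then show ?thesis
          using db that mod_homs_zero[OF E module_scalar_module, of "\<phi> i"]
          by (auto simp: dual_basis_def)
      qed
      then show ?thesis
        by (simp add: endo_ghost_def mod_trace_eq[OF db mod_homs_funpow[OF f]])
    qed
    then show "\<exists>c. K0_class scalars (E, f) = K0_coset scalars c \<and> c \<in> virtual \<and>
        (\<forall>k\<ge>1. ghost c k = 0)"
      using V by (intro exI[of _ "frag_of (E, f)"]) (simp add: K0_class_eq K0_coset_eq[OF char0])
  qed
  have "ideal ?I ?K"
  proof (rule idealI)
    show "ring ?K" ..
    show "subgroup ?I (add_monoid ?K)"
    proof (rule add.subgroupI)
      show "?I \<subseteq> carrier ?K" by (auto simp: carrier_K0)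
      show "?I \<noteq> {}" by (auto intro!: exI[of _ 0])
    next
      fix a assume "a \<in> ?I"
      then obtain c where c: "a = K0_coset scalars c" "c \<in> virtual" "\<forall>k\<ge>1. ghost c k = 0" by blast
      have "\<ominus>\<^bsub>?K\<^esub> a = K0_coset scalars (- c)"
        using c by (intro minus_equality)
          (auto simp: K0_add virtual_minus carrier_K0 K0_zero)
      then show "\<ominus>\<^bsub>?K\<^esub> a \<in> ?I" using c by (auto intro!: exI[of _ "- c"])
    next
      fix a b assume "a \<in> ?I" "b \<in> ?I"
      then obtain c d where "a = K0_coset scalars c" "c \<in> virtual" "\<forall>k\<ge>1. ghost c k = 0"
        "b = K0_coset scalars d" "d \<in> virtual" "\<forall>k\<ge>1. ghost d k = 0" by blast
      then show "a \<oplus>\<^bsub>?K\<^esub> b \<in> ?I"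
        by (auto simp: K0_add intro!: exI[of _ "c + d"])
    qed
  next
    fix a x assume "a \<in> ?I" "x \<in> carrier ?K"
    then obtain c d where *: "a = K0_coset scalars c" "c \<in> virtual" "\<forall>k\<ge>1. ghost c k = 0"
      "x = K0_coset scalars d" "d \<in> virtual" by (auto simp: carrier_K0)
    then show "x \<otimes>\<^bsub>?K\<^esub> a \<in> ?I"
      by (auto simp: K0_mult virtual_tensor ghost_tensor
          intro!: exI[of _ "frag_bilinear (endo_tensor scalars) d c"])
    from * show "a \<otimes>\<^bsub>?K\<^esub> x \<in> ?I"
      by (auto simp: K0_mult virtual_tensor ghost_tensor
          intro!: exI[of _ "frag_bilinear (endo_tensor scalars) c d"])
  qed
  then have le: "W0_ideal (scalars :: 'c ring) \<subseteq> ?I"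
    unfolding W0_ideal_def using S by (rule genideal_minimal)
  have S_carrier: "?S \<subseteq> carrier ?K" using S by (rule order_trans) (auto simp: carrier_K0)
  interpret I: ideal "W0_ideal (scalars :: 'c ring)" ?K
    unfolding W0_ideal_def by (rule genideal_ideal[OF S_carrier])
  let ?L = "frag_of (line_endo (0 :: 'c))"
  have L: "?L \<in> virtual" by (simp add: line_endo_in_endo_pairs)
  have "K0_class scalars (line_endo (0 :: 'c)) \<in> ?S"
    using line_endo_in_endo_pairs[of "0 :: 'c"] by (force simp: line_endo_def)
  then have "K0_class scalars (line_endo (0 :: 'c)) \<in> W0_ideal scalars"
    unfolding W0_ideal_def using genideal_self[OF S_carrier] by blast
  moreover have "K0_class scalars (line_endo (0 :: 'c)) = K0_coset scalars ?L"
    by (simp add: K0_class_eq K0_coset_eq[OF char0] line_endo_in_endo_pairs)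
  ultimately have LI: "K0_coset scalars ?L \<in> W0_ideal scalars" by simp
  have "K0_coset scalars c \<in> W0_ideal scalars"
    if c: "c \<in> virtual" and 0: "\<forall>k\<ge>1. ghost c k = 0" for c :: "('c, nat \<Rightarrow> 'c) endo \<Rightarrow>\<^sub>0 int"
  proof -
    \<comment> \<open>Multiplying by the class of the line with eigenvalue 0, whose ghost vector is \<open>(1, 0, 0, \<dots>)\<close>, fixes \<open>c\<close>.\<close>
    have "ghost c k = ghost c k * 0 ^ k" for k
      using 0 by (cases k) auto
    then have "K0_coset scalars c = K0_coset scalars c \<otimes>\<^bsub>?K\<^esub> K0_coset scalars ?L"
      using c L by (simp add: K0_mult K0_coset_inject virtual_tensor ghost_tensor endo_ghost_line_endo)
    then show ?thesis
      using I.I_l_closed[OF LI, of "K0_coset scalars c"] c by (simp add: carrier_K0)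
  qed
  then show ?thesis using le by blast
qed

lemma ideal_W0_ideal: "ideal (W0_ideal (scalars :: 'c ring)) (K0 scalars)"
proof -
  interpret cring "K0 (scalars :: 'c ring)" by (rule cring_K0)
  show ?thesis
    unfolding W0_ideal_def
    by (rule genideal_ideal) (auto simp: carrier_K0 K0_class_def endo_rep_in_endo_pairs)
qed

text \<open>The counterpart of \<open>K0_coset_eq\<close> one level up: elements of
  \<open>W0\<close> are sets of cosets, and the ideal leaves only the entries k \<ge> 1 to
  compare.\<close>

lemma W0_class_eq:
  fixes c :: "('c, nat \<Rightarrow> 'c) endo \<Rightarrow>\<^sub>0 int"
  assumes c: "c \<in> virtual"
  shows "W0_class c = {K0_coset scalars d | d. d \<in> virtual \<and> (\<forall>k\<ge>1. ghost d k = ghost c k)}"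
proof -
  have mem: "x \<in> W0_class c \<longleftrightarrow>
      (\<exists>h. (h \<in> virtual \<and> (\<forall>k\<ge>1. ghost h k = 0)) \<and> x = K0_coset scalars (h + c))" for x
  proof -
    have "x \<in> W0_class c \<longleftrightarrow>
        (\<exists>y\<in>W0_ideal scalars. x = y \<oplus>\<^bsub>K0 scalars\<^esub> K0_coset scalars c)"
      by (simp add: W0_class_def a_r_coset_def')
    also have "\<dots> \<longleftrightarrow> (\<exists>h. (h \<in> virtual \<and> (\<forall>k\<ge>1. ghost h k = 0)) \<and>
        x = K0_coset scalars h \<oplus>\<^bsub>K0 scalars\<^esub> K0_coset scalars c)"
      unfolding W0_ideal_eq by blast
    finally show ?thesis by (simp add: K0_add[OF _ c] cong: conj_cong)
  qed
  show ?thesis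
  proof (intro subset_antisym subsetI)
    fix x assume "x \<in> W0_class c"
    then obtain h where "x = K0_coset scalars (h + c)" "h \<in> virtual" "\<forall>k\<ge>1. ghost h k = 0"
      unfolding mem by blast
    then show "x \<in> {K0_coset scalars d | d. d \<in> virtual \<and> (\<forall>k\<ge>1. ghost d k = ghost c k)}"
      using c by (intro CollectI exI[of _ "h + c"]) (simp add: virtual_add)
  next
    fix x assume "x \<in> {K0_coset scalars d | d. d \<in> virtual \<and> (\<forall>k\<ge>1. ghost d k = ghost c k)}"
    then obtain d where "x = K0_coset scalars d" "d \<in> virtual" "\<forall>k\<ge>1. ghost d k = ghost c k"
      by blast
    then show "x \<in> W0_class c"
      unfolding mem using c by (intro exI[of _ "d - c"]) (simp add: virtual_diff)
  qed
qed

lemma W0_class_inject: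
  fixes c d :: "('c, nat \<Rightarrow> 'c) endo \<Rightarrow>\<^sub>0 int"
  assumes c: "c \<in> virtual" and d: "d \<in> virtual"
  shows "W0_class c = W0_class d \<longleftrightarrow> (\<forall>k\<ge>1. ghost c k = ghost d k)"
proof
  assume "W0_class c = W0_class d"
  then have "K0_coset scalars c \<in> W0_class d" using c by (auto simp: W0_class_eq)
  then show "\<forall>k\<ge>1. ghost c k = ghost d k"
    using c d by (auto simp: W0_class_eq K0_coset_inject)
qed (simp add: W0_class_eq c d)

lemma cring_W0: "cring (W0 (scalars :: 'c ring))"
  unfolding W0_def by (rule ideal.quotient_is_cring[OF ideal_W0_ideal cring_K0])

lemma W0_proj_hom:
  "(+>\<^bsub>K0 scalars\<^esub>) (W0_ideal scalars) \<in> ring_hom (K0 (scalars :: 'c ring)) (W0 scalars)"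
  unfolding W0_def by (rule ring_hom_cring.homh[OF ideal.rcos_ring_hom_cring[OF ideal_W0_ideal cring_K0]])

lemma W0_class_closed: "c \<in> virtual \<Longrightarrow> W0_class c \<in> carrier (W0 (scalars :: 'c ring))"
  unfolding W0_class_def
  by (rule ring_hom_closed[OF W0_proj_hom]) (rule K0_coset_closed)

lemma
  fixes c d :: "('c, nat \<Rightarrow> 'c) endo \<Rightarrow>\<^sub>0 int"
  assumes "c \<in> virtual" "d \<in> virtual"
  shows W0_class_add: "W0_class (c + d) = W0_class c \<oplus>\<^bsub>W0 scalars\<^esub> W0_class d"
    and W0_class_mult: "W0_class (frag_bilinear (endo_tensor scalars) c d) =
      W0_class c \<otimes>\<^bsub>W0 scalars\<^esub> W0_class d"
    and W0_class_one: "W0_class (frag_of (line_endo (1 :: 'c))) = \<one>\<^bsub>W0 scalars\<^esub>"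
proof -
  have "K0_coset scalars c \<in> carrier (K0 scalars)" "K0_coset scalars d \<in> carrier (K0 scalars)"
    using assms by (simp_all add: K0_coset_closed)
  from ring_hom_add[OF W0_proj_hom this] ring_hom_mult[OF W0_proj_hom this]
    ring_hom_one[OF W0_proj_hom]
  show
    "W0_class (c + d) = W0_class c \<oplus>\<^bsub>W0 scalars\<^esub> W0_class d"
    "W0_class (frag_bilinear (endo_tensor scalars) c d) = W0_class c \<otimes>\<^bsub>W0 scalars\<^esub> W0_class d"
    "W0_class (frag_of (line_endo (1 :: 'c))) = \<one>\<^bsub>W0 scalars\<^esub>"
    unfolding W0_class_def K0_add[OF assms] K0_mult[OF assms] K0_one by blast+
qed

text \<open>Frobenius and Verschiebung are handled together: both send a ghost vector to the one
  whose entry k is a weight \<open>r k\<close> times the old entry \<open>s k\<close>. The condition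
  on s ensures that no entry k \<ge> 1 of the image depends on entry 0, which is unknown in
  \<open>W0\<close>; this makes the induced map well defined.\<close>

lemma
  fixes g :: "('c, nat \<Rightarrow> 'c) endo \<Rightarrow> ('c, nat \<Rightarrow> 'c) endo"
  assumes g: "g \<in> endo_pairs scalars \<rightarrow> endo_pairs scalars"
    and ghost_g: "\<forall>V\<in>endo_pairs scalars. \<forall>k. endo_ghost (g V) k = r k * endo_ghost V (s k)"
    and s: "\<forall>k\<ge>1. s k \<ge> 1 \<or> r k = 0" and c: "c \<in> virtual"
  shows W0_map_W0_class:
      "W0_map scalars g (W0_class c) = W0_class (frag_extend (\<lambda>V. frag_of (g V)) c)"
    and W0_map_ghost: "ghost (frag_extend (\<lambda>V. frag_of (g V)) c) k = r k * ghost c (s k)"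
    and W0_map_virtual: "frag_extend (\<lambda>V. frag_of (g V)) c \<in> virtual"
proof -
  let ?G = "frag_extend (\<lambda>V. frag_of (g V))"
  have G: "?G d \<in> virtual" if "d \<in> virtual" for d
    unfolding virtual_def mem_Collect_eq
  proof (rule keys_frag_extend_subset)
    fix V assume "V \<in> Poly_Mapping.keys d"
    then have "V \<in> endo_pairs scalars" using that unfolding virtual_def by blast
    then show "Poly_Mapping.keys (frag_of (g V)) \<subseteq> endo_pairs scalars"
      using funcset_mem[OF g] by simp
  qed
  have ghost_G: "ghost (?G d) k = r k * ghost d (s k)" if "d \<in> virtual" for d k
  proof -
    have "ghost (?G d) k = frag_eval (\<lambda>V. r k * endo_ghost V (s k)) d"
      unfolding ghost_def frag_eval_extend
    proof (rule frag_eval_cong)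
      fix V assume "V \<in> Poly_Mapping.keys d"
      then have "V \<in> endo_pairs scalars" using that unfolding virtual_def by blast
      then show "frag_eval (\<lambda>V. endo_ghost V k) (frag_of (g V)) = r k * endo_ghost V (s k)"
        by (simp add: ghost_g)
    qed
    then show ?thesis unfolding frag_eval_mult_right ghost_def .
  qed
  \<comment> \<open>Two nested unions have to collapse: this one over the representatives of a
    coset, and then the one over the cosets that make up an element of \<open>W0\<close>.\<close>
  have K0: "K0_map scalars g (K0_coset scalars d) = K0_coset scalars (?G d)" if d: "d \<in> virtual" for d
  proof -
    have "K0_coset scalars (?G d') = K0_coset scalars (?G d)" if "d' \<in> K0_coset scalars d" for d'
      using that d by (simp add: K0_coset_eq[OF char0] G ghost_G)
    moreover have "d \<in> K0_coset scalars d" using d by (simp add: K0_coset_eq[OF char0])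
    ultimately show ?thesis unfolding K0_map_def by blast
  qed
  have "W0_ideal scalars +>\<^bsub>K0 scalars\<^esub> K0_map scalars g C = W0_class (?G c)"
    if "C \<in> W0_class c" for C
  proof -
    obtain d where d: "C = K0_coset scalars d" "d \<in> virtual" "\<forall>k\<ge>1. ghost d k = ghost c k"
      using \<open>C \<in> W0_class c\<close> c by (auto simp: W0_class_eq)
    have "r k * ghost d (s k) = r k * ghost c (s k)" if "k \<ge> 1" for k
      using s that d(3) by fastforce
    then have "W0_class (?G d) = W0_class (?G c)"
      using c d by (simp add: W0_class_inject G ghost_G)
    then show ?thesis using d by (simp add: K0 W0_class_def)
  qed
  moreover have "K0_coset scalars c \<in> W0_class c"
    using c by (auto simp: W0_class_eq)
  ultimately show "W0_map scalars g (W0_class c) = W0_class (?G c)"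
    unfolding W0_map_def by blast
  show "ghost (?G c) k = r k * ghost c (s k)" "?G c \<in> virtual"
    using c by (simp_all add: G ghost_G)
qed

end

section \<open>The Bost-Connes system inside \<open>W\<^sub>0\<close>\<close>

lemma group_ring_simps [simp]:
  "c \<in> carrier (group_ring \<Sigma>) \<longleftrightarrow> Poly_Mapping.keys c \<subseteq> \<Sigma>"
  "mult (group_ring \<Sigma>) = frag_bilinear (*)" "one (group_ring \<Sigma>) = frag_of 1"
  "zero (group_ring \<Sigma>) = 0" "add (group_ring \<Sigma>) = (+)"
  by (simp_all add: group_ring_def)

lemma frag_eval_power_mult:
  fixes c d :: "'a::comm_ring_1 \<Rightarrow>\<^sub>0 int"
  shows "frag_eval (\<lambda>x. x ^ k) (frag_bilinear (*) c d) =
    frag_eval (\<lambda>x. x ^ k) c * frag_eval (\<lambda>x. x ^ k) d"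
  by (intro frag_eval_bilinear power_mult_distrib)

text \<open>The power sums with exponents k \<ge> 0 separate formal sums and turn the product into a
  pointwise product, so the multiplicative laws come from the field, as for
  \<open>K0\<close>.\<close>

lemma cring_group_ring:
  fixes \<Sigma> :: "'a::field set"
  assumes char: "CHAR('a) = 0" and one: "1 \<in> \<Sigma>"
    and mult: "\<And>x y. x \<in> \<Sigma> \<Longrightarrow> y \<in> \<Sigma> \<Longrightarrow> x * y \<in> \<Sigma>"
  shows "cring (group_ring \<Sigma>)"
proof (rule cringI)
  note eqI = frag_eval_powers_inject0[OF char]
  have closed: "Poly_Mapping.keys (frag_bilinear (*) c d) \<subseteq> \<Sigma>"
    if "Poly_Mapping.keys c \<subseteq> \<Sigma>" "Poly_Mapping.keys d \<subseteq> \<Sigma>" for c d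
    by (intro keys_frag_bilinear_subset mult) (use that in blast)+
  show "abelian_group (group_ring \<Sigma>)"
  proof (rule abelian_groupI)
    fix c assume "c \<in> carrier (group_ring \<Sigma>)"
    then show "\<exists>d\<in>carrier (group_ring \<Sigma>). d \<oplus>\<^bsub>group_ring \<Sigma>\<^esub> c = \<zero>\<^bsub>group_ring \<Sigma>\<^esub>"
      by (intro bexI[of _ "- c"]) simp_all
  qed (simp_all add: keys_add_subset algebra_simps)
  show "comm_monoid (group_ring \<Sigma>)"
  proof (rule comm_monoidI)
    fix c d e :: "'a \<Rightarrow>\<^sub>0 int"
    show "c \<otimes>\<^bsub>group_ring \<Sigma>\<^esub> d \<otimes>\<^bsub>group_ring \<Sigma>\<^esub> e = c \<otimes>\<^bsub>group_ring \<Sigma>\<^esub> (d \<otimes>\<^bsub>group_ring \<Sigma>\<^esub> e)"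
      by (rule eqI) (simp add: frag_eval_power_mult mult.assoc)
    show "c \<otimes>\<^bsub>group_ring \<Sigma>\<^esub> d = d \<otimes>\<^bsub>group_ring \<Sigma>\<^esub> c"
      by (rule eqI) (simp add: frag_eval_power_mult mult.commute)
    show "\<one>\<^bsub>group_ring \<Sigma>\<^esub> \<otimes>\<^bsub>group_ring \<Sigma>\<^esub> c = c"
      by (rule eqI) (simp add: frag_eval_power_mult)
  qed (simp_all add: closed one)
  show "(c \<oplus>\<^bsub>group_ring \<Sigma>\<^esub> d) \<otimes>\<^bsub>group_ring \<Sigma>\<^esub> e =
      c \<otimes>\<^bsub>group_ring \<Sigma>\<^esub> e \<oplus>\<^bsub>group_ring \<Sigma>\<^esub> d \<otimes>\<^bsub>group_ring \<Sigma>\<^esub> e" for c d e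
    by (rule eqI) (simp add: frag_eval_power_mult frag_eval_add distrib_right)
qed

lemma char_0_of_ring_hom:
  fixes i :: "'k::field_char_0 \<Rightarrow> 'c::field"
  assumes i: "i \<in> ring_hom ring_of_type_algebra ring_of_type_algebra"
  shows "CHAR('c) = 0"
proof -
  have add: "i (x + y) = i x + i y" and mult: "i (x * y) = i x * i y" and one: "i 1 = 1" for x y
    using i by (auto simp: ring_hom_def)
  have zero: "i 0 = 0" using add[of 0 0] by (metis add_0 add_cancel_right_right)
  have "i (of_nat n) = of_nat n" for n
    by (induction n) (simp_all add: zero add one)
  moreover have "i x \<noteq> 0" if "x \<noteq> 0" for x
    using mult[of x "inverse x"] that one by auto
  ultimately have "(of_nat n :: 'c) \<noteq> 0" if "n > 0" for n
    using that by (metis of_nat_eq_0_iff neq0_conv)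
  then show ?thesis by (simp add: CHAR_eq0_iff)
qed

lemma cyclotomic_datumD:
  fixes \<Sigma> :: "'c::field set"
  assumes "cyclotomic_datum i \<Sigma>"
  shows "1 \<in> \<Sigma>" "\<And>x y. x \<in> \<Sigma> \<Longrightarrow> y \<in> \<Sigma> \<Longrightarrow> x * y \<in> \<Sigma>" "0 \<notin> \<Sigma>"
    "\<And>x n. x \<in> \<Sigma> \<Longrightarrow> n \<ge> 1 \<Longrightarrow> \<exists>y\<in>\<Sigma>. y ^ n = x"
    "\<And>z n. n \<ge> 1 \<Longrightarrow> z ^ n = 1 \<Longrightarrow> z \<in> \<Sigma>"
proof -
  have sub: "subgroup \<Sigma> (units_of (scalars :: 'c ring))"
    using assms by (simp add: cyclotomic_datum_def)
  show "1 \<in> \<Sigma>" using subgroup.one_closed[OF sub] by (simp add: units_of_def)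
  show "x * y \<in> \<Sigma>" if "x \<in> \<Sigma>" "y \<in> \<Sigma>" for x y
    using subgroup.m_closed[OF sub that] by (simp add: units_of_def)
  show "0 \<notin> \<Sigma>" using subgroup.subset[OF sub] by (auto simp: units_of_def Units_def)
qed (use assms in \<open>auto simp: cyclotomic_datum_def roots_of_unity_def\<close>)

lemma frag_eval_bc_sigma: "frag_eval (\<lambda>x. x ^ k) (bc_sigma n c) = frag_eval (\<lambda>x. x ^ (n * k)) c"
  by (simp add: bc_sigma_def frag_eval_extend power_mult)

text \<open>Divisibility puts one n-th root y of x into \<Sigma>, and the roots of unity in \<Sigma>
  supply the others as multiples of y. So the sum over roots in \<Sigma> is the sum over all n-th
  roots in the field.\<close>

lemma frag_eval_bc_rho:
  fixes \<Sigma> :: "'c::alg_closed_field set"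
  assumes \<Sigma>: "cyclotomic_datum i \<Sigma>" and char: "CHAR('c) = 0" and n: "n \<ge> 1"
    and c: "Poly_Mapping.keys c \<subseteq> \<Sigma>"
  shows "frag_eval (\<lambda>x. x ^ k) (bc_rho \<Sigma> n c) =
    (if n dvd k then of_nat n else 0) * frag_eval (\<lambda>x. x ^ (k div n)) c"
proof -
  note \<Sigma> = cyclotomic_datumD[OF \<Sigma>]
  have n0: "(of_nat n :: 'c) \<noteq> 0" using char n by (simp add: of_nat_eq_0_iff_char_dvd)
  have "(\<Sum>z | z \<in> \<Sigma> \<and> z ^ n = x. z ^ k) = (if n dvd k then of_nat n else 0) * x ^ (k div n)"
    if x: "x \<in> \<Sigma>" for x
  proof -
    obtain y where y: "y \<in> \<Sigma>" "y ^ n = x" using \<Sigma>(4)[OF x n] by blast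
    have y0: "y \<noteq> 0" using y(1) \<Sigma>(3) by auto
    have "z \<in> \<Sigma>" if "z ^ n = y ^ n" for z
    proof -
      have "(z / y) ^ n = 1" using that y0 by (simp add: power_divide)
      then have "y * (z / y) \<in> \<Sigma>" by (intro \<Sigma>(2)[OF y(1)] \<Sigma>(5)[OF n])
      then show ?thesis using y0 by simp
    qed
    then have "{z. z \<in> \<Sigma> \<and> z ^ n = x} = {z. z ^ n = y ^ n}" using y(2) by auto
    then show ?thesis
      using sum_powers_nth_roots[OF n0 y0, of k] y(2) by simp
  qed
  moreover have "frag_eval (\<lambda>x. x ^ k) (bc_rho \<Sigma> n c) =
      frag_eval (\<lambda>x. \<Sum>z | z \<in> \<Sigma> \<and> z ^ n = x. z ^ k) c"
    by (simp add: bc_rho_def frag_eval_extend frag_eval_sum)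
  ultimately have "frag_eval (\<lambda>x. x ^ k) (bc_rho \<Sigma> n c) =
      frag_eval (\<lambda>x. (if n dvd k then of_nat n else 0) * x ^ (k div n)) c"
    using c by (metis (no_types, lifting) frag_eval_cong subsetD)
  then show ?thesis by (simp only: frag_eval_mult_right)
qed

theorem proposition3:
  fixes j :: "'r::idom \<Rightarrow> 'k::field_char_0"
    and i :: "'k \<Rightarrow> 'c::alg_closed_field"
    and \<Sigma> :: "'c set"
  assumes "is_fraction_field j"
    and "is_algebraic_closure i"
    and "cyclotomic_datum i \<Sigma>"
  shows "\<exists>\<phi>. ring_hom_cring (group_ring \<Sigma>) (W0 (ring_of_type_algebra :: 'c ring)) \<phi> \<and>
             inj_on \<phi> (carrier (group_ring \<Sigma>)) \<and>
             (\<forall>n\<ge>1. \<forall>c\<in>carrier (group_ring \<Sigma>).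
                \<phi> (bc_sigma n c) = W0_frob ring_of_type_algebra n (\<phi> c) \<and>
                \<phi> (bc_rho \<Sigma> n c) = W0_versch ring_of_type_algebra n (\<phi> c))"
proof -
  have char: "CHAR('c) = 0"
    using assms(2) by (intro char_0_of_ring_hom[of i]) (simp add: is_algebraic_closure_def)
  note \<Sigma> = cyclotomic_datumD[OF assms(3)]
  define \<phi> :: "('c \<Rightarrow>\<^sub>0 int) \<Rightarrow> _" where "\<phi> = (\<lambda>c. W0_class (line_sum c))"
  note W0_eq = W0_class_inject[OF char]
  have "ring_hom_cring (group_ring \<Sigma>) (W0 (scalars :: 'c ring)) \<phi>"
  proof (intro ring_hom_cring.intro ring_hom_cring_axioms.intro ring_hom_memI)
    show "cring (group_ring \<Sigma>)" by (rule cring_group_ring[OF char \<Sigma>(1,2)])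
    show "cring (W0 (scalars :: 'c ring))" by (rule cring_W0[OF char])
    fix c d
    show "\<phi> c \<in> carrier (W0 scalars)"
      unfolding \<phi>_def by (rule W0_class_closed[OF char line_sum_virtual])
    show "\<phi> (c \<oplus>\<^bsub>group_ring \<Sigma>\<^esub> d) = \<phi> c \<oplus>\<^bsub>W0 scalars\<^esub> \<phi> d"
      by (simp add: \<phi>_def line_sum_add W0_class_add[OF char] line_sum_virtual)
    \<comment> \<open>The tensor product of two lines is some chosen object, possibly different from
      the line of the product, so the two formal sums are compared through their ghosts.\<close>
    show "\<phi> (c \<otimes>\<^bsub>group_ring \<Sigma>\<^esub> d) = \<phi> c \<otimes>\<^bsub>W0 scalars\<^esub> \<phi> d"
      unfolding \<phi>_def W0_class_mult[OF char line_sum_virtual line_sum_virtual, symmetric]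
      by (subst W0_eq) (simp_all add: line_sum_virtual virtual_tensor ghost_tensor ghost_line_sum
          frag_eval_power_mult)
    show "\<phi> \<one>\<^bsub>group_ring \<Sigma>\<^esub> = \<one>\<^bsub>W0 scalars\<^esub>"
      using W0_class_one[OF char line_sum_virtual line_sum_virtual] by (simp add: \<phi>_def line_sum_of)
  qed
  moreover have "inj_on \<phi> (carrier (group_ring \<Sigma>))"
  proof (rule inj_onI)
    fix c d assume c: "c \<in> carrier (group_ring \<Sigma>)" and d: "d \<in> carrier (group_ring \<Sigma>)"
      and "\<phi> c = \<phi> d"
    then have "frag_eval (\<lambda>x. x ^ k) c = frag_eval (\<lambda>x. x ^ k) d" if "k \<ge> 1" for k
      using that by (simp add: \<phi>_def W0_eq line_sum_virtual ghost_line_sum)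
    then show "c = d"
      using c d \<Sigma>(3) by (intro frag_eval_powers_inject[OF char]) auto
  qed
  moreover have "\<phi> (bc_sigma n c) = W0_frob scalars n (\<phi> c)" if n: "n \<ge> 1" for n c
  proof -
    \<comment> \<open>Frobenius reads entry n * k with weight 1, and this index stays at least 1
      because n does.\<close>
    have "endo_frob n \<in> endo_pairs (scalars :: 'c ring) \<rightarrow> endo_pairs scalars"
      and "\<forall>V\<in>endo_pairs (scalars :: 'c ring). \<forall>k.
        endo_ghost (endo_frob n V) k = 1 * endo_ghost V (n * k)"
      and "\<forall>k\<ge>1. n * k \<ge> 1 \<or> (1 :: 'c) = 0"
      using n by (simp_all add: endo_frob_in_endo_pairs endo_ghost_frob)
    note map = this line_sum_virtual[of c]
    show ?thesis
      unfolding W0_frob_def \<phi>_def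
      by (subst W0_map_W0_class[OF char map], subst W0_eq)
        (simp_all add: line_sum_virtual W0_map_virtual[OF char map] W0_map_ghost[OF char map]
          ghost_line_sum frag_eval_bc_sigma)
  qed
  moreover have "\<phi> (bc_rho \<Sigma> n c) = W0_versch scalars n (\<phi> c)"
    if n: "n \<ge> 1" and c: "c \<in> carrier (group_ring \<Sigma>)" for n c
  proof -
    let ?r = "\<lambda>k. if n dvd k then of_nat n else (0 :: 'c)"
    have versch: "(\<lambda>V. endo_rep scalars (endo_versch n V)) \<in>
        endo_pairs (scalars :: 'c ring) \<rightarrow> endo_pairs scalars"
      and ghost: "\<forall>V\<in>endo_pairs (scalars :: 'c ring). \<forall>k.
        endo_ghost (endo_rep scalars (endo_versch n V)) k = ?r k * endo_ghost V (k div n)"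
      by (simp_all add: endo_rep_in_endo_pairs endo_ghost_endo_rep
          endo_versch_in_endo_pairs endo_ghost_versch)
    \<comment> \<open>For k \<ge> 1 the index k div n is 0 only when k < n; then n does not divide k
      and the weight vanishes.\<close>
    have pos: "\<forall>k\<ge>1. k div n \<ge> 1 \<or> ?r k = 0"
      using n by (auto elim!: dvdE)
    note map = versch ghost pos line_sum_virtual[of c]
    show ?thesis
      unfolding W0_versch_def \<phi>_def using c
      by (subst W0_map_W0_class[OF char map], subst W0_eq)
        (simp_all add: line_sum_virtual W0_map_virtual[OF char map] W0_map_ghost[OF char map]
          ghost_line_sum frag_eval_bc_rho[OF assms(3) char n])
  qed
  ultimately show ?thesis by blast
qed

end
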